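(* Let $N\ge 1$ be an integer and let $p,q,a,b\ge 0$ be real numbers with $pq>1$ and $$0\le a-b\le (N-2)(p-q).$$ Suppose that $\frac{pq(q+1)}{p+1}\ge 1$ and $$N<2+2\left(\frac{p(b+2)+a+2}{pq-1}\right)\left(\sqrt{\frac{pq(q+1)}{p+1}}+\sqrt{\frac{pq(q+1)}{p+1}-\sqrt{\frac{pq(q+1)}{p+1}}}\right).$$ Then the system $$-\Delta u=|x|^{a}v^{p}\ \text{ in }\mathbb{R}^N,\qquad -\Delta v=|x|^{b}u^{q}\ \text{ in }\mathbb{R}^N$$ has no positive stable solution.
   Context: A positive stable solution is a classical solution $(u,v)$ of the system with $u,v>0$ on $\mathbb{R}^N$ that is pointwise stable: there exist positive smooth functions $\zeta,\eta$ on $\mathbb{R}^N$ such that $$-\Delta\zeta=p|x|^{a}v^{p-1}\eta,\qquad -\Delta\eta=q|x|^{b}u^{q-1}\zeta\qquad\text{in }\mathbb{R}^N .$$ *)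

theory Defs
  imports "HOL-Analysis.Analysis"
begin

definition partial_derivative :: "'n::finite \<Rightarrow> (real^'n \<Rightarrow> real) \<Rightarrow> real^'n \<Rightarrow> real"
  where "partial_derivative i f x = frechet_derivative f (at x) (axis i 1)"

text \<open>\<open>k\<close> times continuously differentiable on the whole space. Since \<^const>\<open>frechet_derivative\<close>
  is a choice operator, differentiability is demanded explicitly at every level.\<close>

primrec C_k :: "nat \<Rightarrow> (real^'n::finite \<Rightarrow> real) \<Rightarrow> bool"
  where
    "C_k 0 f \<longleftrightarrow> continuous_on UNIV f"
  | "C_k (Suc k) f \<longleftrightarrow>
      f differentiable_on UNIV \<and> (\<forall>i. C_k k (partial_derivative i f))"

definition laplacian :: "(real^'n::finite \<Rightarrow> real) \<Rightarrow> real^'n \<Rightarrow> real"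
  where "laplacian f x = (\<Sum>i\<in>UNIV. partial_derivative i (partial_derivative i f) x)"

text \<open>The weight \<open>\<bar>x\<bar>\<^sup>a\<close> for \<open>a \<ge> 0\<close>, with \<open>\<bar>x\<bar>\<^sup>0 = 1\<close> also at the origin; the library's
  \<open>0 powr 0 = 0\<close> would make the equations unsatisfiable at \<open>x = 0\<close> when \<open>a = 0\<close>.\<close>

definition weight :: "real \<Rightarrow> real^'n::finite \<Rightarrow> real"
  where "weight a x = (if a = 0 then 1 else norm x powr a)"

definition positive_classical_solution ::
    "real \<Rightarrow> real \<Rightarrow> real \<Rightarrow> real \<Rightarrow> (real^'n::finite \<Rightarrow> real) \<Rightarrow> (real^'n \<Rightarrow> real) \<Rightarrow> bool"
  where "positive_classical_solution a b p q u v \<longleftrightarrow>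
    C_k 2 u \<and> C_k 2 v \<and>
    (\<forall>x. u x > 0) \<and> (\<forall>x. v x > 0) \<and>
    (\<forall>x. - laplacian u x = weight a x * v x powr p) \<and>
    (\<forall>x. - laplacian v x = weight b x * u x powr q)"

text \<open>The functions \<open>\<zeta>\<close> and \<open>\<eta>\<close> are only required to be of class \<open>C\<^sup>2\<close>, so that the linearised
  equations hold classically. Unless \<open>a\<close> and \<open>b\<close> are even integers, the weights are not smooth
  at the origin, and no \<open>C\<^sup>\<infinity>\<close> pair could satisfy these equations.\<close>

definition pointwise_stable ::
    "real \<Rightarrow> real \<Rightarrow> real \<Rightarrow> real \<Rightarrow> (real^'n::finite \<Rightarrow> real) \<Rightarrow> (real^'n \<Rightarrow> real) \<Rightarrow> bool"
  where "pointwise_stable a b p q u v \<longleftrightarrow>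
    (\<exists>\<zeta> \<eta> :: real^'n \<Rightarrow> real.
      C_k 2 \<zeta> \<and> C_k 2 \<eta> \<and>
      (\<forall>x. \<zeta> x > 0) \<and> (\<forall>x. \<eta> x > 0) \<and>
      (\<forall>x. - laplacian \<zeta> x = p * weight a x * v x powr (p - 1) * \<eta> x) \<and>
      (\<forall>x. - laplacian \<eta> x = q * weight b x * u x powr (q - 1) * \<zeta> x))"

definition positive_stable_solution ::
    "real \<Rightarrow> real \<Rightarrow> real \<Rightarrow> real \<Rightarrow> (real^'n::finite \<Rightarrow> real) \<Rightarrow> (real^'n \<Rightarrow> real) \<Rightarrow> bool"
  where "positive_stable_solution a b p q u v \<longleftrightarrow>
    positive_classical_solution a b p q u v \<and> pointwise_stable a b p q u v"

end

theory Submission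
  imports Defs
begin

text \<open>
  Let \<open>\<beta> = (p (b + 2) + a + 2) / (pq - 1)\<close> be the exponent for which \<open>\<bar>x\<bar>\<^sup>-\<^sup>\<beta>\<close> is the scaling of the first component,
  and \<open>K = \<surd>(pq (q + 1) / (p + 1))\<close>. Positive superharmonic functions satisfy a weak Harnack inequality, and with it
  the two equations force the mean of \<open>u\<close> over the ball of radius \<open>R\<close> to be at most a multiple of \<open>R\<^sup>-\<^sup>\<beta>\<close>
  (\<open>ball_integral_decay\<close>). For \<open>N < 2 + \<beta>\<close> this already contradicts the equation of \<open>u\<close>
  (\<open>no_positive_solution_low_dimension\<close>). Otherwise \<open>N > 2\<close>, so \<open>q \<le> p\<close>, and the components are comparable:
  \<open>\<bar>x\<bar>\<^sup>a v\<^sup>p\<^sup>+\<^sup>1 / (p + 1) \<le> \<bar>x\<bar>\<^sup>b u\<^sup>q\<^sup>+\<^sup>1 / (q + 1)\<close> (\<open>component_comparison\<close>).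

  Stability bounds the integral of \<open>\<surd>(pq \<bar>x\<bar>\<^sup>a\<^sup>+\<^sup>b v\<^sup>p\<^sup>-\<^sup>1 u\<^sup>q\<^sup>-\<^sup>1) \<phi> \<omega>\<close> by the mean of the Dirichlet energies of \<open>\<phi>\<close> and \<open>\<omega>\<close>
  (\<open>stability_inequality\<close>). Test it with \<open>\<phi> = \<omega> = u\<^sup>t \<psi>\<close> for a cutoff \<open>\<psi>\<close>. The comparison turns the left side into at
  least \<open>K\<close> times the integral of \<open>f = \<bar>x\<bar>\<^sup>a v\<^sup>p u\<^sup>2\<^sup>t\<^sup>-\<^sup>1\<close>, and the equation of \<open>u\<close> evaluates the right side as \<open>t\<^sup>2 / (2t - 1)\<close>
  times the same integral plus terms of the cutoff (\<open>energy_identity\<close>). So for \<open>t\<^sup>2 < K (2t - 1)\<close>, that is for \<open>t\<close>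
  between the roots \<open>K \<plusminus> \<surd>(K\<^sup>2 - K)\<close>, one obtains a Caccioppoli estimate: the energy of \<open>u\<^sup>t \<psi>\<close> and the integral
  of \<open>f\<close> are controlled by the square integral of \<open>u\<^sup>t\<close> (\<open>caccioppoli_coercive\<close>). If \<open>K = 1\<close> the roots coincide and this is
  not coercive; then a second test function, built from \<open>v\<close>, gives the missing strictness (\<open>caccioppoli_critical\<close>).

  Only the mean of the first power of \<open>u\<close> is known to decay. A local Nash inequality, whose first-power
  term is truncated at a level of \<open>u\<close>, upgrades the Caccioppoli estimate to the scaling bound \<open>R\<^sup>N\<^sup>-\<^sup>2\<^sup>t\<^sup>\<beta>\<close> for the
  integral of \<open>u\<^sup>2\<^sup>t\<close> directly for the given \<open>t\<close>, without a bootstrap through intermediate exponents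
  (\<open>caccioppoli_decay\<close>). Consequently the integral of \<open>f\<close> is at most a multiple of \<open>R\<^sup>N\<^sup>-\<^sup>2\<^sup>-\<^sup>2\<^sup>t\<^sup>\<beta>\<close>. The hypothesis on \<open>N\<close> says
  that this exponent is negative for \<open>t\<close> close to the larger root, so \<open>f\<close> would vanish, which is absurd.
\<close>

section \<open>Gradients, Laplacians and integration by parts\<close>

definition bdd_support :: "(real^'n::finite \<Rightarrow> real) \<Rightarrow> bool"
  where "bdd_support f \<longleftrightarrow> (\<exists>r. \<forall>x. norm x > r \<longrightarrow> f x = 0)"

text \<open>The derivative is carried as an explicit vector field, so that products and compositions are
differentiated by rules and not by evaluating \<^const>\<open>frechet_derivative\<close>. Continuity of the field is
part of the notion because integration by parts needs it.\<close>

definition has_gradient :: "(real^'n::finite \<Rightarrow> real) \<Rightarrow> (real^'n \<Rightarrow> real^'n) \<Rightarrow> bool"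
  where "has_gradient f G \<longleftrightarrow>
    (\<forall>x. (f has_derivative (\<lambda>h. G x \<bullet> h)) (at x)) \<and> continuous_on UNIV G"

definition has_divergence :: "(real^'n::finite \<Rightarrow> real^'n) \<Rightarrow> (real^'n \<Rightarrow> real) \<Rightarrow> bool"
  where "has_divergence G D \<longleftrightarrow>
    (\<exists>J. (\<forall>i. has_gradient (\<lambda>x. G x $ i) (J i)) \<and> (\<forall>x. D x = (\<Sum>i\<in>UNIV. J i x $ i)))"

text \<open>A \<open>C\<^sup>2\<close> function with its gradient and Laplacian. Second derivatives enter only through the
divergence of the gradient, hence no Hessian is mentioned.\<close>

definition has_laplacian ::
    "(real^'n::finite \<Rightarrow> real) \<Rightarrow> (real^'n \<Rightarrow> real^'n) \<Rightarrow> (real^'n \<Rightarrow> real) \<Rightarrow> bool"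
  where "has_laplacian f G L \<longleftrightarrow> has_gradient f G \<and> has_divergence G L"

lemma bdd_support_mult [intro]:
  "bdd_support f \<Longrightarrow> bdd_support (\<lambda>x. f x * g x)"
  "bdd_support g \<Longrightarrow> bdd_support (\<lambda>x. f x * g x)"
  by (fastforce simp: bdd_support_def)+

lemma bdd_support_vanish:
  assumes "bdd_support f" "\<And>x. f x = 0 \<Longrightarrow> g x = 0"
  shows "bdd_support g"
  using assms by (fastforce simp: bdd_support_def)

lemma bdd_supportI: "(\<And>x. norm x > r \<Longrightarrow> f x = 0) \<Longrightarrow> bdd_support f"
  by (auto simp: bdd_support_def)

lemma integrable_bdd_support:
  fixes f :: "real^'n::finite \<Rightarrow> real"
  assumes "continuous_on UNIV f" "bdd_support f"
  shows "integrable lborel f"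
proof -
  obtain r where r: "\<And>x. norm x > r \<Longrightarrow> f x = 0"
    using assms(2) by (auto simp: bdd_support_def)
  have "integrable lborel (\<lambda>x. indicator (cball 0 r) x *\<^sub>R f x)"
    using assms(1) by (intro borel_integrable_compact continuous_on_subset[OF assms(1)]) auto
  also have "(\<lambda>x. indicator (cball 0 r) x *\<^sub>R f x) = f"
    using r by (auto simp: fun_eq_iff indicator_def)
  finally show ?thesis .
qed

text \<open>Beyond a fixed radius everything vanishes, so the integral is one over a box, where the Leibniz
rule of Henstock-Kurzweil integration applies.\<close>

lemma DERIV_integral_parameter:
  fixes f f' :: "real \<Rightarrow> real^'n::finite \<Rightarrow> real"
  assumes d: "\<And>t x. t \<in> U \<Longrightarrow> ((\<lambda>t. f t x) has_real_derivative f' t x) (at t within U)"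
    and c': "continuous_on (U \<times> UNIV) (\<lambda>(t, x). f' t x)"
    and c: "\<And>t. t \<in> U \<Longrightarrow> continuous_on UNIV (f t)"
    and z: "\<And>t x. t \<in> U \<Longrightarrow> norm x > r \<Longrightarrow> f t x = 0"
    and z': "\<And>t x. t \<in> U \<Longrightarrow> norm x > r \<Longrightarrow> f' t x = 0"
    and U: "t0 \<in> U" "convex U"
  shows "((\<lambda>t. LBINT x. f t x) has_real_derivative (LBINT x. f' t0 x)) (at t0 within U)"
proof -
  obtain a b :: "real^'n" where ab: "cball 0 r \<subseteq> cbox a b"
    using bounded_subset_cbox_symmetric[OF bounded_cball] by metis
  have out: "norm x > r" if "x \<notin> cbox a b" for x
    using that ab by (auto simp: subset_eq not_le[symmetric])
  have eq: "(LBINT x. g x) = integral (cbox a b) g"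
    if "continuous_on UNIV g" "\<And>x. norm x > r \<Longrightarrow> g x = 0" for g :: "real^'n \<Rightarrow> real"
  proof -
    have "(LBINT x. g x) = integral UNIV g"
      using that by (intro integral_lborel[symmetric] integrable_bdd_support bdd_supportI)
    also have "\<dots> = integral UNIV (\<lambda>x. if x \<in> cbox a b then g x else 0)"
      using that(2) out by (intro arg_cong[where f="integral UNIV"]) auto
    also have "\<dots> = integral (cbox a b) g"
      by (rule integral_restrict_UNIV)
    finally show ?thesis .
  qed
  have c'': "continuous_on UNIV (f' t)" if "t \<in> U" for t
  proof -
    have "continuous_on UNIV (\<lambda>x. case (t, x) of (t, x) \<Rightarrow> f' t x)"
      using that by (intro continuous_on_compose2[OF c'] continuous_intros) auto
    then show ?thesis by simp
  qed
  have "((\<lambda>t. integral (cbox a b) (f t)) has_real_derivative integral (cbox a b) (f' t0)) (at t0 within U)"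
    using d c U
    by (intro leibniz_rule_field_derivative continuous_on_subset[OF c'])
      (auto intro!: integrable_continuous continuous_on_subset[OF c])
  then have "((\<lambda>t. LBINT x. f t x) has_real_derivative integral (cbox a b) (f' t0)) (at t0 within U)"
    by (rule has_field_derivative_transform_within[OF _ zero_less_one U(1)]) (simp add: eq[OF c z])
  then show ?thesis
    by (simp add: eq[OF c''[OF U(1)] z'[OF U(1)]])
qed

lemma has_gradient_continuous:
  "has_gradient f G \<Longrightarrow> continuous_on UNIV f" "has_gradient f G \<Longrightarrow> continuous_on UNIV G"
  by (auto simp: has_gradient_def intro: continuous_at_imp_continuous_on dest: has_derivative_continuous)

lemma has_gradientI:
  "(\<And>x. (f has_derivative (\<lambda>h. G x \<bullet> h)) (at x)) \<Longrightarrow> continuous_on UNIV G \<Longrightarrow> has_gradient f G"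
  by (simp add: has_gradient_def)

lemma has_gradientD: "has_gradient f G \<Longrightarrow> (f has_derivative (\<lambda>h. G x \<bullet> h)) (at x)"
  by (simp add: has_gradient_def)

lemma has_gradient_const: "has_gradient (\<lambda>x. c) (\<lambda>x. 0)"
  by (auto simp: has_gradient_def)

lemma has_gradient_add:
  assumes f: "has_gradient f F" and g: "has_gradient g G"
  shows "has_gradient (\<lambda>x. f x + g x) (\<lambda>x. F x + G x)"
proof (rule has_gradientI)
  show "((\<lambda>x. f x + g x) has_derivative (\<lambda>h. (F x + G x) \<bullet> h)) (at x)" for x
    by (rule has_derivative_eq_rhs[OF has_derivative_add[OF has_gradientD[OF f] has_gradientD[OF g]]])
      (simp add: fun_eq_iff inner_add_left)
  show "continuous_on UNIV (\<lambda>x. F x + G x)"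
    by (intro continuous_on_add has_gradient_continuous(2)[OF f] has_gradient_continuous(2)[OF g])
qed

lemma has_gradient_mult:
  assumes f: "has_gradient f F" and g: "has_gradient g G"
  shows "has_gradient (\<lambda>x. f x * g x) (\<lambda>x. f x *\<^sub>R G x + g x *\<^sub>R F x)"
proof (rule has_gradientI)
  show "((\<lambda>x. f x * g x) has_derivative (\<lambda>h. (f x *\<^sub>R G x + g x *\<^sub>R F x) \<bullet> h)) (at x)" for x
    by (rule has_derivative_eq_rhs[OF has_derivative_mult[OF has_gradientD[OF f] has_gradientD[OF g]]])
      (simp add: fun_eq_iff inner_add_left mult.commute)
  show "continuous_on UNIV (\<lambda>x. f x *\<^sub>R G x + g x *\<^sub>R F x)"
    by (intro continuous_on_add continuous_on_scaleR has_gradient_continuous[OF f] has_gradient_continuous[OF g])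
qed

lemma has_gradient_cmult:
  "has_gradient f F \<Longrightarrow> has_gradient (\<lambda>x. c * f x) (\<lambda>x. c *\<^sub>R F x)"
  using has_gradient_mult[OF has_gradient_const[of c], of f F] by simp

lemma has_gradient_compose:
  assumes f: "has_gradient f F"
    and d: "\<And>x. (\<phi> has_real_derivative \<phi>' (f x)) (at (f x))"
    and c: "continuous_on UNIV (\<lambda>x. \<phi>' (f x))"
  shows "has_gradient (\<lambda>x. \<phi> (f x)) (\<lambda>x. \<phi>' (f x) *\<^sub>R F x)"
proof (rule has_gradientI)
  show "((\<lambda>x. \<phi> (f x)) has_derivative (\<lambda>h. (\<phi>' (f x) *\<^sub>R F x) \<bullet> h)) (at x)" for x
    using has_derivative_compose[OF has_gradientD[OF f], of \<phi> "(*) (\<phi>' (f x))"] d[of x]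
    by (simp add: has_field_derivative_def)
  show "continuous_on UNIV (\<lambda>x. \<phi>' (f x) *\<^sub>R F x)"
    by (intro continuous_on_scaleR c has_gradient_continuous(2)[OF f])
qed

lemma has_gradient_zero_off_support:
  assumes "has_gradient f F" "\<And>x. norm x > r \<Longrightarrow> f x = 0" "norm x > r"
  shows "F x = 0"
proof -
  have o: "open {x::real^'n. norm x > r}"
    by (intro open_Collect_less continuous_intros)
  have "(f has_derivative (\<lambda>h. F x \<bullet> h)) (at x)"
    using assms by (auto simp: has_gradient_def)
  moreover have "(f has_derivative (\<lambda>h. 0)) (at x)"
    by (rule has_derivative_transform_within_open[OF has_derivative_const[of 0] o]) (use assms in auto)
  ultimately have "(\<lambda>h. F x \<bullet> h) = (\<lambda>h. 0)"
    by (rule has_derivative_unique)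
  then show ?thesis
    using inner_eq_zero_iff by metis
qed

text \<open>Translating \<open>f\<close> along the \<open>i\<close>-th axis leaves its integral unchanged, so the derivative of
that constant vanishes; differentiating under the integral sign turns it into the integral of the
partial derivative. This replaces the divergence theorem.\<close>

lemma integral_partial_eq_0:
  fixes f :: "real^'n::finite \<Rightarrow> real"
  assumes f: "has_gradient f F" "bdd_support f"
  shows "(LBINT x. F x $ i) = 0"
proof -
  obtain r where r: "\<And>x. norm x > r \<Longrightarrow> f x = 0"
    using assms(2) by (auto simp: bdd_support_def)
  have F0: "F x = 0" if "norm x > r" for x
    using has_gradient_zero_off_support[OF f(1), of r] r that by blast
  note cont = has_gradient_continuous[OF f(1)]
  let ?U = "{-1..1::real}" and ?e = "axis i 1 :: real^'n"
  have far: "norm (x + t *\<^sub>R ?e) > r" if "t \<in> ?U" "norm x > r + 1" for t x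
  proof -
    have "norm x \<le> norm (x + t *\<^sub>R ?e) + norm (t *\<^sub>R ?e)"
      using norm_triangle_ineq4[of "x + t *\<^sub>R ?e" "t *\<^sub>R ?e"] by simp
    with that show ?thesis by auto
  qed
  have "((\<lambda>t. LBINT x. f (x + t *\<^sub>R ?e)) has_real_derivative (LBINT x. F (x + 0 *\<^sub>R ?e) $ i)) (at 0 within ?U)"
  proof (rule DERIV_integral_parameter)
    show "((\<lambda>t. f (x + t *\<^sub>R ?e)) has_real_derivative F (x + t *\<^sub>R ?e) $ i) (at t within ?U)" for t x
    proof -
      have "((\<lambda>t. x + t *\<^sub>R ?e) has_derivative (\<lambda>h. h *\<^sub>R ?e)) (at t within ?U)"
        by (rule derivative_eq_intros refl)+ simp
      from has_derivative_compose[OF this has_gradientD[OF f(1)]]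
      show ?thesis
        by (simp add: has_field_derivative_def inner_axis mult.commute[of _ "_ $ i"])
    qed
    show "continuous_on (?U \<times> UNIV) (\<lambda>(t, x). F (x + t *\<^sub>R ?e) $ i)"
      unfolding split_beta
      by (intro continuous_intros continuous_on_compose2[OF cont(2)]) auto
    show "continuous_on UNIV (\<lambda>x. f (x + t *\<^sub>R ?e))" for t
      by (intro continuous_intros continuous_on_compose2[OF cont(1)]) auto
    show "f (x + t *\<^sub>R ?e) = 0" "F (x + t *\<^sub>R ?e) $ i = 0" if "t \<in> ?U" "norm x > r + 1" for t x
      using r[OF far[OF that]] F0[OF far[OF that]] by auto
  qed auto
  moreover have "(LBINT x. f (x + t *\<^sub>R ?e)) = (LBINT x. f x)" for t
  proof -
    have "(\<integral>x. f (t *\<^sub>R ?e + x) \<partial>lborel) = (\<integral>x. f x \<partial>distr lborel borel ((+) (t *\<^sub>R ?e)))"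
      using cont(1) by (subst integral_distr) (auto intro: borel_measurable_continuous_onI)
    then show ?thesis by (simp add: lborel_distr_plus add.commute)
  qed
  ultimately have "((\<lambda>t. LBINT x. f x) has_real_derivative (LBINT x. F x $ i)) (at 0 within ?U)"
    by simp
  moreover have "((\<lambda>t. LBINT x. f x) has_real_derivative 0) (at 0 within ?U)"
    by simp
  moreover have "at (0::real) within ?U \<noteq> bot"
    by (simp add: at_within_Icc_at)
  ultimately show ?thesis
    by (metis has_field_derivative_unique)
qed

lemma has_divergence_continuous: "has_divergence G D \<Longrightarrow> continuous_on UNIV D"
proof -
  assume "has_divergence G D"
  then obtain J where J: "\<And>i. has_gradient (\<lambda>x. G x $ i) (J i)" "\<And>x. D x = (\<Sum>i\<in>UNIV. J i x $ i)"
    by (auto simp: has_divergence_def)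
  show ?thesis
    unfolding J(2) by (intro continuous_intros has_gradient_continuous(2)[OF J(1)])
qed

lemma has_divergence_field_continuous: "has_divergence G D \<Longrightarrow> continuous_on UNIV G"
proof -
  assume "has_divergence G D"
  then have "continuous_on UNIV (\<lambda>x. G x $ i)" for i
    using has_gradient_continuous(1) by (auto simp: has_divergence_def)
  then have "continuous_on UNIV (\<lambda>x. \<chi> i. G x $ i)"
    by (intro continuous_on_vec_lambda)
  then show ?thesis by simp
qed

lemma integration_by_parts:
  assumes G: "has_divergence G D" and f: "has_gradient f F" "bdd_support f"
  shows "(LBINT x. f x * D x) = - (LBINT x. F x \<bullet> G x)"
proof -
  obtain J where J: "\<And>i. has_gradient (\<lambda>x. G x $ i) (J i)" "\<And>x. D x = (\<Sum>i\<in>UNIV. J i x $ i)"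
    using G by (auto simp: has_divergence_def)
  obtain r where r: "\<And>x. norm x > r \<Longrightarrow> f x = 0"
    using f(2) by (auto simp: bdd_support_def)
  have F0: "F x = 0" if "norm x > r" for x
    using has_gradient_zero_off_support[OF f(1), of r] r that by blast
  note cont = has_gradient_continuous[OF f(1)] has_divergence_continuous[OF G] has_divergence_field_continuous[OF G]
  have int: "integrable lborel (\<lambda>x. f x * J i x $ i)" "integrable lborel (\<lambda>x. F x $ i * G x $ i)" for i
    by (rule integrable_bdd_support,
        (intro continuous_on_mult continuous_on_component cont has_gradient_continuous(2)[OF J(1)]),
        rule bdd_supportI[of r], simp add: r F0)+
  have part: "(LBINT x. f x * J i x $ i) + (LBINT x. F x $ i * G x $ i) = 0" for i
  proof -
    have "(LBINT x. (f x *\<^sub>R J i x + G x $ i *\<^sub>R F x) $ i) = 0"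
      by (rule integral_partial_eq_0[OF has_gradient_mult[OF f(1) J(1)]]) (use f in auto)
    then show ?thesis
      using int[of i] by (simp add: mult.commute)
  qed
  have "(LBINT x. f x * D x) + (LBINT x. F x \<bullet> G x)
      = (\<Sum>i\<in>UNIV. (LBINT x. f x * J i x $ i) + (LBINT x. F x $ i * G x $ i))"
    using int by (simp add: J(2) inner_vec_def sum_distrib_left sum.distrib)
  with part show ?thesis by simp
qed

lemma has_divergence_add:
  assumes "has_divergence F C" "has_divergence G D"
  shows "has_divergence (\<lambda>x. F x + G x) (\<lambda>x. C x + D x)"
proof -
  obtain J where J: "\<And>i. has_gradient (\<lambda>x. F x $ i) (J i)" "\<And>x. C x = (\<Sum>i\<in>UNIV. J i x $ i)"
    using assms by (auto simp: has_divergence_def)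
  obtain K where K: "\<And>i. has_gradient (\<lambda>x. G x $ i) (K i)" "\<And>x. D x = (\<Sum>i\<in>UNIV. K i x $ i)"
    using assms by (auto simp: has_divergence_def)
  show ?thesis
    unfolding has_divergence_def
    by (rule exI[of _ "\<lambda>i x. J i x + K i x"]) (auto simp: J K sum.distrib intro: has_gradient_add)
qed

lemma has_divergence_scale:
  assumes f: "has_gradient f F" and G: "has_divergence G D"
  shows "has_divergence (\<lambda>x. f x *\<^sub>R G x) (\<lambda>x. f x * D x + F x \<bullet> G x)"
proof -
  obtain J where J: "\<And>i. has_gradient (\<lambda>x. G x $ i) (J i)" "\<And>x. D x = (\<Sum>i\<in>UNIV. J i x $ i)"
    using G by (auto simp: has_divergence_def)
  have "has_gradient (\<lambda>x. (f x *\<^sub>R G x) $ i) (\<lambda>x. f x *\<^sub>R J i x + G x $ i *\<^sub>R F x)" for i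
    using has_gradient_mult[OF f J(1)] by simp
  then show ?thesis
    unfolding has_divergence_def
    by (intro exI[of _ "\<lambda>i x. f x *\<^sub>R J i x + G x $ i *\<^sub>R F x"])
      (auto simp: J(2) inner_vec_def sum.distrib sum_distrib_left mult.commute)
qed

lemma has_laplacianD:
  assumes "has_laplacian f G L"
  shows "has_gradient f G" "has_divergence G L" "continuous_on UNIV f" "continuous_on UNIV G" "continuous_on UNIV L"
  using assms by (auto simp: has_laplacian_def has_gradient_continuous intro: has_divergence_continuous)

lemma has_laplacian_const: "has_laplacian (\<lambda>x. c) (\<lambda>x. 0) (\<lambda>x. 0)"
  unfolding has_laplacian_def has_divergence_def
  by (auto intro!: has_gradient_const exI[of _ "\<lambda>i x. 0"])

lemma has_laplacian_add:
  "has_laplacian f F K \<Longrightarrow> has_laplacian g G L \<Longrightarrow>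
    has_laplacian (\<lambda>x. f x + g x) (\<lambda>x. F x + G x) (\<lambda>x. K x + L x)"
  by (auto simp: has_laplacian_def intro: has_gradient_add has_divergence_add)

lemma has_laplacian_mult:
  assumes "has_laplacian f F K" "has_laplacian g G L"
  shows "has_laplacian (\<lambda>x. f x * g x) (\<lambda>x. f x *\<^sub>R G x + g x *\<^sub>R F x)
    (\<lambda>x. f x * L x + g x * K x + 2 * (F x \<bullet> G x))"
proof -
  note f = has_laplacianD[OF assms(1)] and g = has_laplacianD[OF assms(2)]
  show ?thesis
    unfolding has_laplacian_def
    using has_gradient_mult[OF f(1) g(1)]
      has_divergence_add[OF has_divergence_scale[OF f(1) g(2)] has_divergence_scale[OF g(1) f(2)]]
    by (simp add: inner_commute algebra_simps)
qed

lemma has_laplacian_cmult: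
  "has_laplacian f F K \<Longrightarrow> has_laplacian (\<lambda>x. c * f x) (\<lambda>x. c *\<^sub>R F x) (\<lambda>x. c * K x)"
  using has_laplacian_mult[OF has_laplacian_const[of c], of f F K] by simp

lemma has_laplacian_compose:
  assumes f: "has_laplacian f F K"
    and d: "\<And>x. (\<phi> has_real_derivative \<phi>' (f x)) (at (f x))"
    and d': "\<And>x. (\<phi>' has_real_derivative \<phi>'' (f x)) (at (f x))"
    and c: "continuous_on UNIV (\<lambda>x. \<phi>'' (f x))"
  shows "has_laplacian (\<lambda>x. \<phi> (f x)) (\<lambda>x. \<phi>' (f x) *\<^sub>R F x)
    (\<lambda>x. \<phi>' (f x) * K x + \<phi>'' (f x) * (F x \<bullet> F x))"
proof -
  note f' = has_laplacianD[OF f]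
  have 1: "has_gradient (\<lambda>x. \<phi>' (f x)) (\<lambda>x. \<phi>'' (f x) *\<^sub>R F x)"
    by (rule has_gradient_compose[OF f'(1) d' c])
  have "has_gradient (\<lambda>x. \<phi> (f x)) (\<lambda>x. \<phi>' (f x) *\<^sub>R F x)"
    by (rule has_gradient_compose[OF f'(1) d has_gradient_continuous(1)[OF 1]])
  moreover have "has_divergence (\<lambda>x. \<phi>' (f x) *\<^sub>R F x) (\<lambda>x. \<phi>' (f x) * K x + \<phi>'' (f x) * (F x \<bullet> F x))"
    using has_divergence_scale[OF 1 f'(2)] by simp
  ultimately show ?thesis by (simp add: has_laplacian_def)
qed

lemma has_laplacian_powr:
  assumes g: "has_laplacian g G L" and pos: "\<And>x. 0 < g x"
  shows "has_laplacian (\<lambda>x. g x powr k) (\<lambda>x. (k * g x powr (k - 1)) *\<^sub>R G x)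
    (\<lambda>x. k * g x powr (k - 1) * L x + k * ((k - 1) * g x powr (k - 2)) * (G x \<bullet> G x))"
proof (rule has_laplacian_compose[OF g])
  show "((\<lambda>s. s powr k) has_real_derivative k * g x powr (k - 1)) (at (g x))" for x
    by (rule has_real_derivative_powr[OF pos])
  show "((\<lambda>s. k * s powr (k - 1)) has_real_derivative k * ((k - 1) * g x powr (k - 2))) (at (g x))" for x
    using DERIV_cmult[OF has_real_derivative_powr[OF pos[of x], of "k - 1"], of k] by simp
  have "g x \<noteq> 0" for x using pos[of x] by simp
  then show "continuous_on UNIV (\<lambda>x. k * ((k - 1) * g x powr (k - 2)))"
    by (intro continuous_intros has_laplacianD(3)[OF g]) auto
qed

lemma has_laplacian_norm_square:
  "has_laplacian (\<lambda>x. x \<bullet> x) (\<lambda>x. 2 *\<^sub>R x) (\<lambda>x::real^'n::finite. 2 * real CARD('n))"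
proof -
  have "has_gradient (\<lambda>x::real^'n. x \<bullet> x) (\<lambda>x. 2 *\<^sub>R x)"
  proof -
    have "((\<lambda>x. x \<bullet> x) has_derivative (\<lambda>h. (2 *\<^sub>R x) \<bullet> h)) (at x)" for x :: "real^'n"
      by (rule derivative_eq_intros refl)+ (simp add: inner_commute fun_eq_iff)
    then show ?thesis by (simp add: has_gradient_def continuous_on_scaleR)
  qed
  moreover have "has_gradient (\<lambda>x::real^'n. (2 *\<^sub>R x) $ i) (\<lambda>x. axis i 2)" for i
  proof -
    have "((\<lambda>x. 2 * x $ i) has_derivative (\<lambda>h. axis i 2 \<bullet> h)) (at x)" for x :: "real^'n"
      using has_derivative_mult_right[OF bounded_linear.has_derivative[OF bounded_linear_vec_nth has_derivative_ident], of 2 i "at x"]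
      by (simp add: inner_axis')
    then show ?thesis by (simp add: has_gradient_def)
  qed
  ultimately show ?thesis
    unfolding has_laplacian_def has_divergence_def
    by (auto intro!: exI[of _ "\<lambda>i x. axis i 2"])
qed

lemma has_gradient_affine:
  assumes "has_gradient f F"
  shows "has_gradient (\<lambda>z. f (y + r *\<^sub>R z)) (\<lambda>z. r *\<^sub>R F (y + r *\<^sub>R z))"
proof -
  have "((\<lambda>z. f (y + r *\<^sub>R z)) has_derivative (\<lambda>h. r *\<^sub>R F (y + r *\<^sub>R x) \<bullet> h)) (at x)" for x
  proof -
    have "((\<lambda>z. y + r *\<^sub>R z) has_derivative (\<lambda>h. r *\<^sub>R h)) (at x)"
      by (rule derivative_eq_intros refl)+ simp
    from has_derivative_compose[OF this has_gradientD[OF assms]]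
    show ?thesis by simp
  qed
  moreover have "continuous_on UNIV (\<lambda>z. r *\<^sub>R F (y + r *\<^sub>R z))"
    by (intro continuous_intros continuous_on_compose2[OF has_gradient_continuous(2)[OF assms]]) auto
  ultimately show ?thesis
    by (simp add: has_gradient_def)
qed

lemma has_divergence_affine:
  assumes "has_divergence G D"
  shows "has_divergence (\<lambda>z. G (y + r *\<^sub>R z)) (\<lambda>z. r * D (y + r *\<^sub>R z))"
proof -
  obtain J where J: "\<And>i. has_gradient (\<lambda>x. G x $ i) (J i)" "\<And>x. D x = (\<Sum>i\<in>UNIV. J i x $ i)"
    using assms by (auto simp: has_divergence_def)
  have "has_gradient (\<lambda>z. G (y + r *\<^sub>R z) $ i) (\<lambda>z. r *\<^sub>R J i (y + r *\<^sub>R z))" for i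
    by (rule has_gradient_affine[OF J(1)])
  then show ?thesis
    unfolding has_divergence_def
    by (intro exI[of _ "\<lambda>i z. r *\<^sub>R J i (y + r *\<^sub>R z)"]) (simp add: J(2) sum_distrib_left)
qed

lemma C_k_2_has_laplacian:
  assumes "C_k 2 f"
  shows "has_laplacian f (\<lambda>x. \<chi> i. partial_derivative i f x) (laplacian f)"
proof -
  have C: "f differentiable_on UNIV" "partial_derivative i f differentiable_on UNIV"
    "continuous_on UNIV (partial_derivative j (partial_derivative i f))" for i j
    using assms by (auto simp: numeral_2_eq_2)
  have grad: "has_gradient g (\<lambda>x. \<chi> i. partial_derivative i g x)"
    if d: "g differentiable_on UNIV" and c: "\<And>i. continuous_on UNIV (partial_derivative i g)"
    for g :: "real^'n \<Rightarrow> real"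
  proof -
    have "(g has_derivative (\<lambda>h. (\<chi> i. partial_derivative i g x) \<bullet> h)) (at x)" for x
    proof -
      have D: "(g has_derivative frechet_derivative g (at x)) (at x)"
        using d by (auto simp: differentiable_on_def frechet_derivative_works[symmetric])
      then interpret bounded_linear "frechet_derivative g (at x)"
        by (rule has_derivative_bounded_linear)
      have "frechet_derivative g (at x) h = (\<chi> i. partial_derivative i g x) \<bullet> h" for h
      proof -
        have "h = (\<Sum>i\<in>UNIV. h $ i *\<^sub>R axis i 1)"
          by (simp add: basis_expansion flip: scalar_mult_eq_scaleR)
        then have "frechet_derivative g (at x) h = frechet_derivative g (at x) (\<Sum>i\<in>UNIV. h $ i *\<^sub>R axis i 1)"
          by simp
        also have "\<dots> = (\<Sum>i\<in>UNIV. h $ i * partial_derivative i g x)"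
          by (simp add: sum scaleR partial_derivative_def)
        finally show ?thesis by (simp add: inner_vec_def mult.commute)
      qed
      then have "frechet_derivative g (at x) = (\<lambda>h. (\<chi> i. partial_derivative i g x) \<bullet> h)" by auto
      with D show ?thesis by metis
    qed
    with c show ?thesis by (auto simp: has_gradient_def intro!: continuous_on_vec_lambda)
  qed
  have "continuous_on UNIV (partial_derivative i f)" for i
    using C(2) by (rule differentiable_imp_continuous_on)
  then have "has_gradient f (\<lambda>x. \<chi> i. partial_derivative i f x)"
    by (intro grad C)
  moreover have "has_gradient (partial_derivative i f) (\<lambda>x. \<chi> j. partial_derivative j (partial_derivative i f) x)" for i
    by (intro grad C)
  ultimately show ?thesis
    unfolding has_laplacian_def has_divergence_def
    by (auto simp: laplacian_def intro!: exI[of _ "\<lambda>i x. \<chi> j. partial_derivative j (partial_derivative i f) x"])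
qed

section \<open>Cutoff functions\<close>

lemma DERIV_max_0_power:
  "((\<lambda>x::real. max 0 x ^ Suc (Suc n)) has_real_derivative (2 + real n) * max 0 x ^ Suc n) (at x)"
proof -
  consider "x < 0" | "x = 0" | "x > 0" by linarith
  then show ?thesis
  proof cases
    case 1
    have "((\<lambda>x::real. 0) has_real_derivative 0) (at x)" by simp
    then have "((\<lambda>x::real. max 0 x ^ Suc (Suc n)) has_real_derivative 0) (at x)"
      by (rule has_field_derivative_transform_within_open[of _ _ _ "{..<0}"]) (use 1 in auto)
    then show ?thesis using 1 by simp
  next
    case 3
    have "((\<lambda>x::real. x ^ Suc (Suc n)) has_real_derivative (2 + real n) * x ^ Suc n) (at x)"
      using DERIV_pow[of "Suc (Suc n)" x] by (simp add: add.commute)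
    then have "((\<lambda>x::real. max 0 x ^ Suc (Suc n)) has_real_derivative (2 + real n) * x ^ Suc n) (at x)"
      by (rule has_field_derivative_transform_within_open[of _ _ _ "{0<..}"]) (use 3 in auto)
    then show ?thesis using 3 by simp
  next
    case 2
    have "((\<lambda>h::real. max 0 h ^ Suc (Suc n) / h) \<longlongrightarrow> 0) (at 0)"
    proof (rule Lim_null_comparison)
      show "\<forall>\<^sub>F h in at (0::real). norm (max 0 h ^ Suc (Suc n) / h) \<le> \<bar>h\<bar> ^ Suc n"
        by (rule always_eventually) (auto simp: max_def intro: mult_nonpos_nonneg)
      show "((\<lambda>h::real. \<bar>h\<bar> ^ Suc n) \<longlongrightarrow> 0) (at 0)"
        by (auto intro!: tendsto_eq_intros)
    qed
    then show ?thesis using 2 by (simp add: DERIV_def)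
  qed
qed

lemma DERIV_max_0_square [derivative_intros]:
  assumes "(g has_real_derivative g') (at x within s)"
  shows "((\<lambda>x. (max 0 (g x))\<^sup>2) has_real_derivative 2 * max 0 (g x) * g') (at x within s)"
  using DERIV_chain2[OF DERIV_max_0_power[of 0 "g x"] assms] by (simp add: power2_eq_square)

lemma DERIV_max_0_cube [derivative_intros]:
  assumes "(g has_real_derivative g') (at x within s)"
  shows "((\<lambda>x. (max 0 (g x)) ^ 3) has_real_derivative 3 * (max 0 (g x))\<^sup>2 * g') (at x within s)"
  using DERIV_chain2[OF DERIV_max_0_power[of 1 "g x"] assms]
  by (simp add: power2_eq_square power3_eq_cube mult.assoc)

text \<open>Composing cubes of positive parts gives a \<open>C\<^sup>2\<close> transition from 0 to 1 on the unit interval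
without gluing polynomials.\<close>

definition smooth_step :: "real \<Rightarrow> real"
  where "smooth_step y = 1 - (max 0 (1 - (max 0 y) ^ 3)) ^ 3"

definition smooth_step' :: "real \<Rightarrow> real"
  where "smooth_step' y = 9 * ((max 0 (1 - (max 0 y) ^ 3))\<^sup>2 * (max 0 y)\<^sup>2)"

definition smooth_step'' :: "real \<Rightarrow> real"
  where "smooth_step'' y = 18 * (max 0 (1 - (max 0 y) ^ 3))\<^sup>2 * max 0 y
    - 54 * max 0 (1 - (max 0 y) ^ 3) * (max 0 y) ^ 4"

lemma DERIV_smooth_step: "(smooth_step has_real_derivative smooth_step' y) (at y)"
  unfolding smooth_step_def[abs_def] smooth_step'_def
  by (rule derivative_eq_intros refl)+ simp

lemma DERIV_smooth_step': "(smooth_step' has_real_derivative smooth_step'' y) (at y)"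
  unfolding smooth_step'_def[abs_def] smooth_step''_def
  by (rule derivative_eq_intros refl)+ (simp add: algebra_simps power2_eq_square power4_eq_xxxx)

lemma smooth_step_bounds:
  "0 \<le> smooth_step y" "smooth_step y \<le> 1" "\<bar>smooth_step' y\<bar> \<le> 9" "\<bar>smooth_step'' y\<bar> \<le> 72"
  "y \<le> 0 \<Longrightarrow> smooth_step y = 0" "y \<ge> 1 \<Longrightarrow> smooth_step y = 1"
  "y \<le> 0 \<or> y \<ge> 1 \<Longrightarrow> smooth_step' y = 0" "y \<le> 0 \<or> y \<ge> 1 \<Longrightarrow> smooth_step'' y = 0"
proof -
  define a where "a = max 0 y"
  define b where "b = max 0 (1 - a ^ 3)"
  have a: "a \<ge> 0" by (simp add: a_def)
  have b: "0 \<le> b" "b \<le> 1" using a by (auto simp: b_def)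
  show "0 \<le> smooth_step y" "smooth_step y \<le> 1"
    using b by (auto simp: smooth_step_def simp flip: a_def b_def intro: power_le_one)
  have ge: "b = 0" if "a \<ge> 1" using that by (simp add: b_def one_le_power)
  have b2: "0 \<le> b\<^sup>2" "b\<^sup>2 \<le> 1" using b by (auto intro: power_le_one)
  have "b\<^sup>2 * a\<^sup>2 \<le> 1" "b\<^sup>2 * a \<le> 1" "b * a ^ 4 \<le> 1"
    using ge a b b2 by (cases "a \<ge> 1"; force intro: mult_le_one power_le_one)+
  moreover have "0 \<le> b\<^sup>2 * a\<^sup>2" "0 \<le> b\<^sup>2 * a" "0 \<le> b * a ^ 4"
    using a b by auto
  ultimately show "\<bar>smooth_step' y\<bar> \<le> 9" "\<bar>smooth_step'' y\<bar> \<le> 72"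
    unfolding smooth_step'_def smooth_step''_def by (simp_all flip: a_def b_def add: mult.assoc)
  have y0: "a = 0" if "y \<le> 0" using that by (simp add: a_def)
  have y1: "b = 0" if "y \<ge> 1" using that ge by (simp add: a_def)
  show "y \<le> 0 \<Longrightarrow> smooth_step y = 0" "y \<ge> 1 \<Longrightarrow> smooth_step y = 1"
    "y \<le> 0 \<or> y \<ge> 1 \<Longrightarrow> smooth_step' y = 0" "y \<le> 0 \<or> y \<ge> 1 \<Longrightarrow> smooth_step'' y = 0"
    using y0 y1
    by (auto simp: smooth_step_def smooth_step'_def smooth_step''_def simp flip: a_def b_def)
qed

text \<open>The constants come from the bounds 9 and 72 for the derivatives of the profile; what matters is that they do not
depend on the radii.\<close>

definition is_cutoff :: "real \<Rightarrow> real \<Rightarrow> (real^'n::finite \<Rightarrow> real) \<Rightarrow> (real^'n \<Rightarrow> real^'n) \<Rightarrow> (real^'n \<Rightarrow> real) \<Rightarrow> bool"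
  where "is_cutoff r \<rho> \<psi> G L \<longleftrightarrow> has_laplacian \<psi> G L \<and> (\<forall>x. 0 \<le> \<psi> x \<and> \<psi> x \<le> 1) \<and>
    (\<forall>x. norm x \<le> r \<longrightarrow> \<psi> x = 1) \<and> (\<forall>x. norm x \<ge> \<rho> \<longrightarrow> \<psi> x = 0) \<and>
    (\<forall>x. norm (G x) \<le> (288 + 18 * real CARD('n)) / (\<rho> - r)) \<and>
    (\<forall>x. \<bar>L x\<bar> \<le> (288 + 36 * real CARD('n)) / (\<rho> - r)\<^sup>2) \<and>
    (\<forall>x. norm x < r \<or> \<rho> < norm x \<longrightarrow> G x = 0 \<and> L x = 0)"

text \<open>The profile is a function of \<open>\<bar>x\<bar>\<^sup>2\<close>, hence smooth at the origin. That the derivative bounds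
depend on \<open>\<rho> - r\<close> alone, even for \<open>\<rho> - r\<close> much smaller than \<open>r\<close>, is what the absorption argument
with radii approaching each other needs.\<close>

lemma cutoff_exists:
  assumes r: "0 < r" "r < \<rho>"
  obtains \<psi> G L where "is_cutoff r \<rho> (\<psi> :: real^'n::finite \<Rightarrow> real) G L"
proof -
  define d where "d = \<rho>\<^sup>2 - r\<^sup>2"
  have d_eq: "d = (\<rho> - r) * (\<rho> + r)" by (simp add: d_def power2_eq_square algebra_simps)
  then have d: "d > 0" using r by simp
  define y where "y x = \<rho>\<^sup>2 / d + (- 1 / d) * (x \<bullet> x)" for x :: "real^'n"
  have y_eq: "y x = (\<rho>\<^sup>2 - (norm x)\<^sup>2) / d" for x
    using d by (simp add: y_def power2_norm_eq_inner diff_divide_distrib)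
  have lap_y: "has_laplacian y (\<lambda>x. (- 2 / d) *\<^sub>R x) (\<lambda>x. - 2 * real CARD('n) / d)"
    unfolding y_def[abs_def]
    using has_laplacian_add[OF has_laplacian_const[of "\<rho>\<^sup>2 / d"] has_laplacian_cmult[OF has_laplacian_norm_square, of "- 1 / d"]]
    by simp
  let ?G = "\<lambda>x. smooth_step' (y x) *\<^sub>R ((- 2 / d) *\<^sub>R x)"
  let ?L = "\<lambda>x. smooth_step' (y x) * (- 2 * real CARD('n) / d) + smooth_step'' (y x) * (((- 2 / d) *\<^sub>R x) \<bullet> ((- 2 / d) *\<^sub>R x))"
  have lap: "has_laplacian (\<lambda>x. smooth_step (y x)) ?G ?L"
  proof (rule has_laplacian_compose[OF lap_y DERIV_smooth_step DERIV_smooth_step'])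
    have "continuous_on UNIV smooth_step''"
      unfolding smooth_step''_def[abs_def] by (intro continuous_intros)
    then show "continuous_on UNIV (\<lambda>x. smooth_step'' (y x))"
      by (rule continuous_on_compose2) (use has_laplacianD(3)[OF lap_y] in auto)
  qed
  have y0: "y x \<le> 0" if "norm x \<ge> \<rho>" for x
    using that r d by (auto simp: y_eq divide_le_0_iff intro: power_mono)
  have y1: "y x \<ge> 1" if "norm x \<le> r" for x
    using that r d by (auto simp: y_eq d_def intro: power_mono)
  have d1: "2 / d * norm x \<le> 2 / (\<rho> - r)" if "norm x \<le> \<rho>" for x :: "real^'n"
  proof -
    have "norm x * (\<rho> - r) \<le> (\<rho> + r) * (\<rho> - r)"
      using that r by (intro mult_right_mono) auto
    then show ?thesis using r d by (simp add: d_eq divide_simps mult.commute)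
  qed
  have d2: "1 / d \<le> 1 / (\<rho> - r)\<^sup>2"
    using r d by (intro divide_left_mono) (auto simp: d_eq power2_eq_square intro: mult_left_mono)
  have G: "norm (?G x) \<le> (288 + 18 * real CARD('n)) / (\<rho> - r)" for x
  proof (cases "norm x \<le> \<rho>")
    case True
    have "norm (?G x) = \<bar>smooth_step' (y x)\<bar> * (2 / d * norm x)"
      using d by (simp add: abs_mult)
    also have "\<dots> \<le> 9 * (2 / (\<rho> - r))"
      using d1[OF True] smooth_step_bounds(3)[of "y x"] d r by (intro mult_mono) auto
    also have "9 * (2 / (\<rho> - r)) = 18 / (\<rho> - r)"
      by simp
    also have "\<dots> \<le> (288 + 18 * real CARD('n)) / (\<rho> - r)"
      using r by (intro divide_right_mono) auto
    finally show ?thesis .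
  next
    case False
    then show ?thesis using y0[of x] smooth_step_bounds(7)[of "y x"] r by simp
  qed
  have L: "\<bar>?L x\<bar> \<le> (288 + 36 * real CARD('n)) / (\<rho> - r)\<^sup>2" for x
  proof (cases "norm x \<le> \<rho>")
    case True
    have "\<bar>?L x\<bar> \<le> \<bar>smooth_step' (y x)\<bar> * (2 * real CARD('n) * (1 / d)) + \<bar>smooth_step'' (y x)\<bar> * (2 / d * norm x)\<^sup>2"
      using d by (intro order_trans[OF abs_triangle_ineq] add_mono)
        (auto simp: abs_mult power2_eq_square dot_square_norm)
    also have "\<dots> \<le> 9 * (2 * real CARD('n) * (1 / (\<rho> - r)\<^sup>2)) + 72 * (2 / (\<rho> - r))\<^sup>2"
      using d1[OF True] d2 smooth_step_bounds(3,4)[of "y x"] d r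
      by (intro add_mono mult_mono power_mono) auto
    also have "\<dots> \<le> (288 + 36 * real CARD('n)) / (\<rho> - r)\<^sup>2"
      using r by (simp add: divide_simps power2_eq_square)
    finally show ?thesis .
  next
    case False
    then show ?thesis using y0[of x] smooth_step_bounds(7,8)[of "y x"] r by simp
  qed
  have far: "?G x = 0 \<and> ?L x = 0" if "norm x < r \<or> \<rho> < norm x" for x
    using that y0[of x] y1[of x] smooth_step_bounds(7,8)[of "y x"] by auto
  have "is_cutoff r \<rho> (\<lambda>x. smooth_step (y x)) ?G ?L"
    unfolding is_cutoff_def
    using lap G L far smooth_step_bounds(1,2,5,6) y0 y1 by blast
  then show ?thesis by (rule that)
qed

lemma is_cutoff_bdd_support: "is_cutoff r \<rho> \<psi> G L \<Longrightarrow> bdd_support \<psi>"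
  by (rule bdd_supportI[of \<rho>]) (auto simp: is_cutoff_def)

section \<open>Mean values of subharmonic functions\<close>

definition mean_kernel :: "real^'n::finite \<Rightarrow> real"
  where "mean_kernel z = 6 * (max 0 (1 - z \<bullet> z))\<^sup>2"

lemma mean_kernel_continuous: "continuous_on S mean_kernel"
  unfolding mean_kernel_def[abs_def] by (intro continuous_intros)

lemma mean_kernel_nonneg: "0 \<le> mean_kernel z" and mean_kernel_le: "mean_kernel z \<le> 6"
  by (auto simp: mean_kernel_def max_def intro!: power_le_one)

lemma mean_kernel_outside: "norm z > 1 \<Longrightarrow> mean_kernel z = 0"
  by (simp add: mean_kernel_def power2_norm_eq_inner[symmetric])

lemma mean_kernel_half: 
  assumes "norm z \<le> 1/2"
  shows "1 \<le> mean_kernel z"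
proof -
  have "(norm z)\<^sup>2 \<le> (1/2)\<^sup>2" using assms by (intro power_mono) auto
  then have "3/4 \<le> max 0 (1 - z \<bullet> z)"
    by (simp add: power2_norm_eq_inner le_max_iff_disj) (simp add: power2_eq_square)
  from power_mono[OF this, of 2] show ?thesis by (simp add: mean_kernel_def power2_eq_square)
qed

lemma mean_kernel_bdd_support: "bdd_support mean_kernel"
  by (rule bdd_supportI[of 1]) (rule mean_kernel_outside)

text \<open>\<open>z\<close> times the kernel is an exact gradient; this is why weighted means of \<open>f\<close> over balls have a
radial derivative that only involves the Laplacian of \<open>f\<close>.\<close>

lemma mean_kernel_primitive:
  "has_gradient (\<lambda>z::real^'n::finite. (max 0 (1 - z \<bullet> z)) ^ 3) (\<lambda>z. - mean_kernel z *\<^sub>R z)"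
proof -
  have d: "((\<lambda>s::real. (max 0 (1 - s)) ^ 3) has_real_derivative - 3 * (max 0 (1 - s))\<^sup>2) (at s)" for s
    by (rule derivative_eq_intros refl)+ simp
  have "has_gradient (\<lambda>z::real^'n. (max 0 (1 - z \<bullet> z)) ^ 3) (\<lambda>z. (- 3 * (max 0 (1 - z \<bullet> z))\<^sup>2) *\<^sub>R (2 *\<^sub>R z))"
    by (rule has_gradient_compose[OF has_laplacianD(1)[OF has_laplacian_norm_square] d]) (intro continuous_intros)
  then show ?thesis by (simp add: mean_kernel_def)
qed

text \<open>The derivative in \<open>r\<close> of the weighted mean over the ball of radius \<open>r\<close> is the integral of
\<open>\<nabla>f(y + rz) \<bullet> z\<close> against the kernel. Integrating by parts with the primitive of the kernel turns it
into \<open>r\<close> times an integral of \<open>\<Delta>f \<ge> 0\<close>, so the mean increases from its value at \<open>r = 0\<close>.\<close>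

lemma subharmonic_mean_value:
  fixes f :: "real^'n::finite \<Rightarrow> real"
  assumes f: "has_laplacian f G L" and L: "\<And>x. 0 \<le> L x" and r: "0 \<le> r"
  shows "f y * (LBINT z. mean_kernel (z::real^'n)) \<le> (LBINT z. f (y + r *\<^sub>R z) * mean_kernel (z::real^'n))"
proof -
  note f' = has_laplacianD[OF f]
  note K = mean_kernel_continuous[of UNIV]
  define M where "M s = (LBINT z. f (y + s *\<^sub>R z) * mean_kernel z)" for s
  have deriv: "(M has_real_derivative (LBINT z. (G (y + s *\<^sub>R z) \<bullet> z) * mean_kernel z)) (at s)" for s
    unfolding M_def[abs_def]
  proof (rule DERIV_integral_parameter)
    show "((\<lambda>t. f (y + t *\<^sub>R x) * mean_kernel x) has_real_derivative (G (y + t *\<^sub>R x) \<bullet> x) * mean_kernel x) (at t)" for t x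
    proof -
      have "((\<lambda>t. y + t *\<^sub>R x) has_derivative (\<lambda>h. h *\<^sub>R x)) (at t)"
        by (rule derivative_eq_intros refl)+ simp
      from has_derivative_compose[OF this has_gradientD[OF f'(1)]]
      have "((\<lambda>t. f (y + t *\<^sub>R x)) has_real_derivative (G (y + t *\<^sub>R x) \<bullet> x)) (at t)"
        by (simp add: has_field_derivative_def mult.commute[of _ "_ \<bullet> _"])
      then show ?thesis by (rule DERIV_cmult_right)
    qed
    show "continuous_on (UNIV \<times> UNIV) (\<lambda>(t, x). (G (y + t *\<^sub>R x) \<bullet> x) * mean_kernel x)"
      unfolding split_beta
      by (intro continuous_intros continuous_on_compose2[OF f'(4)] continuous_on_compose2[OF K]) auto
    show "continuous_on UNIV (\<lambda>x. f (y + t *\<^sub>R x) * mean_kernel x)" for t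
      by (intro continuous_intros continuous_on_compose2[OF f'(3)] K) auto
    show "f (y + t *\<^sub>R x) * mean_kernel x = 0" "(G (y + t *\<^sub>R x) \<bullet> x) * mean_kernel x = 0" if "norm x > 1" for t x
      using mean_kernel_outside[OF that] by auto
  qed auto
  have nonneg: "0 \<le> (LBINT z. (G (y + s *\<^sub>R z) \<bullet> z) * mean_kernel z)" if "0 \<le> s" for s
  proof -
    have "bdd_support (\<lambda>z::real^'n. (max 0 (1 - z \<bullet> z)) ^ 3)"
      (is "bdd_support ?P")
      by (rule bdd_support_vanish[OF mean_kernel_bdd_support]) (simp add: mean_kernel_def)
    from integration_by_parts[OF has_divergence_affine[OF f'(2), of y s] mean_kernel_primitive this]
    have "(LBINT z. (G (y + s *\<^sub>R z) \<bullet> z) * mean_kernel z)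
        = (LBINT z. (max 0 (1 - z \<bullet> z)) ^ 3 * (s * L (y + s *\<^sub>R z)))"
      by (simp add: inner_commute mult.commute)
    also have "\<dots> \<ge> 0"
      using L that by (intro Bochner_Integration.integral_nonneg) auto
    finally show ?thesis .
  qed
  have "M 0 \<le> M r"
    using r deriv nonneg by (intro DERIV_nonneg_imp_nondecreasing[of 0 r M]) blast+
  then show ?thesis by (simp add: M_def)
qed

lemma integral_affine:
  fixes f :: "real^'n::finite \<Rightarrow> real"
  assumes "f \<in> borel_measurable borel" "0 < r"
  shows "(LBINT z. f (y + r *\<^sub>R z)) = (LBINT x. f x) / r ^ CARD('n)"
proof -
  have "(LBINT x. f x)
      = (\<integral>x. f x \<partial>density (distr lborel borel (\<lambda>x. y + r *\<^sub>R x)) (\<lambda>_. \<bar>r\<bar> ^ DIM(real^'n)))"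
    using assms by (subst lborel_affine[of r y]) auto
  also have "\<dots> = (\<integral>x. \<bar>r\<bar> ^ DIM(real^'n) * f x \<partial>distr lborel borel (\<lambda>x. y + r *\<^sub>R x))"
    using assms by (subst integral_density) auto
  also have "\<dots> = (LBINT z. r ^ CARD('n) * f (y + r *\<^sub>R z))"
    using assms by (subst integral_distr) (auto simp: abs_of_pos)
  finally show ?thesis using assms by simp
qed

definition ball_integral :: "(real^'n::finite \<Rightarrow> real) \<Rightarrow> real \<Rightarrow> real"
  where "ball_integral f r = (LBINT x. indicator (cball 0 r) x * f x)"

lemma integrable_on_ball:
  fixes f :: "real^'n::finite \<Rightarrow> real"
  assumes "continuous_on UNIV f"
  shows "integrable lborel (\<lambda>x. indicator (cball 0 r) x * f x)"
  using borel_integrable_compact[of "cball 0 r" f] continuous_on_subset[OF assms] by simp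

text \<open>The weak Harnack inequality for positive superharmonic functions, with exponent one: the mean over
the ball of radius \<open>4R\<close> about \<open>y\<close> controls the mean over the centred ball of radius \<open>R\<close>, where the
kernel is at least one.\<close>

lemma superharmonic_ball_integral_le:
  obtains C :: real where "0 < C"
    "\<And>(u :: real^'n::finite \<Rightarrow> real) G L R y. has_laplacian u G L \<Longrightarrow> (\<And>x. L x \<le> 0) \<Longrightarrow> (\<And>x. 0 < u x) \<Longrightarrow> 0 < R \<Longrightarrow> norm y \<le> R
      \<Longrightarrow> ball_integral u R \<le> C * R ^ CARD('n) * u (y :: real^'n)"
proof
  let ?I = "LBINT z. mean_kernel (z::real^'n)"
  have I0: "0 \<le> ?I" by (intro Bochner_Integration.integral_nonneg mean_kernel_nonneg)
  show "0 < 4 ^ CARD('n) * ?I + 1" using I0 by (simp add: add_nonneg_pos)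
  fix u :: "real^'n \<Rightarrow> real" and G L and R :: real and y :: "real^'n"
  assume u: "has_laplacian u G L" and L: "\<And>x. L x \<le> 0" and pos: "\<And>x. 0 < u x"
    and R: "0 < R" and y: "norm y \<le> R"
  note u' = has_laplacianD[OF u]
  define g where "g x = u x * mean_kernel ((1 / (4 * R)) *\<^sub>R (x - y))" for x
  have cg: "continuous_on UNIV g"
    unfolding g_def by (intro continuous_intros u' continuous_on_compose2[OF mean_kernel_continuous[of UNIV]]) auto
  have bg: "bdd_support g"
  proof (rule bdd_supportI)
    fix x :: "real^'n" assume x: "norm x > 5 * R"
    have "norm x \<le> norm (x - y) + norm y" by (metis add_diff_cancel norm_triangle_ineq diff_add_cancel)
    then have "norm (x - y) > 4 * R" using x y by linarith
    then have "norm ((1 / (4 * R)) *\<^sub>R (x - y)) > 1" using R by (simp add: divide_simps)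
    then show "g x = 0" by (simp add: g_def mean_kernel_outside)
  qed
  have lap: "has_laplacian (\<lambda>x. - u x) (\<lambda>x. - G x) (\<lambda>x. - L x)"
    using has_laplacian_cmult[OF u, of "-1"] by simp
  have "- u y * ?I \<le> (LBINT z. - u (y + (4 * R) *\<^sub>R z) * mean_kernel z)"
    using L R by (intro subharmonic_mean_value[OF lap]) (auto simp: less_imp_le)
  then have "(LBINT z. u (y + (4 * R) *\<^sub>R z) * mean_kernel z) \<le> u y * ?I"
    by simp
  also have "(LBINT z. u (y + (4 * R) *\<^sub>R z) * mean_kernel z) = (LBINT z. g (y + (4 * R) *\<^sub>R z))"
    using R by (simp add: g_def)
  also have "\<dots> = (LBINT x. g x) / (4 * R) ^ CARD('n)"
    using R by (intro integral_affine) (auto intro: borel_measurable_continuous_onI cg)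
  finally have *: "(LBINT x. g x) \<le> (4 * R) ^ CARD('n) * (u y * ?I)"
    using R by (simp add: divide_simps mult.commute)
  have "ball_integral u R \<le> (LBINT x. g x)"
    unfolding ball_integral_def
  proof (rule integral_mono[OF integrable_on_ball[OF u'(3)] integrable_bdd_support[OF cg bg]])
    fix x :: "real^'n"
    have "1 \<le> mean_kernel ((1 / (4 * R)) *\<^sub>R (x - y))" if "norm x \<le> R"
    proof (rule mean_kernel_half)
      have "norm (x - y) \<le> 2 * R" using norm_triangle_ineq4[of x y] that y by linarith
      then show "norm ((1 / (4 * R)) *\<^sub>R (x - y)) \<le> 1/2" using R by (simp add: divide_simps)
    qed
    moreover have "0 \<le> u x" using pos[of x] by simp
    ultimately have "norm x \<le> R \<Longrightarrow> u x * 1 \<le> u x * mean_kernel ((1 / (4 * R)) *\<^sub>R (x - y))"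
      by (intro mult_left_mono)
    then show "indicator (cball 0 R) x * u x \<le> g x"
      using mean_kernel_nonneg[of "(1 / (4 * R)) *\<^sub>R (x - y)"] \<open>0 \<le> u x\<close> by (auto simp: g_def indicator_def)
  qed
  also note *
  also have "(4 * R) ^ CARD('n) * (u y * ?I) = (4 ^ CARD('n) * ?I) * R ^ CARD('n) * u y"
    by (simp add: power_mult_distrib)
  also have "\<dots> \<le> (4 ^ CARD('n) * ?I + 1) * R ^ CARD('n) * u y"
    using R pos[of y] by (intro mult_right_mono) auto
  finally show "ball_integral u R \<le> (4 ^ CARD('n) * ?I + 1) * R ^ CARD('n) * u y" .
qed

section \<open>Decay of positive solutions\<close>

lemma weight_continuous: "0 \<le> a \<Longrightarrow> continuous_on S (weight a)"
  unfolding weight_def[abs_def]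
  by (cases "a = 0") (simp_all add: continuous_on_powr' continuous_on_norm_id continuous_on_const)

lemma weight_nonneg: "0 \<le> weight a x"
  by (simp add: weight_def)

lemma weight_pos: "x \<noteq> 0 \<Longrightarrow> 0 < weight a x"
  by (simp add: weight_def)

lemma weight_scale: "0 < r \<Longrightarrow> weight a (r *\<^sub>R x) = r powr a * weight a x"
  by (simp add: weight_def powr_mult)

text \<open>Here the vector field and not the function has bounded support; a cutoff equal to one there
reduces this to the previous form.\<close>

lemma integration_by_parts_field:
  fixes f :: "real^'n::finite \<Rightarrow> real"
  assumes G: "has_divergence G D" and f: "has_gradient f F"
    and z: "\<And>x. norm x > r \<Longrightarrow> G x = 0 \<and> D x = 0"
  shows "(LBINT x. f x * D x) = - (LBINT x. F x \<bullet> G x)"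
proof -
  define s where "s = max r 1"
  obtain \<psi> P L where c: "is_cutoff (s + 1) (s + 2) (\<psi> :: real^'n \<Rightarrow> real) P L"
    by (rule cutoff_exists[of "s + 1" "s + 2"]) (auto simp: s_def)
  then have lap: "has_laplacian \<psi> P L" by (simp add: is_cutoff_def)
  have in1: "\<psi> x = 1 \<and> P x = 0" if "norm x \<le> s" for x
    using c that by (simp add: is_cutoff_def)
  have out: "G x = 0 \<and> D x = 0" if "\<not> norm x \<le> s" for x
    using z[of x] that by (simp add: s_def)
  have "(LBINT x. \<psi> x * f x * D x) = - (LBINT x. (\<psi> x *\<^sub>R F x + f x *\<^sub>R P x) \<bullet> G x)"
    by (rule integration_by_parts[OF G has_gradient_mult[OF has_laplacianD(1)[OF lap] f]])
      (intro bdd_support_mult is_cutoff_bdd_support[OF c])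
  also have "(\<lambda>x. \<psi> x * f x * D x) = (\<lambda>x. f x * D x)"
    using in1 out by (metis mult_1 mult_zero_right)
  also have "(\<lambda>x. (\<psi> x *\<^sub>R F x + f x *\<^sub>R P x) \<bullet> G x) = (\<lambda>x. F x \<bullet> G x)"
  proof
    fix x show "(\<psi> x *\<^sub>R F x + f x *\<^sub>R P x) \<bullet> G x = F x \<bullet> G x"
      using in1[of x] out[of x] by (cases "norm x \<le> s") auto
  qed
  finally show ?thesis .
qed

lemma ball_integral_nonneg: "(\<And>x. 0 \<le> f x) \<Longrightarrow> 0 \<le> ball_integral f r"
  unfolding ball_integral_def by (intro Bochner_Integration.integral_nonneg) simp

lemma ball_integral_mono:
  assumes "continuous_on UNIV f" "continuous_on UNIV g" "\<And>x. norm x \<le> r \<Longrightarrow> f x \<le> g x"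
  shows "ball_integral f r \<le> ball_integral g r"
  unfolding ball_integral_def
  by (rule integral_mono[OF integrable_on_ball[OF assms(1)] integrable_on_ball[OF assms(2)]])
    (auto simp: indicator_def assms(3))

lemma ball_integral_mono_radius:
  assumes "continuous_on UNIV f" "\<And>x. 0 \<le> f x" "r \<le> s"
  shows "ball_integral f r \<le> ball_integral f s"
  unfolding ball_integral_def
  by (rule integral_mono[OF integrable_on_ball[OF assms(1)] integrable_on_ball[OF assms(1)]])
    (use assms in \<open>auto simp: indicator_def\<close>)

lemma ball_integral_cmult: "ball_integral (\<lambda>x. c * f x) r = c * ball_integral f r"
proof -
  have "(\<lambda>x. indicator (cball 0 r) x * (c * f x)) = (\<lambda>x. c * (indicator (cball 0 r) x * f x))"
    by (simp add: fun_eq_iff)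
  then show ?thesis by (simp add: ball_integral_def)
qed

lemma ball_integral_le_integral:
  assumes "continuous_on UNIV f" "integrable lborel g"
    "\<And>x. norm x \<le> r \<Longrightarrow> f x \<le> g x" "\<And>x. 0 \<le> g x"
  shows "ball_integral f r \<le> (LBINT x. g x)"
  unfolding ball_integral_def
  by (rule integral_mono[OF integrable_on_ball[OF assms(1)] assms(2)]) (auto simp: indicator_def assms(3,4))

lemma integral_le_ball_integral:
  assumes "continuous_on UNIV f" "integrable lborel g"
    "\<And>x. norm x \<le> r \<Longrightarrow> g x \<le> f x" "\<And>x. norm x > r \<Longrightarrow> g x \<le> 0"
  shows "(LBINT x. g x) \<le> ball_integral f r"
  unfolding ball_integral_def
  by (rule integral_mono[OF assms(2) integrable_on_ball[OF assms(1)]]) (auto simp: indicator_def assms(3,4))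

lemma ball_integral_pos:
  fixes f :: "real^'n::finite \<Rightarrow> real"
  assumes f: "continuous_on UNIV f" and nn: "\<And>x. 0 \<le> f x" and pos: "\<And>x. x \<noteq> 0 \<Longrightarrow> 0 < f x" and r: "0 < r"
  shows "0 < ball_integral f r"
proof (rule ccontr)
  assume "\<not> ?thesis"
  then have "ball_integral f r = 0" using ball_integral_nonneg[of f r] nn by simp
  then have "AE x in lborel. indicator (cball 0 r) x * f x = 0"
    unfolding ball_integral_def
    by (subst integral_nonneg_eq_0_iff_AE[symmetric]) (auto intro: integrable_on_ball f simp: nn)
  moreover have "AE x in lborel. x \<noteq> (0::real^'n)" by (rule AE_lborel_singleton)
  ultimately have "AE x in lborel. x \<notin> cball (0::real^'n) r"
    by eventually_elim (use pos in \<open>fastforce simp: indicator_def split: if_splits\<close>)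
  then have "cball (0::real^'n) r \<in> null_sets lborel"
    by (subst AE_iff_null_sets) auto
  then have "measure lborel (cball (0::real^'n) r) = 0"
    by (simp add: null_sets_def measure_def)
  then show False using content_cball_pos[OF r, of "0::real^'n"] by simp
qed

lemma ball_integral_scale:
  fixes f :: "real^'n::finite \<Rightarrow> real"
  assumes "continuous_on UNIV f" "0 < r"
  shows "ball_integral f r = r ^ CARD('n) * ball_integral (\<lambda>x. f (r *\<^sub>R x)) 1"
proof -
  have "(LBINT z. indicator (cball 0 r) (0 + r *\<^sub>R z) * f (0 + r *\<^sub>R z)) = ball_integral f r / r ^ CARD('n)"
    unfolding ball_integral_def
    using borel_measurable_integrable[OF integrable_on_ball[OF assms(1)]] assms(2)
    by (intro integral_affine[where f="\<lambda>x. indicator (cball 0 r) x * f x"]) auto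
  moreover have "(\<lambda>z. indicator (cball 0 r) (0 + r *\<^sub>R z) * f (0 + r *\<^sub>R z))
      = (\<lambda>z::real^'n. indicator (cball 0 1) z * f (r *\<^sub>R z))"
    using assms(2) by (auto simp: fun_eq_iff indicator_def mult_le_cancel_left1 abs_of_pos mult_le_cancel_left2)
  ultimately show ?thesis using assms(2) by (simp add: ball_integral_def field_simps)
qed

lemma ball_integral_weight:
  assumes "0 \<le> a" "0 < r"
  shows "ball_integral (weight a :: real^'n::finite \<Rightarrow> real) r
    = r ^ CARD('n) * r powr a * ball_integral (weight a :: real^'n \<Rightarrow> real) 1"
  unfolding ball_integral_scale[OF weight_continuous[OF assms(1)] assms(2)] weight_scale[OF assms(2)] ball_integral_cmult
  by simp

text \<open>Both derivatives are moved to the cutoff, whose Laplacian is of size the inverse square of \<open>\<rho> - r\<close>.\<close>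

lemma superharmonic_test:
  fixes u :: "real^'n::finite \<Rightarrow> real"
  assumes u: "has_laplacian u G L" and pos: "\<And>x. 0 < u x" and c: "is_cutoff r \<rho> \<psi> P Q"
  shows "(LBINT x. \<psi> x * - L x) \<le> (288 + 36 * real CARD('n)) / (\<rho> - r)\<^sup>2 * ball_integral u \<rho>"
proof -
  have \<psi>: "has_laplacian \<psi> P Q" using c by (simp add: is_cutoff_def)
  note u' = has_laplacianD[OF u] and \<psi>' = has_laplacianD[OF \<psi>]
  have far: "P x = 0 \<and> Q x = 0" if "norm x > \<rho>" for x using c that by (simp add: is_cutoff_def)
  have "(LBINT x. \<psi> x * - L x) = (LBINT x. P x \<bullet> G x)"
    using integration_by_parts[OF u'(2) \<psi>'(1) is_cutoff_bdd_support[OF c]] by simp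
  also have "\<dots> = (LBINT x. - (u x * Q x))"
    using integration_by_parts_field[OF \<psi>'(2) u'(1) far] by (simp add: inner_commute)
  also have "\<dots> \<le> ball_integral (\<lambda>x. (288 + 36 * real CARD('n)) / (\<rho> - r)\<^sup>2 * u x) \<rho>"
  proof (rule integral_le_ball_integral)
    show "continuous_on UNIV (\<lambda>x. (288 + 36 * real CARD('n)) / (\<rho> - r)\<^sup>2 * u x)"
      by (intro continuous_intros u')
    show "integrable lborel (\<lambda>x. - (u x * Q x))"
      by (rule integrable_bdd_support, intro continuous_intros u' \<psi>', rule bdd_supportI[of \<rho>]) (simp add: far)
    fix x
    have "\<bar>Q x\<bar> \<le> (288 + 36 * real CARD('n)) / (\<rho> - r)\<^sup>2" using c by (simp add: is_cutoff_def)
    then have "- Q x * u x \<le> (288 + 36 * real CARD('n)) / (\<rho> - r)\<^sup>2 * u x"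
      using pos[of x] by (intro mult_right_mono) auto
    then show "- (u x * Q x) \<le> (288 + 36 * real CARD('n)) / (\<rho> - r)\<^sup>2 * u x"
      by (simp add: mult.commute)
  qed (use far in auto)
  finally show ?thesis unfolding ball_integral_cmult .
qed

text \<open>Testing the equation of \<open>u\<close> with a cutoff bounds the integral of \<open>\<bar>x\<bar>\<^sup>a v\<^sup>p\<close> by the mean of \<open>u\<close>;
by the Harnack inequality \<open>v\<close> is bounded below by its mean. Working with means and the Harnack
inequality, and not with Hoelder's inequality, covers exponents below one.\<close>

lemma mean_inequality:
  fixes a p :: real
  assumes a: "0 \<le> a" and p: "0 \<le> p"
  obtains C :: real where "0 < C"
    "\<And>(u :: real^'n::finite \<Rightarrow> real) G L v H M R.
      has_laplacian u G L \<Longrightarrow> has_laplacian v H M \<Longrightarrow> (\<And>x. 0 < u x) \<Longrightarrow> (\<And>x. 0 < v x) \<Longrightarrow>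
      (\<And>x. L x = - (weight a x * v x powr p)) \<Longrightarrow> (\<And>x. M x \<le> 0) \<Longrightarrow> 0 < R \<Longrightarrow>
      (ball_integral v R / R ^ CARD('n)) powr p \<le> C * R powr (- 2 - a) * (ball_integral u R / R ^ CARD('n))"
proof -
  let ?N = "CARD('n)"
  obtain C where C: "0 < C" and harnack: "\<And>(u :: real^'n \<Rightarrow> real) G L R y. has_laplacian u G L \<Longrightarrow>
      (\<And>x. L x \<le> 0) \<Longrightarrow> (\<And>x. 0 < u x) \<Longrightarrow> 0 < R \<Longrightarrow> norm y \<le> R
      \<Longrightarrow> ball_integral u R \<le> C * R ^ CARD('n) * u y"
    using superharmonic_ball_integral_le by blast
  define \<kappa> where "\<kappa> = ball_integral (\<lambda>x::real^'n. 1) 1"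
  define \<omega> where "\<omega> = ball_integral (weight a :: real^'n \<Rightarrow> real) 1"
  define K where "K = 288 + 36 * real ?N"
  have \<kappa>: "0 < \<kappa>" unfolding \<kappa>_def by (rule ball_integral_pos) auto
  have \<omega>: "0 < \<omega>" unfolding \<omega>_def by (rule ball_integral_pos) (auto intro: weight_continuous[OF a] weight_pos weight_nonneg)
  have K: "0 < K" by (simp add: K_def add_pos_nonneg)
  define D where "D = C powr p * K * C * 2 ^ ?N / (\<kappa> * \<omega>)"
  show ?thesis
  proof (rule that[of D])
    show "0 < D" using C K \<kappa> \<omega> by (simp add: D_def)
    fix u G L v H M R
    assume u: "has_laplacian (u :: real^'n \<Rightarrow> real) G L" and v: "has_laplacian v H M"
      and upos: "\<And>x. 0 < u x" and vpos: "\<And>x. 0 < v x"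
      and L: "\<And>x. L x = - (weight a x * v x powr p)" and M: "\<And>x. M x \<le> 0" and R: "(0::real) < R"
    note u' = has_laplacianD[OF u] and v' = has_laplacianD[OF v]
    have L0: "L x \<le> 0" for x using L weight_nonneg[of a x] by simp
    obtain \<psi> P Q where c: "is_cutoff R (2 * R) (\<psi> :: real^'n \<Rightarrow> real) P Q"
      by (rule cutoff_exists[of R "2 * R"]) (use R in auto)
    define m where "m = ball_integral v R / (C * R ^ ?N)"
    have m0: "0 \<le> m" using C R vpos by (simp add: m_def ball_integral_nonneg less_imp_le)
    have m: "m \<le> v y" if "norm y \<le> R" for y
      using harnack[OF v M vpos R that] C R by (simp add: m_def divide_simps mult.commute mult.left_commute)
    have cL: "continuous_on UNIV L" by (rule u')
    have "m powr p * (R ^ ?N * R powr a * \<omega>) = ball_integral (\<lambda>x::real^'n. m powr p * weight a x) R"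
      by (simp only: ball_integral_cmult ball_integral_weight[OF a R] \<omega>_def)
    also have "\<dots> \<le> (LBINT x. \<psi> x * - L x)"
    proof (rule ball_integral_le_integral)
      show "continuous_on UNIV (\<lambda>x. m powr p * weight a x)"
        by (intro continuous_intros weight_continuous a)
      show "integrable lborel (\<lambda>x. \<psi> x * - L x)"
        using c by (intro integrable_bdd_support bdd_support_mult(1) is_cutoff_bdd_support[OF c] continuous_intros cL)
          (auto simp: is_cutoff_def dest: has_laplacianD)
      show "0 \<le> \<psi> x * - L x" for x
        using c L0[of x] by (intro mult_nonneg_nonneg) (auto simp: is_cutoff_def)
      fix x :: "real^'n" assume x: "norm x \<le> R"
      then have "\<psi> x = 1" using c by (simp add: is_cutoff_def)
      moreover have "m powr p \<le> v x powr p" using m[OF x] m0 p by (intro powr_mono2) auto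
      ultimately show "m powr p * weight a x \<le> \<psi> x * - L x"
        using weight_nonneg[of a x] by (simp add: L mult.commute mult_left_mono)
    qed
    also have "\<dots> \<le> K / (2 * R - R)\<^sup>2 * ball_integral u (2 * R)"
      unfolding K_def by (rule superharmonic_test[OF u upos c])
    also have "\<dots> = K / R\<^sup>2 * ball_integral u (2 * R)" by simp
    also have "ball_integral u (2 * R) \<le> C * 2 ^ ?N / \<kappa> * ball_integral u R"
    proof -
      have "ball_integral u (2 * R) * (R ^ ?N * \<kappa>) = ball_integral (\<lambda>x::real^'n. ball_integral u (2 * R) * 1) R"
        using ball_integral_scale[of "\<lambda>x::real^'n. 1" R] R by (subst ball_integral_cmult) (simp add: \<kappa>_def)
      also have "\<dots> \<le> ball_integral (\<lambda>x. (C * (2 * R) ^ ?N) * u x) R"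
        using R harnack[OF u L0 upos, of "2 * R"] u'(3)
        by (intro ball_integral_mono continuous_intros) auto
      also have "\<dots> = C * (2 * R) ^ ?N * ball_integral u R" by (rule ball_integral_cmult)
      finally show ?thesis using R \<kappa> by (simp add: divide_simps power_mult_distrib mult_ac)
    qed
    finally have *: "m powr p * (R ^ ?N * R powr a * \<omega>) \<le> K / R\<^sup>2 * (C * 2 ^ ?N / \<kappa> * ball_integral u R)"
      using K R by (simp add: mult_left_mono divide_right_mono)
    have "(ball_integral v R / R ^ ?N) powr p = C powr p * m powr p"
      using C R vpos ball_integral_nonneg[of v R]
      by (subst powr_mult[symmetric]) (auto simp: m_def less_imp_le)
    also have "\<dots> = C powr p / (R ^ ?N * R powr a * \<omega>) * (m powr p * (R ^ ?N * R powr a * \<omega>))"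
      using R \<omega> by simp
    also have "\<dots> \<le> C powr p / (R ^ ?N * R powr a * \<omega>) * (K / R\<^sup>2 * (C * 2 ^ ?N / \<kappa> * ball_integral u R))"
      using * C R \<omega> by (intro mult_left_mono) auto
    also have "\<dots> = D * R powr (- 2 - a) * (ball_integral u R / R ^ ?N)"
    proof -
      have "R powr (- 2 - a) = 1 / (R\<^sup>2 * R powr a)" using R by (simp add: powr_diff powr_minus divide_simps)
      then show ?thesis using R \<omega> \<kappa> by (simp add: D_def mult_ac)
    qed
    finally show "(ball_integral v R / R ^ ?N) powr p \<le> D * R powr (- 2 - a) * (ball_integral u R / R ^ ?N)" .
  qed
qed

lemma power_inequalities_decay:
  fixes X Y R C a b p q :: real
  assumes pos: "0 < X" "0 < Y" "0 < R" "0 < C" and pq: "0 \<le> p" "1 < p * q"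
    and 1: "Y powr p \<le> C * R powr (- 2 - a) * X" and 2: "X powr q \<le> C * R powr (- 2 - b) * Y"
  shows "X \<le> C powr ((p + 1) / (p * q - 1)) * R powr (- ((p * (b + 2) + a + 2) / (p * q - 1)))"
proof -
  have "X powr (p * q - 1) * X = (X powr q) powr p"
    using pos by (simp add: powr_powr mult.commute powr_diff)
  also have "\<dots> \<le> (C * R powr (- 2 - b) * Y) powr p"
    using 2 pq pos by (intro powr_mono2) auto
  also have "\<dots> = C powr p * R powr ((- 2 - b) * p) * Y powr p"
    using pos by (simp add: powr_mult powr_powr)
  also have "\<dots> \<le> C powr p * R powr ((- 2 - b) * p) * (C * R powr (- 2 - a) * X)"
    using 1 by (intro mult_left_mono) auto
  also have "\<dots> = C powr (p + 1) * R powr (- (p * (b + 2) + a + 2)) * X"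
  proof -
    have e: "- (p * (b + 2) + a + 2) = (- 2 - b) * p + (- 2 - a)" by (simp add: algebra_simps)
    show ?thesis unfolding e using pos by (simp add: powr_add del: add_diff_eq)
  qed
  finally have le: "X powr (p * q - 1) \<le> C powr (p + 1) * R powr (- (p * (b + 2) + a + 2))"
    using pos by simp
  have "X = (X powr (p * q - 1)) powr (1 / (p * q - 1))"
    using pos pq by (simp add: powr_powr)
  also have "\<dots> \<le> (C powr (p + 1) * R powr (- (p * (b + 2) + a + 2))) powr (1 / (p * q - 1))"
    using le pq by (intro powr_mono2) auto
  also have "\<dots> = C powr ((p + 1) / (p * q - 1)) * R powr (- ((p * (b + 2) + a + 2) / (p * q - 1)))"
    using pos by (simp add: powr_mult powr_powr del: minus_add_distrib)
  finally show ?thesis .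
qed

text \<open>The mean inequalities for both equations, \<open>v\<^sup>p \<lesssim> R\<^sup>-\<^sup>2\<^sup>-\<^sup>a u\<close> and \<open>u\<^sup>q \<lesssim> R\<^sup>-\<^sup>2\<^sup>-\<^sup>b v\<close>, combine to
\<open>u\<^sup>p\<^sup>q \<lesssim> R\<^sup>-\<^sup>p\<^sup>(\<^sup>b\<^sup>+\<^sup>2\<^sup>)\<^sup>-\<^sup>a\<^sup>-\<^sup>2 u\<close>; since \<open>pq > 1\<close> this is the decay of the means at the scaling rate.\<close>

lemma ball_integral_decay:
  fixes u v :: "real^'n::finite \<Rightarrow> real" and a b p q :: real
  assumes par: "0 \<le> p" "0 \<le> q" "0 \<le> a" "0 \<le> b" "1 < p * q"
    and u: "has_laplacian u G L" "\<And>x. 0 < u x" "\<And>x. L x = - (weight a x * v x powr p)"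
    and v: "has_laplacian v H M" "\<And>x. 0 < v x" "\<And>x. M x = - (weight b x * u x powr q)"
  obtains C where "0 < C"
    "\<And>R. 0 < R \<Longrightarrow> ball_integral u R \<le> C * R powr (real CARD('n) - (p * (b + 2) + a + 2) / (p * q - 1))"
proof -
  let ?N = "CARD('n)"
  obtain C1 where C1: "0 < C1" "\<And>R. 0 < R \<Longrightarrow>
      (ball_integral v R / R ^ ?N) powr p \<le> C1 * R powr (- 2 - a) * (ball_integral u R / R ^ ?N)"
    using mean_inequality[OF par(3,1), where 'n='n] u v
    by (metis (no_types, lifting) mult_nonneg_nonneg neg_le_0_iff_le powr_ge_zero weight_nonneg)
  obtain C2 where C2: "0 < C2" "\<And>R. 0 < R \<Longrightarrow>
      (ball_integral u R / R ^ ?N) powr q \<le> C2 * R powr (- 2 - b) * (ball_integral v R / R ^ ?N)"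
    using mean_inequality[OF par(4,2), where 'n='n] u v
    by (metis (no_types, lifting) mult_nonneg_nonneg neg_le_0_iff_le powr_ge_zero weight_nonneg)
  define C where "C = max C1 C2"
  have C: "0 < C" "C1 \<le> C" "C2 \<le> C" using C1 C2 by (auto simp: C_def)
  show ?thesis
  proof (rule that)
    show "0 < C powr ((p + 1) / (p * q - 1))" using C by simp
    fix R :: real assume R: "0 < R"
    define X Y where "X = ball_integral u R / R ^ ?N" and "Y = ball_integral v R / R ^ ?N"
    have XY: "0 < X" "0 < Y"
      using R u v has_laplacianD(3)[OF u(1)] has_laplacianD(3)[OF v(1)]
      by (auto simp: X_def Y_def intro!: divide_pos_pos ball_integral_pos less_imp_le)
    have "X \<le> C powr ((p + 1) / (p * q - 1)) * R powr (- ((p * (b + 2) + a + 2) / (p * q - 1)))"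
    proof (rule power_inequalities_decay[OF XY R C(1) par(1,5)])
      have "C1 * R powr (- 2 - a) * X \<le> C * R powr (- 2 - a) * X"
        using C XY by (intro mult_right_mono) auto
      then show "Y powr p \<le> C * R powr (- 2 - a) * X"
        using C1(2)[OF R] by (simp add: X_def Y_def)
      have "C2 * R powr (- 2 - b) * Y \<le> C * R powr (- 2 - b) * Y"
        using C XY by (intro mult_right_mono) auto
      then show "X powr q \<le> C * R powr (- 2 - b) * Y"
        using C2(2)[OF R] by (simp add: X_def Y_def)
    qed
    then have "ball_integral u R \<le> C powr ((p + 1) / (p * q - 1)) * R powr (- ((p * (b + 2) + a + 2) / (p * q - 1))) * R ^ ?N"
      using R by (simp add: X_def divide_simps)
    also have "\<dots> = C powr ((p + 1) / (p * q - 1)) * R powr (real ?N - (p * (b + 2) + a + 2) / (p * q - 1))"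
      using R by (simp add: powr_diff powr_minus powr_realpow field_simps del: diff_divide_eq_iff divide_diff_eq_iff)
    finally show "ball_integral u R \<le> C powr ((p + 1) / (p * q - 1)) * R powr (real ?N - (p * (b + 2) + a + 2) / (p * q - 1))" .
  qed
qed

lemma powr_neg_exponent_arbitrarily_small:
  fixes e \<epsilon> C :: real
  assumes "e < 0" "0 < \<epsilon>" "0 < C"
  obtains R where "1 \<le> R" "\<And>S. S \<ge> R \<Longrightarrow> C * S powr e < \<epsilon>"
proof -
  have "((\<lambda>x::real. x powr e) \<longlongrightarrow> 0) at_top"
    using assms by (intro tendsto_neg_powr filterlim_ident)
  then have "((\<lambda>x::real. C * x powr e) \<longlongrightarrow> C * 0) at_top"
    by (intro tendsto_mult_left)
  then have "eventually (\<lambda>x::real. C * x powr e < \<epsilon>) at_top"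
    using assms by (intro order_tendstoD) auto
  then obtain R where "\<forall>S\<ge>R. C * S powr e < \<epsilon>" by (auto simp: eventually_at_top_linorder)
  then show ?thesis by (intro that[of "max 1 R"]) auto
qed

text \<open>With \<open>\<beta>\<close> the decay exponent of the means of \<open>u\<close>, the equation of \<open>u\<close> contradicts this decay: the integral of \<open>\<bar>x\<bar>\<^sup>a v\<^sup>p\<close> over a ball is
bounded by the mean of \<open>u\<close> times \<open>R\<^sup>N\<^sup>-\<^sup>2\<close>, that is by a
multiple of \<open>R\<^sup>N\<^sup>-\<^sup>2\<^sup>-\<^sup>\<beta>\<close>, which tends to zero. This covers dimensions one and two.\<close>

lemma no_positive_solution_low_dimension:
  fixes u v :: "real^'n::finite \<Rightarrow> real" and a b p q :: real
  assumes par: "0 \<le> p" "0 \<le> q" "0 \<le> a" "0 \<le> b" "1 < p * q"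
    and u: "has_laplacian u G L" "\<And>x. 0 < u x" "\<And>x. L x = - (weight a x * v x powr p)"
    and v: "has_laplacian v H M" "\<And>x. 0 < v x" "\<And>x. M x = - (weight b x * u x powr q)"
    and dim: "real CARD('n) < 2 + (p * (b + 2) + a + 2) / (p * q - 1)"
  shows False
proof -
  let ?N = "real CARD('n)"
  define \<beta> where "\<beta> = (p * (b + 2) + a + 2) / (p * q - 1)"
  define K where "K = 288 + 36 * ?N"
  obtain C where C: "0 < C" "\<And>R. 0 < R \<Longrightarrow> ball_integral u R \<le> C * R powr (?N - \<beta>)"
    using ball_integral_decay[OF par u v] unfolding \<beta>_def by blast
  note u' = has_laplacianD[OF u(1)]
  define \<epsilon> where "\<epsilon> = ball_integral (\<lambda>x. - L x) 1"
  have L: "0 \<le> - L x" "x \<noteq> 0 \<Longrightarrow> 0 < - L x" for x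
    using weight_nonneg[of a x] weight_pos[of x a] v(2)[of x] by (simp_all add: u(3))
  have \<epsilon>: "0 < \<epsilon>"
    unfolding \<epsilon>_def by (rule ball_integral_pos) (use L u' in \<open>auto intro: continuous_on_minus\<close>)
  have K: "0 < K" by (simp add: K_def add_pos_nonneg)
  obtain R where R: "1 \<le> R" "\<And>S. S \<ge> R \<Longrightarrow> (K * (C * 2 powr (?N - \<beta>))) * S powr (?N - 2 - \<beta>) < \<epsilon>"
    by (rule powr_neg_exponent_arbitrarily_small[of "?N - 2 - \<beta>" \<epsilon> "K * (C * 2 powr (?N - \<beta>))"])
      (use C \<epsilon> K dim \<beta>_def in auto)
  obtain \<psi> P Q where c: "is_cutoff R (2 * R) (\<psi> :: real^'n \<Rightarrow> real) P Q"
    by (rule cutoff_exists[of R "2 * R"]) (use R in auto)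
  have "\<epsilon> \<le> (LBINT x. \<psi> x * - L x)"
    unfolding \<epsilon>_def
  proof (rule ball_integral_le_integral)
    show "integrable lborel (\<lambda>x. \<psi> x * - L x)"
      using c by (intro integrable_bdd_support bdd_support_mult(1) is_cutoff_bdd_support[OF c] continuous_intros u')
        (auto simp: is_cutoff_def dest: has_laplacianD)
    show "0 \<le> \<psi> x * - L x" for x
      using c L(1)[of x] by (intro mult_nonneg_nonneg) (auto simp: is_cutoff_def)
    show "- L x \<le> \<psi> x * - L x" if "norm x \<le> 1" for x
      using c R that by (simp add: is_cutoff_def)
  qed (intro continuous_intros u')
  also have "\<dots> \<le> K / (2 * R - R)\<^sup>2 * ball_integral u (2 * R)"
    unfolding K_def by (rule superharmonic_test[OF u(1,2) c])
  also have "\<dots> \<le> K / (2 * R - R)\<^sup>2 * (C * (2 * R) powr (?N - \<beta>))"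
    using C(2)[of "2 * R"] R K by (intro mult_left_mono) auto
  also have "\<dots> = (K * (C * 2 powr (?N - \<beta>))) * R powr (?N - 2 - \<beta>)"
    using R by (simp add: powr_mult powr_diff mult_ac)
  also have "\<dots> < \<epsilon>" by (rule R) simp
  finally show False by simp
qed

section \<open>Comparison of the two components\<close>

definition soft_positive_part :: "real \<Rightarrow> real"
  where "soft_positive_part s = (1 + max 0 s ^ 3) powr (1/3) - 1"

definition soft_positive_part' :: "real \<Rightarrow> real"
  where "soft_positive_part' s = (1 + max 0 s ^ 3) powr (-2/3) * (max 0 s)\<^sup>2"

definition soft_positive_part'' :: "real \<Rightarrow> real"
  where "soft_positive_part'' s = 2 * (1 + max 0 s ^ 3) powr (-5/3) * max 0 s"

lemma one_plus_max_cube_pos: "0 < 1 + max 0 s ^ 3" for s :: real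
  by (simp add: add_pos_nonneg)

text \<open>\<open>(1 + s\<^sub>+\<^sup>3)\<^sup>1\<^sup>/\<^sup>3 - 1\<close> is a convex \<open>C\<^sup>2\<close> substitute for the positive part \<open>s\<^sub>+\<close>: it maps functions that are
subharmonic where positive to subharmonic functions. Its linear growth is essential, since only
first powers of the solutions have controlled means.\<close>

lemma DERIV_soft_positive_part: "(soft_positive_part has_real_derivative soft_positive_part' s) (at s)"
proof -
  have "((\<lambda>s::real. 1 + max 0 s ^ 3) has_real_derivative 3 * (max 0 s)\<^sup>2) (at s)"
    by (rule derivative_eq_intros refl)+ simp
  from DERIV_fun_powr[OF this one_plus_max_cube_pos, of "1/3"]
  have "((\<lambda>s::real. (1 + max 0 s ^ 3) powr (1/3) - 1) has_real_derivative
      1/3 * (1 + max 0 s ^ 3) powr (1/3 - 1) * (3 * (max 0 s)\<^sup>2) - 0) (at s)"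
    by (intro DERIV_diff DERIV_const) simp
  then show ?thesis
    unfolding soft_positive_part_def[abs_def] soft_positive_part'_def by simp
qed

lemma DERIV_soft_positive_part': "(soft_positive_part' has_real_derivative soft_positive_part'' s) (at s)"
proof -
  let ?P = "1 + max 0 s ^ 3"
  have "((\<lambda>s::real. 1 + max 0 s ^ 3) has_real_derivative 3 * (max 0 s)\<^sup>2) (at s)"
    by (rule derivative_eq_intros refl)+ simp
  from DERIV_fun_powr[OF this one_plus_max_cube_pos, of "-2/3"]
  have 1: "((\<lambda>s::real. (1 + max 0 s ^ 3) powr (-2/3)) has_real_derivative
      - 2 * ?P powr (-5/3) * (max 0 s)\<^sup>2) (at s)"
    by (simp add: mult_ac)
  have 2: "((\<lambda>s::real. (max 0 s)\<^sup>2) has_real_derivative 2 * max 0 s) (at s)"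
    by (rule derivative_eq_intros refl)+ simp
  have P: "?P powr (-2/3) = ?P powr (-5/3) * ?P"
    using powr_add[of ?P "-5/3" 1] one_plus_max_cube_pos[of s] by simp
  have "- 2 * ?P powr (-5/3) * (max 0 s)\<^sup>2 * (max 0 s)\<^sup>2 + 2 * max 0 s * ?P powr (-2/3) = soft_positive_part'' s"
    unfolding P soft_positive_part''_def by (simp add: algebra_simps power2_eq_square power3_eq_cube)
  with DERIV_mult[OF 1 2] show ?thesis
    unfolding soft_positive_part'_def[abs_def] by simp
qed

lemma soft_positive_part_bounds:
  "0 \<le> soft_positive_part s" "soft_positive_part s \<le> max 0 s" "0 < s \<Longrightarrow> 0 < soft_positive_part s"
  "0 \<le> soft_positive_part' s" "0 \<le> soft_positive_part'' s" "s \<le> 0 \<Longrightarrow> soft_positive_part' s = 0"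
proof -
  show "0 \<le> soft_positive_part s" by (simp add: soft_positive_part_def ge_one_powr_ge_zero)
  show "0 < s \<Longrightarrow> 0 < soft_positive_part s"
    using powr_less_mono2[of "1/3" 1 "1 + s ^ 3"] by (simp add: soft_positive_part_def)
  have "(1 + max 0 s ^ 3) powr (1/3) \<le> ((1 + max 0 s) ^ 3) powr (1/3)"
    by (intro powr_mono2) (auto simp: power3_eq_cube algebra_simps)
  also have "\<dots> = ((1 + max 0 s) powr 3) powr (1/3)"
    by (subst powr_numeral) auto
  also have "\<dots> = 1 + max 0 s"
    by (subst powr_powr) simp
  finally show "soft_positive_part s \<le> max 0 s" by (simp add: soft_positive_part_def)
qed (auto simp: soft_positive_part'_def soft_positive_part''_def)

text \<open>The regularised positive part of \<open>w\<close> is subharmonic, so its value at a point is bounded by its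
means over large balls, which are bounded by those of \<open>v\<close> and tend to zero.\<close>

lemma sub_solution_nonpositive:
  fixes w v :: "real^'n::finite \<Rightarrow> real"
  assumes w: "has_laplacian w G L" and L: "\<And>x. 0 < w x \<Longrightarrow> 0 \<le> L x"
    and v: "continuous_on UNIV v" "\<And>x. 0 < v x" "\<And>x. w x \<le> v x"
    and decay: "0 < \<gamma>" "0 < C" "\<And>R. 0 < R \<Longrightarrow> ball_integral v R \<le> C * R powr (real CARD('n) - \<gamma>)"
  shows "w y \<le> 0"
proof (rule ccontr)
  assume "\<not> w y \<le> 0"
  then have y: "0 < w y" by simp
  let ?N = "CARD('n)"
  let ?H = "soft_positive_part" and ?H' = "soft_positive_part'" and ?H'' = "soft_positive_part''"
  note w' = has_laplacianD[OF w]
  have lap: "has_laplacian (\<lambda>x. ?H (w x)) (\<lambda>x. ?H' (w x) *\<^sub>R G x) (\<lambda>x. ?H' (w x) * L x + ?H'' (w x) * (G x \<bullet> G x))"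
  proof (rule has_laplacian_compose[OF w DERIV_soft_positive_part DERIV_soft_positive_part'])
    have "continuous_on UNIV ?H''"
      unfolding soft_positive_part''_def[abs_def]
      by (intro continuous_intros) (use one_plus_max_cube_pos in \<open>force dest: less_imp_neq\<close>)
    then show "continuous_on UNIV (\<lambda>x. ?H'' (w x))"
      by (rule continuous_on_compose2) (use w' in auto)
  qed
  have sub: "0 \<le> ?H' (w x) * L x + ?H'' (w x) * (G x \<bullet> G x)" for x
  proof (cases "0 < w x")
    case True then show ?thesis
      using L[OF True] soft_positive_part_bounds(4,5)[of "w x"] by (intro add_nonneg_nonneg mult_nonneg_nonneg) auto
  next
    case False then show ?thesis
      using soft_positive_part_bounds(5,6)[of "w x"] by simp
  qed
  define I where "I = (LBINT z. mean_kernel (z::real^'n))"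
  have "0 < ball_integral (\<lambda>x::real^'n. 1) (1/2)" by (rule ball_integral_pos) auto
  also have "\<dots> \<le> I"
    unfolding I_def
    by (intro ball_integral_le_integral integrable_bdd_support mean_kernel_continuous mean_kernel_bdd_support mean_kernel_nonneg mean_kernel_half) auto
  finally have I: "0 < I" .
  define \<epsilon> where "\<epsilon> = ?H (w y) * I"
  have \<epsilon>: "0 < \<epsilon>" using I soft_positive_part_bounds(3)[OF y] by (simp add: \<epsilon>_def)
  obtain R0 where R0: "1 \<le> R0" "\<And>S. S \<ge> R0 \<Longrightarrow> (6 * C * 2 powr (real ?N - \<gamma>)) * S powr (- \<gamma>) < \<epsilon>"
    by (rule powr_neg_exponent_arbitrarily_small[of "- \<gamma>" \<epsilon> "6 * C * 2 powr (real ?N - \<gamma>)"])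
      (use decay \<epsilon> in auto)
  define R where "R = max R0 (norm y)"
  have R: "0 < R" "norm y \<le> R" "R0 \<le> R" using R0 by (auto simp: R_def)
  define g where "g x = ?H (w x) * mean_kernel ((1 / R) *\<^sub>R (x - y))" for x
  have H_cont: "continuous_on UNIV (\<lambda>x. ?H (w x))" using has_laplacianD[OF lap] by blast
  have cg: "continuous_on UNIV g"
    unfolding g_def by (intro continuous_intros H_cont continuous_on_compose2[OF mean_kernel_continuous[of UNIV]]) auto
  have g0: "g x = 0" if x: "norm x > 2 * R" for x :: "real^'n"
  proof -
    have "norm x \<le> norm (x - y) + norm y" by (metis norm_triangle_ineq diff_add_cancel)
    then have "norm (x - y) > R" using x R by linarith
    then have "norm ((1 / R) *\<^sub>R (x - y)) > 1" using R by (simp add: divide_simps)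
    then show "g x = 0" by (simp add: g_def mean_kernel_outside)
  qed
  have "\<epsilon> \<le> (LBINT z. ?H (w (y + R *\<^sub>R z)) * mean_kernel z)"
    unfolding \<epsilon>_def I_def using R by (intro subharmonic_mean_value[OF lap sub]) simp
  also have "\<dots> = (LBINT z. g (y + R *\<^sub>R z))"
    using R by (simp add: g_def)
  also have "\<dots> = (LBINT x. g x) / R ^ ?N"
    using R by (intro integral_affine) (auto intro: borel_measurable_continuous_onI cg)
  also have "(LBINT x. g x) \<le> ball_integral (\<lambda>x. 6 * v x) (2 * R)"
  proof (rule integral_le_ball_integral)
    fix x
    have "?H (w x) \<le> v x" using soft_positive_part_bounds(2)[of "w x"] v(2,3)[of x] by linarith
    then have "?H (w x) * mean_kernel ((1 / R) *\<^sub>R (x - y)) \<le> v x * 6"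
      using soft_positive_part_bounds(1)[of "w x"] by (intro mult_mono mean_kernel_le mean_kernel_nonneg) (use v(2)[of x] in auto)
    then show "g x \<le> 6 * v x" by (simp add: g_def)
  qed (use g0 v cg in \<open>auto intro: integrable_bdd_support bdd_supportI continuous_on_mult_left\<close>)
  also have "\<dots> = 6 * ball_integral v (2 * R)" by (rule ball_integral_cmult)
  also have "\<dots> \<le> 6 * (C * (2 * R) powr (real ?N - \<gamma>))"
    using decay(3)[of "2 * R"] R by simp
  finally have "\<epsilon> \<le> 6 * (C * (2 * R) powr (real ?N - \<gamma>)) / R ^ ?N"
    using R by (simp add: divide_right_mono)
  also have "\<dots> = (6 * C * 2 powr (real ?N - \<gamma>)) * R powr (- \<gamma>)"
    using R by (simp add: powr_mult powr_diff powr_minus powr_realpow divide_simps)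
  also have "\<dots> < \<epsilon>" using R by (intro R0)
  finally show False by simp
qed

text \<open>A positive \<open>C\<^sup>2\<close> modification of \<open>s = \<bar>x\<bar>\<^sup>2\<close> inside the ball of radius \<open>d\<close> which does not exceed
\<open>d\<^sup>2\<close> there. Its power \<open>-\<mu> / 2\<close> is therefore \<open>\<bar>x\<bar>\<^sup>-\<^sup>\<mu>\<close> outside that ball and at least \<open>d\<^sup>-\<^sup>\<mu>\<close> inside.\<close>

definition core_profile :: "real \<Rightarrow> real \<Rightarrow> real"
  where "core_profile d s = s + max 0 (d\<^sup>2 - s) ^ 3 / d ^ 4"

lemma core_profile_eq: "d\<^sup>2 \<le> s \<Longrightarrow> core_profile d s = s"
  by (simp add: core_profile_def)

lemma core_profile_pos: assumes "0 < d" "0 \<le> s" shows "0 < core_profile d s"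
proof (cases "s = 0")
  case True then show ?thesis using assms by (simp add: core_profile_def)
next
  case False then show ?thesis using assms by (simp add: core_profile_def add_pos_nonneg)
qed

lemma core_profile_le: assumes "0 < d" "0 \<le> s" "s \<le> d\<^sup>2" shows "core_profile d s \<le> d\<^sup>2"
proof -
  have "(d\<^sup>2 - s) ^ 3 \<le> (d\<^sup>2 - s) * (d\<^sup>2 * d\<^sup>2)"
    unfolding power3_eq_cube mult.assoc using assms by (intro mult_left_mono mult_mono) auto
  then have "(d\<^sup>2 - s) ^ 3 / d ^ 4 \<le> d\<^sup>2 - s"
    using assms by (simp add: divide_simps power4_eq_xxxx power2_eq_square mult.assoc)
  then show ?thesis using assms by (simp add: core_profile_def)
qed

lemma has_laplacian_core:
  fixes d k :: real
  assumes d: "0 < d"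
  obtains G L where "has_laplacian (\<lambda>x::real^'n::finite. core_profile d (x \<bullet> x) powr k) G L"
    "\<And>x. d \<le> norm x \<Longrightarrow> G x = (2 * k * (x \<bullet> x) powr (k - 1)) *\<^sub>R x"
    "\<And>x. d \<le> norm x \<Longrightarrow> L x = 2 * k * (real CARD('n) + 2 * k - 2) * (x \<bullet> x) powr (k - 1)"
    "\<And>x. k = 0 \<Longrightarrow> G x = 0 \<and> L x = 0"
proof -
  define j' where "j' s = 1 - 3 * (max 0 (d\<^sup>2 - s))\<^sup>2 / d ^ 4" for s
  define j'' where "j'' s = 6 * max 0 (d\<^sup>2 - s) / d ^ 4" for s
  let ?j = "\<lambda>x::real^'n. core_profile d (x \<bullet> x)"
  let ?Gj = "\<lambda>x::real^'n. j' (x \<bullet> x) *\<^sub>R (2 *\<^sub>R x)"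
  let ?Lj = "\<lambda>x::real^'n. j' (x \<bullet> x) * (2 * real CARD('n)) + j'' (x \<bullet> x) * ((2 *\<^sub>R x) \<bullet> (2 *\<^sub>R x))"
  have lapj: "has_laplacian ?j ?Gj ?Lj"
  proof (rule has_laplacian_compose[OF has_laplacian_norm_square])
    show "(core_profile d has_real_derivative j' (x \<bullet> x)) (at (x \<bullet> x))" for x :: "real^'n"
    proof -
      have "((\<lambda>s. s + max 0 (d\<^sup>2 - s) ^ 3 / d ^ 4) has_real_derivative
          1 + 3 * (max 0 (d\<^sup>2 - s))\<^sup>2 * (0 - 1) / d ^ 4) (at s)" for s
        by (intro DERIV_add DERIV_ident DERIV_cdivide DERIV_max_0_cube DERIV_diff DERIV_const)
      then show ?thesis by (simp add: core_profile_def[abs_def] j'_def)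
    qed
    show "(j' has_real_derivative j'' (x \<bullet> x)) (at (x \<bullet> x))" for x :: "real^'n"
    proof -
      have "((\<lambda>s. 1 - 3 * (max 0 (d\<^sup>2 - s))\<^sup>2 / d ^ 4) has_real_derivative
          0 - 3 * (2 * max 0 (d\<^sup>2 - s) * (0 - 1)) / d ^ 4) (at s)" for s
        by (intro DERIV_ident DERIV_cdivide DERIV_cmult DERIV_max_0_square DERIV_diff DERIV_const)
      then show ?thesis by (simp add: j'_def[abs_def] j''_def)
    qed
    show "continuous_on UNIV (\<lambda>x::real^'n. j'' (x \<bullet> x))"
      unfolding j''_def using d by (intro continuous_intros) auto
  qed
  have jpos: "0 < ?j x" for x by (rule core_profile_pos[OF d]) simp
  let ?G = "\<lambda>x. (k * ?j x powr (k - 1)) *\<^sub>R ?Gj x"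
  let ?L = "\<lambda>x. (k * ?j x powr (k - 1)) * ?Lj x + (k * ((k - 1) * ?j x powr (k - 2))) * (?Gj x \<bullet> ?Gj x)"
  have lap: "has_laplacian (\<lambda>x. ?j x powr k) ?G ?L"
    by (rule has_laplacian_powr[OF lapj jpos])
  show ?thesis
  proof (rule that[OF lap])
    fix x :: "real^'n" assume x: "d \<le> norm x"
    then have s: "d\<^sup>2 \<le> x \<bullet> x" using d by (simp add: power2_norm_eq_inner[symmetric] power_mono)
    then have j1: "j' (x \<bullet> x) = 1" "j'' (x \<bullet> x) = 0" "?j x = x \<bullet> x"
      by (auto simp: j'_def j''_def core_profile_eq)
    show "?G x = (2 * k * (x \<bullet> x) powr (k - 1)) *\<^sub>R x" by (simp add: j1 mult.commute)
    have "0 < x \<bullet> x" using s d by (smt (verit) zero_less_power)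
    then have "(x \<bullet> x) powr (k - 1) = (x \<bullet> x) powr (k - 2) * (x \<bullet> x)"
      using powr_add[of "x \<bullet> x" "k - 2" 1] by simp
    then show "?L x = 2 * k * (real CARD('n) + 2 * k - 2) * (x \<bullet> x) powr (k - 1)"
      by (simp add: j1 algebra_simps)
  qed simp
qed

text \<open>Completing the square in the Laplacian of \<open>h u\<^sup>\<sigma>\<close>: with \<open>A = \<nabla>u\<close>, \<open>B = \<nabla>h\<close>, \<open>l = \<Delta>h\<close> and
\<open>c = U\<^sup>\<sigma>\<^sup>-\<^sup>2\<close>, the terms without \<open>\<Delta>u\<close> are nonpositive as soon as \<open>h\<^sup>1\<^sup>/\<^sup>(\<^sup>1\<^sup>-\<^sup>\<sigma>\<^sup>)\<close> is superharmonic.\<close>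

lemma product_laplacian_square:
  fixes A B :: "'a::real_inner" and \<sigma> h U c l :: real
  shows "(1 - \<sigma>) * h * (h * (\<sigma> * (\<sigma> - 1) * c) * (A \<bullet> A) + (c * U\<^sup>2) * l + 2 * (B \<bullet> ((\<sigma> * (c * U)) *\<^sub>R A)))
    = c * (- (\<sigma> * ((((1 - \<sigma>) * h) *\<^sub>R A - U *\<^sub>R B) \<bullet> (((1 - \<sigma>) * h) *\<^sub>R A - U *\<^sub>R B)))
        + U\<^sup>2 * (\<sigma> * (B \<bullet> B) + (1 - \<sigma>) * h * l))"
  by (simp add: inner_diff_left inner_diff_right inner_commute algebra_simps power2_eq_square)

text \<open>With \<open>\<sigma> = (q + 1) / (p + 1)\<close> and \<open>\<mu> = (a - b) / (p + 1)\<close>, let \<open>w = v - l \<bar>x\<bar>\<^sup>-\<^sup>\<mu> u\<^sup>\<sigma>\<close>, where the constant \<open>l\<close> is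
chosen so that \<open>w\<close> is subharmonic wherever it is positive. The gradient terms have the right sign
because \<open>\<bar>x\<bar>\<close> to the power \<open>-\<mu> / (1 - \<sigma>)\<close> is superharmonic, which is exactly the hypothesis
\<open>a - b \<le> (N - 2) (p - q)\<close>. If \<open>\<mu> > 0\<close> then \<open>w\<close> is negative near the origin, so the singularity may be
smoothed there. As \<open>w \<le> v\<close> and the means of \<open>v\<close> decay, \<open>w \<le> 0\<close>.\<close>

lemma component_comparison:
  fixes u v :: "real^'n::finite \<Rightarrow> real" and a b p q :: real
  assumes par: "0 \<le> p" "0 \<le> q" "0 \<le> a" "0 \<le> b" "1 < p * q"
    and u: "has_laplacian u Gu Lu" "\<And>x. 0 < u x" "\<And>x. Lu x = - (weight a x * v x powr p)"
    and v: "has_laplacian v Gv Lv" "\<And>x. 0 < v x" "\<And>x. Lv x = - (weight b x * u x powr q)"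
    and pq: "q \<le> p" and ab: "0 \<le> a - b" "a - b \<le> (real CARD('n) - 2) * (p - q)"
  shows "(q + 1) / (p + 1) * (weight a x * v x powr (p + 1)) \<le> weight b x * u x powr (q + 1)"
proof -
  define \<sigma> where "\<sigma> = (q + 1) / (p + 1)"
  define \<mu> where "\<mu> = (a - b) / (p + 1)"
  \<comment> \<open>normalised by \<open>\<sigma> l\<^sup>p\<^sup>+\<^sup>1 = 1\<close>, so that both equations balance where \<open>v = l h u\<^sup>\<sigma>\<close>\<close>
  define l where "l = \<sigma> powr (- 1 / (p + 1))"
  have \<sigma>: "0 < \<sigma>" "\<sigma> \<le> 1" using par pq by (auto simp: \<sigma>_def divide_simps)
  have \<mu>: "0 \<le> \<mu>" "\<mu> * (p + 1) = a - b" using par ab by (auto simp: \<mu>_def)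
  have \<mu>0: "\<mu> = 0 \<longleftrightarrow> a = b" using par by (simp add: \<mu>_def)
  have \<mu>_le: "\<mu> \<le> (1 - \<sigma>) * (real CARD('n) - 2)"
  proof -
    have "1 - \<sigma> = (p - q) / (p + 1)" using par by (simp add: \<sigma>_def divide_simps)
    then show ?thesis
      using ab par by (simp add: \<mu>_def divide_right_mono mult.commute)
  qed
  have l: "0 < l" "l powr (p + 1) = 1 / \<sigma>"
  proof -
    show "0 < l" using \<sigma> by (simp add: l_def)
    have "l powr (p + 1) = \<sigma> powr (- 1 / (p + 1) * (p + 1))" by (simp only: l_def powr_powr)
    also have "- 1 / (p + 1) * (p + 1) = - 1" using par by simp
    finally show "l powr (p + 1) = 1 / \<sigma>" using \<sigma> by (simp add: powr_minus_divide)
  qed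
  have \<sigma>p: "\<sigma> * (p + 1) = q + 1" using par by (simp add: \<sigma>_def)
  note u' = has_laplacianD[OF u(1)] and v' = has_laplacianD[OF v(1)]
  let ?h = "\<lambda>d x::real^'n. core_profile d (x \<bullet> x) powr (- \<mu> / 2)"
  have hp: "?h d x powr (p + 1) * weight a x = weight b x" if "0 < d" "\<mu> = 0 \<or> d \<le> norm x" for d x
  proof (cases "\<mu> = 0")
    case True then show ?thesis
      using \<mu>0 core_profile_pos[OF that(1), of "x \<bullet> x"] by simp
  next
    case False
    then have x: "d \<le> norm x" "0 < norm x" using that by auto
    then have cp: "core_profile d (x \<bullet> x) = norm x powr 2"
      using that(1) by (subst core_profile_eq) (auto simp: power2_norm_eq_inner[symmetric] power_mono)
    have "?h d x powr (p + 1) = norm x powr (2 * (- \<mu> / 2 * (p + 1)))"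
      by (simp only: cp powr_powr mult.assoc)
    then have "?h d x powr (p + 1) = norm x powr (- (\<mu> * (p + 1)))"
      by simp
    moreover have "weight a x = norm x powr a" "weight b x = norm x powr b"
      using x by (auto simp: weight_def)
    ultimately show ?thesis using x by (simp add: \<mu>(2) powr_add[symmetric])
  qed
  \<comment> \<open>the comparison with the smoothed weight, assumed inside the core where the weight is not the true one\<close>
  have main: "v x \<le> l * (?h d x * u x powr \<sigma>)"
    if d: "0 < d" and core: "\<And>x. norm x < d \<Longrightarrow> \<mu> \<noteq> 0 \<Longrightarrow> v x \<le> l * (?h d x * u x powr \<sigma>)" for d x
  proof -
    obtain Gh Lh where h: "has_laplacian (?h d) Gh Lh"
      and Gh: "\<And>x. d \<le> norm x \<Longrightarrow> Gh x = (2 * (- \<mu> / 2) * (x \<bullet> x) powr (- \<mu> / 2 - 1)) *\<^sub>R x"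
      and Lh: "\<And>x. d \<le> norm x \<Longrightarrow> Lh x = 2 * (- \<mu> / 2) * (real CARD('n) + 2 * (- \<mu> / 2) - 2) * (x \<bullet> x) powr (- \<mu> / 2 - 1)"
      and h0: "\<And>x. - \<mu> / 2 = 0 \<Longrightarrow> Gh x = 0 \<and> Lh x = 0"
      using has_laplacian_core[OF d, of "- \<mu> / 2", where 'n='n] by blast
    note lapu = has_laplacian_powr[OF u(1,2), of \<sigma>]
    define w where "w x = v x + (- l) * (?h d x * u x powr \<sigma>)" for x
    define LU where "LU x = ?h d x * ((\<sigma> * u x powr (\<sigma> - 1)) * Lu x + (\<sigma> * ((\<sigma> - 1) * u x powr (\<sigma> - 2))) * (Gu x \<bullet> Gu x))
       + u x powr \<sigma> * Lh x + 2 * (Gh x \<bullet> ((\<sigma> * u x powr (\<sigma> - 1)) *\<^sub>R Gu x))" for x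
    obtain Gw where lapw: "has_laplacian w Gw (\<lambda>x. Lv x + (- l) * LU x)"
      unfolding w_def[abs_def] LU_def
      using has_laplacian_add[OF v(1) has_laplacian_cmult[OF has_laplacian_mult[OF h lapu], of "- l"]] by blast
    have hpos: "0 < ?h d x" for x using core_profile_pos[OF d, of "x \<bullet> x"] by simp
    have Lw: "0 \<le> Lv x + (- l) * LU x" if wx: "0 < w x" for x
    proof -
      have V: "l * (?h d x * u x powr \<sigma>) < v x" using wx by (simp add: w_def)
      have out: "\<mu> = 0 \<or> d \<le> norm x" using core[of x] V by (meson not_le)
      define U where "U = u x"
      have U: "0 < U" using u(2) by (simp add: U_def)
      define c where "c = U powr (\<sigma> - 2)"
      have c: "0 < c" "U powr (\<sigma> - 1) = c * U" "U powr \<sigma> = c * U\<^sup>2"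
        using U powr_add[of U "\<sigma> - 2" 1] powr_add[of U "\<sigma> - 2" 2] by (auto simp: c_def)
      define T where "T = ?h d x * (\<sigma> * (\<sigma> - 1) * c) * (Gu x \<bullet> Gu x) + (c * U\<^sup>2) * Lh x + 2 * (Gh x \<bullet> ((\<sigma> * (c * U)) *\<^sub>R Gu x))"
      have LU: "LU x = ?h d x * (\<sigma> * U powr (\<sigma> - 1)) * Lu x + T"
        unfolding LU_def T_def U_def[symmetric] c(2,3) c_def[symmetric] by (simp add: algebra_simps)
      have "T \<le> 0"
      proof (cases "\<sigma> = 1")
        case True
        then have "\<mu> = 0" using \<mu>_le \<mu> by simp
        then show ?thesis using h0[of x] True by (simp add: T_def)
      next
        case False
        then have s1: "0 < 1 - \<sigma>" using \<sigma> by simp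
        have hh: "\<sigma> * (Gh x \<bullet> Gh x) + (1 - \<sigma>) * ?h d x * Lh x \<le> 0"
        proof (cases "\<mu> = 0")
          case True then show ?thesis using h0[of x] by simp
        next
          case False
          then have x: "d \<le> norm x" using out by simp
          let ?s = "x \<bullet> x"
          have s: "0 < ?s" using x d by (metis inner_gt_zero_iff norm_zero not_le)
          have hx: "?h d x = ?s powr (- \<mu> / 2)"
            using x d by (subst core_profile_eq) (auto simp: power2_norm_eq_inner[symmetric] power_mono)
          let ?t = "?s powr (- 1 - \<mu>)"
          have e1: "?s powr (- \<mu> / 2 - 1) * ?s powr (- \<mu> / 2 - 1) * ?s = ?t"
            using s powr_add[of ?s "- \<mu> / 2 - 1" "- \<mu> / 2 - 1"] powr_add[of ?s "- \<mu> - 2" 1] by simp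
          have e2: "?s powr (- \<mu> / 2) * ?s powr (- \<mu> / 2 - 1) = ?t"
          proof -
            have "- \<mu> / 2 + (- \<mu> / 2 - 1) = - 1 - \<mu>" by simp
            then show ?thesis by (metis powr_add)
          qed
          have "Gh x \<bullet> Gh x = \<mu>\<^sup>2 * (?s powr (- \<mu> / 2 - 1) * ?s powr (- \<mu> / 2 - 1) * ?s)"
            unfolding Gh[OF x] by (simp add: power2_eq_square)
          then have "Gh x \<bullet> Gh x = \<mu>\<^sup>2 * ?t" by (simp only: e1)
          moreover have "?h d x * Lh x = - \<mu> * (real CARD('n) - \<mu> - 2) * (?s powr (- \<mu> / 2) * ?s powr (- \<mu> / 2 - 1))"
            unfolding Lh[OF x] hx by simp
          then have "?h d x * Lh x = - \<mu> * (real CARD('n) - \<mu> - 2) * ?t" by (simp only: e2)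
          ultimately have "\<sigma> * (Gh x \<bullet> Gh x) + (1 - \<sigma>) * ?h d x * Lh x
              = - (\<mu> * ?t) * ((1 - \<sigma>) * (real CARD('n) - 2) - \<mu>)"
            by (simp add: mult.assoc) (simp add: algebra_simps power2_eq_square)
          also have "\<dots> \<le> 0" using \<mu> \<mu>_le by (intro mult_nonpos_nonneg) auto
          finally show ?thesis .
        qed
        have "(1 - \<sigma>) * ?h d x * T \<le> 0"
        proof -
          have "U\<^sup>2 * (\<sigma> * (Gh x \<bullet> Gh x) + (1 - \<sigma>) * ?h d x * Lh x) \<le> 0"
            using hh by (intro mult_nonneg_nonpos) auto
          moreover have "0 \<le> \<sigma> * ((((1 - \<sigma>) * ?h d x) *\<^sub>R Gu x - U *\<^sub>R Gh x) \<bullet> (((1 - \<sigma>) * ?h d x) *\<^sub>R Gu x - U *\<^sub>R Gh x))"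
            using \<sigma> by (intro mult_nonneg_nonneg) auto
          ultimately have neg: "- \<sigma> * ((((1 - \<sigma>) * ?h d x) *\<^sub>R Gu x - U *\<^sub>R Gh x) \<bullet> (((1 - \<sigma>) * ?h d x) *\<^sub>R Gu x - U *\<^sub>R Gh x))
            + U\<^sup>2 * (\<sigma> * (Gh x \<bullet> Gh x) + (1 - \<sigma>) * ?h d x * Lh x) \<le> 0"
            by simp
          show ?thesis
            unfolding T_def product_laplacian_square using c(1) neg by (intro mult_nonneg_nonpos) auto
        qed
        then show ?thesis using s1 hpos[of x] by (simp add: mult_le_0_iff zero_less_mult_iff)
      qed
      then have "l * LU x \<le> l * (?h d x * (\<sigma> * U powr (\<sigma> - 1)) * Lu x)"
        unfolding LU using l by (intro mult_left_mono) auto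
      moreover have "weight b x * U powr q \<le> l * (?h d x * (\<sigma> * U powr (\<sigma> - 1)) * (weight a x * v x powr p))"
      proof -
        have "weight b x * U powr q = l powr (p + 1) * \<sigma> * (?h d x powr (p + 1) * weight a x) * U powr q"
          using hp[OF d out] l \<sigma> by simp
        also have "\<dots> = l * (?h d x * (\<sigma> * U powr (\<sigma> - 1)) * (weight a x * (l * (?h d x * U powr \<sigma>)) powr p))"
        proof -
          have "U powr q = U powr (\<sigma> - 1) * (U powr \<sigma>) powr p"
            using U \<sigma>p by (simp add: powr_powr powr_add[symmetric] algebra_simps)
          moreover have "l powr (p + 1) = l * l powr p" "?h d x powr (p + 1) = ?h d x * ?h d x powr p"
            using l(1) hpos[of x] by (auto simp: powr_add)
          moreover have "(l * (?h d x * U powr \<sigma>)) powr p = l powr p * (?h d x powr p * (U powr \<sigma>) powr p)"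
            using l(1) hpos[of x] by (simp add: powr_mult)
          ultimately show ?thesis by (simp only: mult_ac)
        qed
        also have "\<dots> \<le> l * (?h d x * (\<sigma> * U powr (\<sigma> - 1)) * (weight a x * v x powr p))"
          using V hpos[of x] l \<sigma> par by (intro mult_left_mono powr_mono2 mult_nonneg_nonneg weight_nonneg) (auto simp: U_def)
        finally show ?thesis .
      qed
      ultimately show ?thesis by (simp add: v(3) u(3) U_def)
    qed
    obtain C where C: "0 < C"
      "\<And>R. 0 < R \<Longrightarrow> ball_integral v R \<le> C * R powr (real CARD('n) - (q * (a + 2) + b + 2) / (q * p - 1))"
      using ball_integral_decay[OF par(2,1,4,3) _ v u] par(5) by (auto simp: mult.commute)
    have "w x \<le> 0"
    proof (rule sub_solution_nonpositive[OF lapw Lw v'(3) v(2) _ _ C])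
      show "w x \<le> v x" for x
        using l hpos[of x] by (simp add: w_def)
      show "0 < (q * (a + 2) + b + 2) / (q * p - 1)"
        using par by (intro divide_pos_pos) (auto simp: mult.commute add_nonneg_pos)
    qed
    then show ?thesis by (simp add: w_def)
  qed
  have conclude: ?thesis if d: "0 < d" "\<mu> = 0 \<or> d \<le> norm x" and le: "v x \<le> l * (?h d x * u x powr \<sigma>)" for d
  proof -
    have hpos: "0 < ?h d x" using core_profile_pos[OF d(1), of "x \<bullet> x"] by simp
    have "v x powr (p + 1) \<le> (l * (?h d x * u x powr \<sigma>)) powr (p + 1)"
      using le v(2)[of x] par by (intro powr_mono2) auto
    also have "\<dots> = 1 / \<sigma> * (?h d x powr (p + 1) * u x powr (q + 1))"
      using l hpos u(2)[of x] \<sigma>p by (simp add: powr_mult powr_powr)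
    finally have "\<sigma> * (weight a x * v x powr (p + 1)) \<le> \<sigma> * (weight a x * (1 / \<sigma> * (?h d x powr (p + 1) * u x powr (q + 1))))"
      using \<sigma> by (intro mult_left_mono weight_nonneg) auto
    also have "\<dots> = (?h d x powr (p + 1) * weight a x) * u x powr (q + 1)"
      using \<sigma> by simp
    also have "\<dots> = weight b x * u x powr (q + 1)" by (simp only: hp[OF d])
    finally show ?thesis by (simp add: \<sigma>_def)
  qed
  show ?thesis
  proof (cases "\<mu> = 0")
    case True
    then show ?thesis using main[of 1 x] by (intro conclude[of 1]) auto
  next
    case False
    then have \<mu>p: "0 < \<mu>" using \<mu> by simp
    show ?thesis
    proof (cases "x = 0")
      case True
      have "a \<noteq> 0" using False \<mu>0 ab par by auto
      then have "weight a x = 0" by (simp add: weight_def True)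
      then show ?thesis using weight_nonneg[of b x] by simp
    next
      case x: False
      obtain y where y: "\<And>z. norm z \<le> 1 \<Longrightarrow> u y \<le> u z"
        using continuous_attains_inf[of "cball (0::real^'n) 1" u] continuous_on_subset[OF u'(3)]
        by (auto simp: Ball_def)
      obtain y' where y': "\<And>z. norm z \<le> 1 \<Longrightarrow> v z \<le> v y'"
        using continuous_attains_sup[of "cball (0::real^'n) 1" v] continuous_on_subset[OF v'(3)]
        by (auto simp: Ball_def)
      \<comment> \<open>the core is taken so small that the smoothed weight makes \<open>w\<close> negative in it\<close>
      obtain R where R: "1 \<le> R" "\<And>S. S \<ge> R \<Longrightarrow> v y' * S powr (- \<mu>) < l * u y powr \<sigma>"
        by (rule powr_neg_exponent_arbitrarily_small[of "- \<mu>" "l * u y powr \<sigma>" "v y'"])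
          (use \<mu>p l u(2)[of y] v(2) in auto)
      define S where "S = max R (1 / norm x)"
      have S: "1 \<le> S" "1 / norm x \<le> S" "R \<le> S" using R by (auto simp: S_def)
      have dx: "0 < 1 / S" "1 / S \<le> norm x" using S x by (auto simp: divide_simps mult.commute)
      show ?thesis
      proof (rule conclude[OF dx(1) disjI2[OF dx(2)]], rule main[OF dx(1)])
        fix z :: "real^'n" assume z: "norm z < 1 / S"
        then have z1: "norm z \<le> 1" using S by (smt (verit) divide_le_eq_1)
        have "(norm z)\<^sup>2 \<le> (1 / S)\<^sup>2" using z by (intro power_mono) auto
        then have "core_profile (1 / S) (z \<bullet> z) \<le> (1 / S)\<^sup>2"
          by (intro core_profile_le dx) (auto simp: power2_norm_eq_inner)
        then have "((1 / S)\<^sup>2) powr (- \<mu> / 2) \<le> ?h (1 / S) z"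
          using \<mu> core_profile_pos[OF dx(1), of "z \<bullet> z"] by (intro powr_mono2') auto
        also have "((1 / S)\<^sup>2) powr (- \<mu> / 2) = ((1 / S) powr 2) powr (- \<mu> / 2)"
          using dx by (subst powr_numeral) auto
        also have "\<dots> = (1 / S) powr (- \<mu>)" by (simp add: powr_powr)
        also have "\<dots> = S powr \<mu>" using S by (simp add: powr_divide powr_minus_divide)
        finally have hS: "S powr \<mu> \<le> ?h (1 / S) z" .
        have "v z \<le> v y'" by (rule y'[OF z1])
        also have "\<dots> = (v y' * S powr (- \<mu>)) * S powr \<mu>" using S by (simp add: powr_minus)
        also have "\<dots> \<le> (l * u y powr \<sigma>) * S powr \<mu>"
          using R(2)[OF S(3)] by (intro mult_right_mono) auto
        also have "\<dots> \<le> (l * u z powr \<sigma>) * ?h (1 / S) z"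
          using hS y[OF z1] u(2)[of y] \<sigma> l by (intro mult_mono mult_left_mono powr_mono2) auto
        finally show "v z \<le> l * (?h (1 / S) z * u z powr \<sigma>)" by (simp add: mult_ac)
      qed
    qed
  qed
qed

section \<open>Stability and the energy of powers\<close>

lemma integrable_gradient_norm:
  assumes "has_gradient f F" "bdd_support f"
  shows "integrable lborel (\<lambda>x. F x \<bullet> F x)"
proof -
  obtain r where r: "\<And>x. norm x > r \<Longrightarrow> f x = 0"
    using assms(2) by (auto simp: bdd_support_def)
  have "F x = 0" if "norm x > r" for x
    using has_gradient_zero_off_support[OF assms(1), of r] r that by blast
  then show ?thesis
    by (intro integrable_bdd_support continuous_intros has_gradient_continuous(2)[OF assms(1)] bdd_supportI[of r]) auto
qed

text \<open>Test \<open>-\<Delta>\<zeta>\<close> with \<open>\<phi>\<^sup>2 / \<zeta>\<close> and use that \<open>\<bar>\<nabla>\<phi> - (\<phi> / \<zeta>) \<nabla>\<zeta>\<bar>\<^sup>2\<close> is nonnegative.\<close>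

lemma picone_inequality:
  fixes \<zeta> :: "real^'n::finite \<Rightarrow> real"
  assumes \<zeta>: "has_laplacian \<zeta> G L" and pos: "\<And>x. 0 < \<zeta> x" and \<phi>: "has_gradient \<phi> F" "bdd_support \<phi>"
  shows "(LBINT x. - L x / \<zeta> x * (\<phi> x)\<^sup>2) \<le> (LBINT x. F x \<bullet> F x)"
proof -
  note \<zeta>' = has_laplacianD[OF \<zeta>]
  have nz: "\<zeta> x \<noteq> 0" for x using pos[of x] by simp
  have inv: "has_gradient (\<lambda>x. inverse (\<zeta> x)) (\<lambda>x. (- (inverse (\<zeta> x) ^ Suc (Suc 0))) *\<^sub>R G x)"
    by (rule has_gradient_compose[OF \<zeta>'(1) DERIV_inverse[OF nz]])
      (intro continuous_intros \<zeta>'(3), use nz in auto)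
  have sq: "has_gradient (\<lambda>x. \<phi> x * \<phi> x) (\<lambda>x. (2 * \<phi> x) *\<^sub>R F x)"
    using has_gradient_mult[OF \<phi>(1) \<phi>(1)] unfolding scaleR_add_left[symmetric] mult_2[where 'a=real, symmetric] .
  let ?T = "\<lambda>x. \<phi> x * \<phi> x * inverse (\<zeta> x)"
  let ?GT = "\<lambda>x. (\<phi> x * \<phi> x) *\<^sub>R (- (inverse (\<zeta> x) ^ Suc (Suc 0)) *\<^sub>R G x) + inverse (\<zeta> x) *\<^sub>R ((2 * \<phi> x) *\<^sub>R F x)"
  have T: "has_gradient ?T ?GT" by (rule has_gradient_mult[OF sq inv])
  have bT: "bdd_support ?T" using \<phi>(2) by (intro bdd_support_mult) 
  have cG: "continuous_on UNIV (\<lambda>x. ?GT x \<bullet> G x)"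
    by (intro continuous_intros has_gradient_continuous(2)[OF T] \<zeta>'(4))
  obtain r where r: "\<And>x. norm x > r \<Longrightarrow> ?T x = 0"
    using bT by (auto simp: bdd_support_def)
  have GT0: "?GT x = 0" if "norm x > r" for x
    using has_gradient_zero_off_support[OF T, of r] r that by blast
  have "(LBINT x. - L x / \<zeta> x * (\<phi> x)\<^sup>2) = (LBINT x. - (?T x * L x))"
    by (simp add: divide_inverse power2_eq_square mult_ac)
  also have "\<dots> = (LBINT x. ?GT x \<bullet> G x)"
    using integration_by_parts[OF \<zeta>'(2) T bT] by simp
  also have "\<dots> \<le> (LBINT x. F x \<bullet> F x)"
  proof (rule integral_mono[OF _ integrable_gradient_norm[OF \<phi>]])
    show "integrable lborel (\<lambda>x. ?GT x \<bullet> G x)"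
      by (rule integrable_bdd_support[OF cG], rule bdd_supportI[of r]) (simp only: GT0 inner_zero_left)
    fix x
    have "0 \<le> (F x - (\<phi> x * inverse (\<zeta> x)) *\<^sub>R G x) \<bullet> (F x - (\<phi> x * inverse (\<zeta> x)) *\<^sub>R G x)"
      by (rule inner_ge_zero)
    then show "?GT x \<bullet> G x \<le> F x \<bullet> F x"
      by (simp add: inner_diff_left inner_diff_right inner_add_left inner_commute algebra_simps)
  qed
  finally show ?thesis .
qed

text \<open>Adding the inequalities for \<open>\<zeta>\<close> and \<open>\<eta>\<close>, the unknown quotient \<open>\<zeta> / \<eta>\<close> and its inverse disappear by the
inequality between the arithmetic and the geometric mean. Two different test functions are
allowed; the critical case depends on this.\<close>

lemma stability_inequality:
  fixes \<zeta> \<eta> :: "real^'n::finite \<Rightarrow> real"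
  assumes \<zeta>: "has_laplacian \<zeta> Gz Lz" "\<And>x. 0 < \<zeta> x" "\<And>x. Lz x = - (P x * \<eta> x)"
    and \<eta>: "has_laplacian \<eta> Ge Le" "\<And>x. 0 < \<eta> x" "\<And>x. Le x = - (Q x * \<zeta> x)"
    and PQ: "continuous_on UNIV P" "continuous_on UNIV Q" "\<And>x. 0 \<le> P x" "\<And>x. 0 \<le> Q x"
    and \<phi>: "has_gradient \<phi> F" "bdd_support \<phi>" and \<omega>: "has_gradient \<omega> H" "bdd_support \<omega>"
    and pos: "\<And>x. 0 \<le> \<phi> x" "\<And>x. 0 \<le> \<omega> x"
  shows "2 * (LBINT x. sqrt (P x * Q x) * (\<phi> x * \<omega> x))
    \<le> (LBINT x. F x \<bullet> F x) + (LBINT x. H x \<bullet> H x)"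
proof -
  note \<zeta>' = has_laplacianD[OF \<zeta>(1)] and \<eta>' = has_laplacianD[OF \<eta>(1)]
  have nz: "\<zeta> x \<noteq> 0" "\<eta> x \<noteq> 0" for x using \<zeta>(2)[of x] \<eta>(2)[of x] by auto
  note c\<phi> = has_gradient_continuous(1)[OF \<phi>(1)] and c\<omega> = has_gradient_continuous(1)[OF \<omega>(1)]
  have b: "bdd_support (\<lambda>x. (\<phi> x)\<^sup>2)" "bdd_support (\<lambda>x. (\<omega> x)\<^sup>2)"
    using \<phi>(2) \<omega>(2) by (auto elim: bdd_support_vanish)
  have i1: "integrable lborel (\<lambda>x. - Lz x / \<zeta> x * (\<phi> x)\<^sup>2)"
    by (rule integrable_bdd_support) (intro continuous_intros \<zeta>' c\<phi>, use nz in simp, intro bdd_support_mult b)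
  have i2: "integrable lborel (\<lambda>x. - Le x / \<eta> x * (\<omega> x)\<^sup>2)"
    by (rule integrable_bdd_support) (intro continuous_intros \<eta>' c\<omega>, use nz in simp, intro bdd_support_mult b)
  have i3: "integrable lborel (\<lambda>x. sqrt (P x * Q x) * (\<phi> x * \<omega> x))"
    by (intro integrable_bdd_support continuous_intros PQ c\<phi> c\<omega> bdd_support_mult \<phi>(2))
  have "2 * (LBINT x. sqrt (P x * Q x) * (\<phi> x * \<omega> x)) = (LBINT x. 2 * (sqrt (P x * Q x) * (\<phi> x * \<omega> x)))"
    by simp
  also have "\<dots> \<le> (LBINT x. - Lz x / \<zeta> x * (\<phi> x)\<^sup>2 + - Le x / \<eta> x * (\<omega> x)\<^sup>2)"
  proof (rule integral_mono)
    fix x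
    let ?A = "P x * \<eta> x / \<zeta> x * (\<phi> x)\<^sup>2" and ?B = "Q x * \<zeta> x / \<eta> x * (\<omega> x)\<^sup>2"
    have "?A * ?B = (P x * Q x) * (\<phi> x * \<omega> x)\<^sup>2"
      using nz[of x] by (simp add: power_mult_distrib)
    then have "sqrt (?A * ?B) = sqrt (P x * Q x) * (\<phi> x * \<omega> x)"
      using pos[of x] by (simp add: real_sqrt_mult)
    moreover have "sqrt (?A * ?B) \<le> (?A + ?B) / 2"
      using PQ(3,4)[of x] \<zeta>(2)[of x] \<eta>(2)[of x] by (intro arith_geo_mean_sqrt) auto
    ultimately show "2 * (sqrt (P x * Q x) * (\<phi> x * \<omega> x)) \<le> - Lz x / \<zeta> x * (\<phi> x)\<^sup>2 + - Le x / \<eta> x * (\<omega> x)\<^sup>2"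
      by (simp add: \<zeta>(3) \<eta>(3))
  qed (use i1 i2 i3 in auto)
  also have "\<dots> = (LBINT x. - Lz x / \<zeta> x * (\<phi> x)\<^sup>2) + (LBINT x. - Le x / \<eta> x * (\<omega> x)\<^sup>2)"
    by (rule Bochner_Integration.integral_add[OF i1 i2])
  also have "\<dots> \<le> (LBINT x. F x \<bullet> F x) + (LBINT x. H x \<bullet> H x)"
    by (intro add_mono picone_inequality[OF \<zeta>(1,2) \<phi>] picone_inequality[OF \<eta>(1,2) \<omega>])
  finally show ?thesis .
qed

text \<open>The cross term and the Dirichlet term of \<open>\<nabla>(g\<^sup>s \<Psi>)\<close> are both eliminated: one by testing the equation
of \<open>g\<close> with \<open>g\<^sup>2\<^sup>s\<^sup>-\<^sup>1 \<Psi>\<^sup>2\<close>, the other by integrating \<open>\<nabla>(g\<^sup>2\<^sup>s)\<close> against \<open>\<nabla>(\<Psi>\<^sup>2)\<close>. The remainder contains only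
\<open>g\<^sup>2\<^sup>s\<close> and derivatives of \<open>\<Psi>\<close>, so no gradient of the solution has to be absorbed.\<close>

lemma energy_identity:
  fixes g \<Psi> :: "real^'n::finite \<Rightarrow> real" and s :: real
  assumes g: "has_laplacian g G L" "\<And>x. 0 < g x"
    and \<Psi>: "has_laplacian \<Psi> P Q" "bdd_support \<Psi>" and s: "1/2 < s"
  obtains E where "has_gradient (\<lambda>x. g x powr s * \<Psi> x) E"
    "(LBINT x. E x \<bullet> E x) = s\<^sup>2 / (2 * s - 1) * (LBINT x. g x powr (2 * s - 1) * - L x * (\<Psi> x)\<^sup>2)
      + (LBINT x. g x powr (2 * s) * (P x \<bullet> P x - (s - 1) / (2 * (2 * s - 1)) * (2 * (\<Psi> x * Q x + P x \<bullet> P x))))"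
proof
  note g' = has_laplacianD[OF g(1)] and \<Psi>' = has_laplacianD[OF \<Psi>(1)]
  have nz: "g x \<noteq> 0" for x using g(2)[of x] by simp
  note pw = has_laplacianD(1)[OF has_laplacian_powr[OF g]]
  have cpw: "continuous_on UNIV (\<lambda>x. g x powr t)" for t
    using has_gradient_continuous(1)[OF pw] .
  let ?E = "\<lambda>x. g x powr s *\<^sub>R P x + \<Psi> x *\<^sub>R ((s * g x powr (s - 1)) *\<^sub>R G x)"
  show "has_gradient (\<lambda>x. g x powr s * \<Psi> x) ?E"
    by (rule has_gradient_mult[OF pw \<Psi>'(1)])
  obtain r where r: "\<And>x. norm x > r \<Longrightarrow> \<Psi> x = 0"
    using \<Psi>(2) by (auto simp: bdd_support_def)
  have P0: "P x = 0" if "norm x > r" for x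
    using has_gradient_zero_off_support[OF \<Psi>'(1), of r] r that by blast
  note cont = continuous_intros g' \<Psi>' cpw
  have intg: "integrable lborel f" if "continuous_on UNIV f" "\<And>x. norm x > r \<Longrightarrow> f x = 0" for f :: "real^'n \<Rightarrow> real"
    using that by (intro integrable_bdd_support bdd_supportI)
  define d where "d x = g x powr (2 * s - 2) * (\<Psi> x)\<^sup>2 * (G x \<bullet> G x)" for x
  define y where "y x = g x powr (2 * s - 1) * \<Psi> x * (P x \<bullet> G x)" for x
  define e where "e x = g x powr (2 * s) * (P x \<bullet> P x)" for x
  define f where "f x = g x powr (2 * s - 1) * - L x * (\<Psi> x)\<^sup>2" for x
  define z where "z x = g x powr (2 * s) * (2 * (\<Psi> x * Q x + P x \<bullet> P x))" for x
  have id: "integrable lborel d" and iy: "integrable lborel y" and ie: "integrable lborel e"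
    and "integrable lborel f" and iz: "integrable lborel z"
    unfolding d_def y_def e_def f_def z_def
    by (rule intg, intro cont, simp add: r P0)+
  have powr_split: "g x powr (2 * s) = g x powr s * g x powr s"
    "g x powr (2 * s - 1) = g x powr s * g x powr (s - 1)"
    "g x powr (2 * s - 2) = g x powr (s - 1) * g x powr (s - 1)" for x
    by (simp_all add: powr_add[symmetric])
  have E: "(LBINT x. ?E x \<bullet> ?E x) = s\<^sup>2 * integral\<^sup>L lborel d + 2 * s * integral\<^sup>L lborel y + integral\<^sup>L lborel e"
  proof -
    have "(\<lambda>x. ?E x \<bullet> ?E x) = (\<lambda>x. s\<^sup>2 * d x + 2 * s * y x + e x)"
      unfolding d_def y_def e_def powr_split
      by (rule ext) (simp add: inner_add_left inner_add_right inner_commute algebra_simps power2_eq_square)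
    then show ?thesis using id iy ie by simp
  qed
  have F: "integral\<^sup>L lborel f = (2 * s - 1) * integral\<^sup>L lborel d + 2 * integral\<^sup>L lborel y"
  proof -
    have sq: "has_gradient (\<lambda>x. \<Psi> x * \<Psi> x) (\<lambda>x. (2 * \<Psi> x) *\<^sub>R P x)"
      using has_gradient_mult[OF \<Psi>'(1) \<Psi>'(1)] unfolding scaleR_add_left[symmetric] mult_2[where 'a=real, symmetric] .
    have "bdd_support (\<lambda>x. g x powr (2 * s - 1) * (\<Psi> x * \<Psi> x))"
      using \<Psi>(2) by (intro bdd_support_mult)
    from integration_by_parts[OF g'(2) has_gradient_mult[OF pw sq] this]
    have "(LBINT x. g x powr (2 * s - 1) * (\<Psi> x * \<Psi> x) * L x) =
        - (LBINT x. (g x powr (2 * s - 1) *\<^sub>R ((2 * \<Psi> x) *\<^sub>R P x) +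
            (\<Psi> x * \<Psi> x) *\<^sub>R (((2 * s - 1) * g x powr (2 * s - 1 - 1)) *\<^sub>R G x)) \<bullet> G x)" .
    moreover have "(\<lambda>x. g x powr (2 * s - 1) * (\<Psi> x * \<Psi> x) * L x) = (\<lambda>x. - f x)"
      by (rule ext) (simp add: f_def power2_eq_square)
    moreover have "(\<lambda>x. (g x powr (2 * s - 1) *\<^sub>R ((2 * \<Psi> x) *\<^sub>R P x) +
            (\<Psi> x * \<Psi> x) *\<^sub>R (((2 * s - 1) * g x powr (2 * s - 1 - 1)) *\<^sub>R G x)) \<bullet> G x) = (\<lambda>x. (2 * s - 1) * d x + 2 * y x)"
      by (rule ext) (simp add: d_def y_def inner_add_left algebra_simps power2_eq_square)
    ultimately show ?thesis using id iy by simp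
  qed
  have Z: "integral\<^sup>L lborel z = - (4 * s * integral\<^sup>L lborel y)"
  proof -
    have fld: "has_divergence (\<lambda>x. (2 * \<Psi> x) *\<^sub>R P x) (\<lambda>x. (2 * \<Psi> x) * Q x + (2 *\<^sub>R P x) \<bullet> P x)"
      by (rule has_divergence_scale[OF has_gradient_cmult[OF \<Psi>'(1)] \<Psi>'(2)])
    have "(LBINT x. g x powr (2 * s) * ((2 * \<Psi> x) * Q x + (2 *\<^sub>R P x) \<bullet> P x))
        = - (LBINT x. (((2 * s) * g x powr (2 * s - 1)) *\<^sub>R G x) \<bullet> ((2 * \<Psi> x) *\<^sub>R P x))"
      by (rule integration_by_parts_field[OF fld pw, of r]) (simp add: r P0)
    moreover have "(\<lambda>x. g x powr (2 * s) * ((2 * \<Psi> x) * Q x + (2 *\<^sub>R P x) \<bullet> P x)) = z"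
      by (rule ext) (simp add: z_def algebra_simps)
    moreover have "(\<lambda>x. (((2 * s) * g x powr (2 * s - 1)) *\<^sub>R G x) \<bullet> ((2 * \<Psi> x) *\<^sub>R P x)) = (\<lambda>x. 4 * s * y x)"
      by (rule ext) (simp add: y_def inner_commute)
    ultimately have "integral\<^sup>L lborel z = - (LBINT x. 4 * s * y x)" by (simp only:)
    then show ?thesis by simp
  qed
  have "(\<lambda>x. g x powr (2 * s) * (P x \<bullet> P x - (s - 1) / (2 * (2 * s - 1)) * (2 * (\<Psi> x * Q x + P x \<bullet> P x))))
      = (\<lambda>x. e x - (s - 1) / (2 * (2 * s - 1)) * z x)"
    by (rule ext) (simp add: e_def z_def algebra_simps)
  then have rest: "(LBINT x. g x powr (2 * s) * (P x \<bullet> P x - (s - 1) / (2 * (2 * s - 1)) * (2 * (\<Psi> x * Q x + P x \<bullet> P x))))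
      = integral\<^sup>L lborel e - (s - 1) / (2 * (2 * s - 1)) * integral\<^sup>L lborel z"
    using ie iz by simp
  have "s\<^sup>2 * D + 2 * s * Y + e0 = s\<^sup>2 / (2 * s - 1) * ((2 * s - 1) * D + 2 * Y)
      + (e0 - (s - 1) / (2 * (2 * s - 1)) * (- (4 * s * Y)))" for D Y e0 :: real
  proof -
    define i where "i = 1 / (2 * s - 1)"
    have i: "i * (2 * s - 1) = 1" using s by (simp add: i_def)
    have e: "s\<^sup>2 / (2 * s - 1) = s\<^sup>2 * i" "(s - 1) / (2 * (2 * s - 1)) * (- (4 * s * Y)) = - (2 * s * (s - 1) * i * Y)"
      using s by (simp_all add: i_def field_simps)
    show ?thesis unfolding e using i by algebra
  qed
  then show "(LBINT x. ?E x \<bullet> ?E x) = s\<^sup>2 / (2 * s - 1) * (LBINT x. g x powr (2 * s - 1) * - L x * (\<Psi> x)\<^sup>2)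
      + (LBINT x. g x powr (2 * s) * (P x \<bullet> P x - (s - 1) / (2 * (2 * s - 1)) * (2 * (\<Psi> x * Q x + P x \<bullet> P x))))"
    unfolding E rest Z F[unfolded f_def] by simp
qed

section \<open>Caccioppoli estimates\<close>

text \<open>The functions \<open>w\<close> are cut-off copies of \<open>W\<close>. Their Dirichlet energy and the integral of \<open>f\<close> are bounded
by the square integral of \<open>W\<close> alone, with the scale-invariant factor. The restriction \<open>\<rho> \<le> 2r\<close> makes the
transition region no wider than its distance from the origin.\<close>

definition caccioppoli :: "(real^'n::finite \<Rightarrow> real) \<Rightarrow> (real^'n \<Rightarrow> real) \<Rightarrow> bool"
  where "caccioppoli W f \<longleftrightarrow> (\<exists>C>0. \<forall>r \<rho>. 0 < r \<and> r < \<rho> \<and> \<rho> \<le> 2 * r \<longrightarrow>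
    (\<exists>w E. has_gradient w E \<and> (\<forall>x. norm x \<le> r \<longrightarrow> w x = W x) \<and> (\<forall>x. 0 \<le> w x \<and> w x \<le> W x) \<and>
      (\<forall>x. \<rho> \<le> norm x \<longrightarrow> w x = 0) \<and>
      (LBINT x. E x \<bullet> E x) \<le> C / (\<rho> - r)\<^sup>2 * ball_integral (\<lambda>x. (W x)\<^sup>2) \<rho> \<and>
      ball_integral f r \<le> C / (\<rho> - r)\<^sup>2 * ball_integral (\<lambda>x. (W x)\<^sup>2) \<rho>))"

lemma powr_square: "0 < x \<Longrightarrow> (x powr t)\<^sup>2 = x powr (2 * t)" for x t :: real
  by (simp add: power2_eq_square powr_add[symmetric])

lemma powr_continuous:
  fixes u :: "real^'n::finite \<Rightarrow> real"
  shows "continuous_on UNIV u \<Longrightarrow> (\<And>x. 0 < u x) \<Longrightarrow> continuous_on UNIV (\<lambda>x. u x powr t)"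
  by (intro continuous_on_powr continuous_intros) (auto dest: less_imp_neq[THEN not_sym])

lemma cutoff_commutator_bound:
  fixes G :: "real^'n::finite \<Rightarrow> real"
  assumes c: "is_cutoff r \<rho> \<psi> P Q" and r: "0 < r" "r < \<rho>" and G: "continuous_on UNIV G" "\<And>x. 0 \<le> G x"
  shows "\<bar>LBINT x. G x * (P x \<bullet> P x - k * (2 * (\<psi> x * Q x + P x \<bullet> P x)))\<bar>
    \<le> ((1 + 4 * \<bar>k\<bar>) * (288 + 36 * real CARD('n))\<^sup>2) / (\<rho> - r)\<^sup>2 * ball_integral G \<rho>"
proof -
  define K where "K = 288 + 36 * real CARD('n)"
  have K: "1 \<le> K" by (simp add: K_def)
  have \<psi>: "has_laplacian \<psi> P Q" using c by (simp add: is_cutoff_def)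
  note \<psi>' = has_laplacianD[OF \<psi>]
  let ?e = "\<lambda>x. P x \<bullet> P x - k * (2 * (\<psi> x * Q x + P x \<bullet> P x))"
  define M where "M = (1 + 4 * \<bar>k\<bar>) * K\<^sup>2 / (\<rho> - r)\<^sup>2"
  have far: "P x = 0 \<and> Q x = 0" if "norm x > \<rho>" for x using c that by (simp add: is_cutoff_def)
  have bound: "\<bar>?e x\<bar> \<le> M" for x
  proof -
    have "norm (P x) \<le> (288 + 18 * real CARD('n)) / (\<rho> - r)" using c by (simp add: is_cutoff_def)
    also have "\<dots> \<le> K / (\<rho> - r)" using r by (intro divide_right_mono) (auto simp: K_def)
    finally have "(norm (P x))\<^sup>2 \<le> (K / (\<rho> - r))\<^sup>2" by (intro power_mono) auto
    then have P: "P x \<bullet> P x \<le> K\<^sup>2 / (\<rho> - r)\<^sup>2" by (simp add: power2_norm_eq_inner power_divide)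
    have "\<bar>Q x\<bar> \<le> K / (\<rho> - r)\<^sup>2" using c by (simp add: is_cutoff_def K_def)
    also have "\<dots> \<le> K\<^sup>2 / (\<rho> - r)\<^sup>2" using K by (intro divide_right_mono) (auto simp: power2_eq_square)
    finally have "\<bar>\<psi> x\<bar> * \<bar>Q x\<bar> \<le> 1 * (K\<^sup>2 / (\<rho> - r)\<^sup>2)"
      using c by (intro mult_mono) (auto simp: is_cutoff_def abs_le_iff intro: order_trans[of _ 0])
    then have Q: "\<bar>\<psi> x * Q x\<bar> \<le> K\<^sup>2 / (\<rho> - r)\<^sup>2" by (simp add: abs_mult)
    have "\<bar>?e x\<bar> \<le> P x \<bullet> P x + \<bar>k\<bar> * (2 * (\<bar>\<psi> x * Q x\<bar> + P x \<bullet> P x))"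
    proof -
      have "\<bar>?e x\<bar> \<le> \<bar>P x \<bullet> P x\<bar> + \<bar>k * (2 * (\<psi> x * Q x + P x \<bullet> P x))\<bar>" by (rule abs_triangle_ineq4)
      also have "\<bar>k * (2 * (\<psi> x * Q x + P x \<bullet> P x))\<bar> = \<bar>k\<bar> * (2 * \<bar>\<psi> x * Q x + P x \<bullet> P x\<bar>)"
        by (simp only: abs_mult abs_numeral)
      also have "\<dots> \<le> \<bar>k\<bar> * (2 * (\<bar>\<psi> x * Q x\<bar> + P x \<bullet> P x))"
        by (intro mult_left_mono order_trans[OF abs_triangle_ineq]) auto
      finally show ?thesis by simp
    qed
    also have "\<dots> \<le> K\<^sup>2 / (\<rho> - r)\<^sup>2 + \<bar>k\<bar> * (2 * (K\<^sup>2 / (\<rho> - r)\<^sup>2 + K\<^sup>2 / (\<rho> - r)\<^sup>2))"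
      using P Q by (intro add_mono mult_left_mono) auto
    also have "\<dots> = M" by (simp add: M_def algebra_simps add_divide_distrib)
    finally show ?thesis .
  qed
  have "\<bar>LBINT x. G x * ?e x\<bar> \<le> (LBINT x. \<bar>G x * ?e x\<bar>)"
    by (rule integral_abs_bound)
  also have "\<dots> \<le> ball_integral (\<lambda>x. M * G x) \<rho>"
  proof (rule integral_le_ball_integral)
    show "integrable lborel (\<lambda>x. \<bar>G x * ?e x\<bar>)"
      by (rule integrable_bdd_support, intro continuous_intros G \<psi>', rule bdd_supportI[of \<rho>]) (simp add: far)
    show "\<bar>G x * ?e x\<bar> \<le> M * G x" for x
      using mult_left_mono[OF bound[of x] G(2)[of x]] G(2)[of x] by (simp add: abs_mult mult.commute)
  qed (use far G in \<open>auto intro: continuous_on_mult_left\<close>)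
  also have "\<dots> = M * ball_integral G \<rho>" by (rule ball_integral_cmult)
  finally show ?thesis by (simp add: M_def K_def)
qed

text \<open>The consequence of stability that remains once \<open>\<zeta>\<close> and \<open>\<eta>\<close> are eliminated.\<close>

definition stable_weight :: "(real^'n::finite \<Rightarrow> real) \<Rightarrow> bool"
  where "stable_weight g \<longleftrightarrow> (\<forall>\<phi> F \<omega> H. has_gradient \<phi> F \<and> bdd_support \<phi> \<and> has_gradient \<omega> H \<and> bdd_support \<omega> \<and>
    (\<forall>x. 0 \<le> \<phi> x) \<and> (\<forall>x. 0 \<le> \<omega> x) \<longrightarrow>
    2 * (LBINT x. g x * (\<phi> x * \<omega> x)) \<le> (LBINT x. F x \<bullet> F x) + (LBINT x. H x \<bullet> H x))"

lemma stable_weightD: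
  assumes "stable_weight g" "has_gradient \<phi> F" "bdd_support \<phi>" "has_gradient \<omega> H" "bdd_support \<omega>"
    "\<And>x. 0 \<le> \<phi> x" "\<And>x. 0 \<le> \<omega> x"
  shows "2 * (LBINT x. g x * (\<phi> x * \<omega> x)) \<le> (LBINT x. F x \<bullet> F x) + (LBINT x. H x \<bullet> H x)"
  using assms unfolding stable_weight_def by blast

lemma is_cutoffD:
  assumes "is_cutoff r \<rho> \<psi> P Q"
  shows "has_laplacian \<psi> P Q" "0 \<le> \<psi> x" "\<psi> x \<le> 1" "norm x \<le> r \<Longrightarrow> \<psi> x = 1" "\<rho> \<le> norm x \<Longrightarrow> \<psi> x = 0"
    "continuous_on UNIV \<psi>" "bdd_support \<psi>" "bdd_support (\<lambda>x. (\<psi> x)\<^sup>2)"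
proof -
  show "bdd_support \<psi>" by (rule is_cutoff_bdd_support[OF assms])
  then show "bdd_support (\<lambda>x. (\<psi> x)\<^sup>2)" by (auto elim: bdd_support_vanish)
qed (use assms in \<open>auto simp: is_cutoff_def dest: has_laplacianD\<close>)

text \<open>The task that the energy identity leaves for a Caccioppoli estimate: from the stated bound for the energy of
\<open>u\<^sup>t \<psi>\<close> one has to bound the integral of \<open>f \<psi>\<^sup>2\<close> by the scale-invariant quantity \<open>I\<close>. Stability enters here.\<close>

definition test_bound ::
    "(real^'n::finite \<Rightarrow> real) \<Rightarrow> real \<Rightarrow> (real^'n \<Rightarrow> real) \<Rightarrow> real \<Rightarrow> real \<Rightarrow> bool"
  where "test_bound u t f M B \<longleftrightarrow> (\<forall>r \<rho> \<psi> P Q E I. 0 < r \<and> r < \<rho> \<and> \<rho> \<le> 2 * r \<and> is_cutoff r \<rho> \<psi> P Q \<and>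
      has_gradient (\<lambda>x. u x powr t * \<psi> x) E \<and> I = ball_integral (\<lambda>x. (u x powr t)\<^sup>2) \<rho> / (\<rho> - r)\<^sup>2 \<and>
      (LBINT x. E x \<bullet> E x) \<le> t\<^sup>2 / (2 * t - 1) * (LBINT x. f x * (\<psi> x)\<^sup>2) + M * I \<longrightarrow>
      (LBINT x. f x * (\<psi> x)\<^sup>2) \<le> B * I)"

text \<open>The premise of the test bound holds by the energy identity, with \<open>M\<close> bounding the terms of the cutoff; its
conclusion is fed back into the energy.\<close>

lemma caccioppoliI:
  fixes u :: "real^'n::finite \<Rightarrow> real" and t :: real
  assumes u: "has_laplacian u G L" "\<And>x. 0 < u x" and t: "1/2 < t"
    and f: "continuous_on UNIV f" "\<And>x. 0 \<le> f x" "\<And>x. f x = u x powr (2 * t - 1) * - L x"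
    and close: "\<And>M. 0 < M \<Longrightarrow> \<exists>B. test_bound u t f M B"
  shows "caccioppoli (\<lambda>x. u x powr t) f"
proof -
  define A where "A = t\<^sup>2 / (2 * t - 1)"
  have A: "0 < A" using t by (simp add: A_def)
  define M where "M = (1 + 4 * \<bar>(t - 1) / (2 * (2 * t - 1))\<bar>) * (288 + 36 * real CARD('n))\<^sup>2"
  have M: "0 < M" unfolding M_def by (intro mult_pos_pos) (auto simp: add_pos_nonneg)
  obtain B where B: "test_bound u t f M B" using close[OF M] by blast
  define C where "C = max B (A * B + M) + 1 + \<bar>B\<bar>"
  have C: "0 < C" "B \<le> C" "A * B + M \<le> C" by (auto simp: C_def)
  have pc: "continuous_on UNIV (\<lambda>x. u x powr t)" by (rule powr_continuous[OF has_laplacianD(3)[OF u(1)] u(2)])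
  have "\<exists>w E. has_gradient w E \<and> (\<forall>x. norm x \<le> r \<longrightarrow> w x = u x powr t) \<and> (\<forall>x. 0 \<le> w x \<and> w x \<le> u x powr t) \<and>
      (\<forall>x. \<rho> \<le> norm x \<longrightarrow> w x = 0) \<and>
      (LBINT x. E x \<bullet> E x) \<le> C / (\<rho> - r)\<^sup>2 * ball_integral (\<lambda>x. (u x powr t)\<^sup>2) \<rho> \<and>
      ball_integral f r \<le> C / (\<rho> - r)\<^sup>2 * ball_integral (\<lambda>x. (u x powr t)\<^sup>2) \<rho>"
    if r: "0 < r" "r < \<rho>" "\<rho> \<le> 2 * r" for r \<rho>
  proof -
    obtain \<psi> P Q where cut: "is_cutoff r \<rho> (\<psi> :: real^'n \<Rightarrow> real) P Q"
      using cutoff_exists[OF r(1,2)] by blast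
    note \<psi> = is_cutoffD[OF cut]
    obtain E where E: "has_gradient (\<lambda>x. u x powr t * \<psi> x) E"
      and en: "(LBINT x. E x \<bullet> E x) = t\<^sup>2 / (2 * t - 1) * (LBINT x. u x powr (2 * t - 1) * - L x * (\<psi> x)\<^sup>2)
      + (LBINT x. u x powr (2 * t) * (P x \<bullet> P x - (t - 1) / (2 * (2 * t - 1)) * (2 * (\<psi> x * Q x + P x \<bullet> P x))))"
      using energy_identity[OF u \<psi>(1,7) t] by blast
    define I where "I = ball_integral (\<lambda>x. (u x powr t)\<^sup>2) \<rho> / (\<rho> - r)\<^sup>2"
    have I0: "0 \<le> I" unfolding I_def by (intro divide_nonneg_nonneg ball_integral_nonneg) auto
    define F where "F = (LBINT x. f x * (\<psi> x)\<^sup>2)"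
    have "\<bar>LBINT x. (u x powr t)\<^sup>2 * (P x \<bullet> P x - (t - 1) / (2 * (2 * t - 1)) * (2 * (\<psi> x * Q x + P x \<bullet> P x)))\<bar> \<le> M / (\<rho> - r)\<^sup>2 * ball_integral (\<lambda>x. (u x powr t)\<^sup>2) \<rho>"
      unfolding M_def by (rule cutoff_commutator_bound[OF cut r(1,2)]) (auto intro: continuous_on_power pc)
    then have E_le: "(LBINT x. E x \<bullet> E x) \<le> A * F + M * I"
      unfolding en F_def f(3) A_def powr_square[OF u(2)] I_def by simp
    then have F: "F \<le> B * I"
      unfolding F_def using B[unfolded test_bound_def, folded A_def, rule_format, of r \<rho> \<psi> P Q E I] r cut E I_def by blast
    have "A * F \<le> A * (B * I)" using F A by (intro mult_left_mono) auto
    then have "A * F + M * I \<le> (A * B + M) * I" by (simp add: algebra_simps)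
    moreover have "(A * B + M) * I \<le> C * I" "B * I \<le> C * I" using C I0 by (intro mult_right_mono; simp)+
    moreover have "ball_integral f r \<le> F"
      unfolding F_def
    proof (rule ball_integral_le_integral[OF f(1)])
      show "integrable lborel (\<lambda>x. f x * (\<psi> x)\<^sup>2)"
        by (intro integrable_bdd_support continuous_intros f(1) \<psi>(6) bdd_support_mult(2) \<psi>(8))
    qed (use f(2) \<psi>(4) in auto)
    ultimately have "(LBINT x. E x \<bullet> E x) \<le> C * I" "ball_integral f r \<le> C * I" using E_le F by linarith+
    then show ?thesis
      using E \<psi>(2-5) by (intro exI[of _ "\<lambda>x. u x powr t * \<psi> x"] exI[of _ E]) (auto simp: I_def intro: mult_left_le)
  qed
  with C(1) show ?thesis unfolding caccioppoli_def by blast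
qed

text \<open>Insert \<open>u\<^sup>t \<psi>\<close> twice into the stability inequality. By the comparison the left side is at least
\<open>K = \<surd>(pq(q + 1) / (p + 1))\<close> times the integral of \<open>f = \<bar>x\<bar>\<^sup>a v\<^sup>p u\<^sup>2\<^sup>t\<^sup>-\<^sup>1\<close>, while the energy identity gives
\<open>t\<^sup>2 / (2t - 1)\<close> times this integral on the right side, up to terms of the cutoff.\<close>

lemma caccioppoli_coercive:
  fixes u v :: "real^'n::finite \<Rightarrow> real" and a b p q t :: real
  assumes par: "0 \<le> p" "0 \<le> q" "0 \<le> a" "0 \<le> b"
    and u: "has_laplacian u Gu Lu" "\<And>x. 0 < u x" "\<And>x. Lu x = - (weight a x * v x powr p)"
    and v: "continuous_on UNIV v" "\<And>x. 0 < v x"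
    and stab: "stable_weight (\<lambda>x. sqrt (p * weight a x * v x powr (p - 1) * (q * weight b x * u x powr (q - 1))))"
    and comp: "\<And>x. (q + 1) / (p + 1) * (weight a x * v x powr (p + 1)) \<le> weight b x * u x powr (q + 1)"
    and t: "1/2 < t" "t\<^sup>2 / (2 * t - 1) < sqrt (p * q * (q + 1) / (p + 1))"
  shows "caccioppoli (\<lambda>x. u x powr t) (\<lambda>x. weight a x * v x powr p * u x powr (2 * t - 1))"
proof -
  define K where "K = sqrt (p * q * (q + 1) / (p + 1))"
  define A where "A = t\<^sup>2 / (2 * t - 1)"
  have A: "A < K" using t by (simp add: A_def K_def)
  define f where "f x = weight a x * v x powr p * u x powr (2 * t - 1)" for x
  define g where "g x = sqrt (p * weight a x * v x powr (p - 1) * (q * weight b x * u x powr (q - 1)))" for x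
  note pc = powr_continuous[OF has_laplacianD(3)[OF u(1)] u(2)] powr_continuous[OF v]
  have gf: "K * f x \<le> g x * (u x powr t)\<^sup>2" for x
  proof -
    define U V where "U = u x" and "V = v x"
    have UV: "0 < U" "0 < V" using u v by (auto simp: U_def V_def)
    note w = weight_nonneg[of a x] weight_nonneg[of b x]
    have "(K * (weight a x * V powr p))\<^sup>2 = p * q * ((q + 1) / (p + 1) * (weight a x * V powr (p + 1))) * (weight a x * V powr (p - 1))"
    proof -
      have "V powr p * V powr p = V powr (p + 1) * V powr (p - 1)" by (simp add: powr_add[symmetric])
      moreover have "K\<^sup>2 = p * q * ((q + 1) / (p + 1))"
        using par by (simp add: K_def)
      ultimately show ?thesis unfolding power_mult_distrib by (simp add: power2_eq_square mult_ac)
    qed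
    also have "\<dots> \<le> p * q * (weight b x * U powr (q + 1)) * (weight a x * V powr (p - 1))"
      using comp[of x] par w by (intro mult_right_mono mult_left_mono) (auto simp: U_def V_def)
    also have "\<dots> = (g x)\<^sup>2 * U\<^sup>2"
    proof -
      have "U powr (q + 1) = U powr (q - 1) * U\<^sup>2"
        using UV powr_add[of U "q - 1" 2] by (simp add: add.commute)
      moreover have "(g x)\<^sup>2 = p * weight a x * V powr (p - 1) * (q * weight b x * U powr (q - 1))"
        using par w by (simp add: g_def U_def V_def)
      ultimately show ?thesis by (simp add: mult_ac)
    qed
    finally have "(K * (weight a x * V powr p))\<^sup>2 \<le> (g x * U)\<^sup>2" by (simp add: power_mult_distrib)
    moreover have "0 \<le> g x * U" using par w UV by (simp add: g_def)
    ultimately have "K * (weight a x * V powr p) \<le> g x * U" by (rule power2_le_imp_le)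
    then have "K * (weight a x * V powr p) * U powr (2 * t - 1) \<le> g x * U * U powr (2 * t - 1)"
      by (intro mult_right_mono) auto
    moreover have "(U powr t)\<^sup>2 = U * U powr (2 * t - 1)"
      using UV powr_add[of U 1 "2 * t - 1"] by (simp add: powr_square)
    ultimately show ?thesis by (simp add: f_def U_def V_def mult_ac)
  qed
  have cf: "continuous_on UNIV f"
    unfolding f_def[abs_def] by (intro continuous_intros pc weight_continuous par)
  have "caccioppoli (\<lambda>x. u x powr t) f"
  proof (rule caccioppoliI[OF u(1,2) t(1) cf])
    fix M :: real assume "0 < M"
    have "(LBINT x. f x * (\<psi> x)\<^sup>2) \<le> M / (K - A) * I"
      if cut: "is_cutoff r \<rho> (\<psi> :: real^'n \<Rightarrow> real) P Q" and E: "has_gradient (\<lambda>x. u x powr t * \<psi> x) E"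
      and E_le: "(LBINT x. E x \<bullet> E x) \<le> A * (LBINT x. f x * (\<psi> x)\<^sup>2) + M * I" for r \<rho> \<psi> P Q E I
    proof -
    note \<psi> = is_cutoffD[OF cut]
    let ?w = "\<lambda>x. u x powr t * \<psi> x"
    have supp: "bdd_support ?w" using \<psi>(7) by (rule bdd_support_mult(2))
    have "K * (LBINT x. f x * (\<psi> x)\<^sup>2) = (LBINT x. K * (f x * (\<psi> x)\<^sup>2))" by simp
    also have "\<dots> \<le> (LBINT x. g x * (?w x * ?w x))"
    proof (rule integral_mono)
      show "integrable lborel (\<lambda>x. g x * (?w x * ?w x))"
        unfolding g_def by (intro integrable_bdd_support continuous_intros pc weight_continuous par \<psi>(6) bdd_support_mult(2) \<psi>(7))
      show "integrable lborel (\<lambda>x. K * (f x * (\<psi> x)\<^sup>2))"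
        by (intro integrable_bdd_support continuous_intros cf \<psi>(6) bdd_support_mult(2) \<psi>(8))
      show "K * (f x * (\<psi> x)\<^sup>2) \<le> g x * (?w x * ?w x)" for x
        using mult_right_mono[OF gf[of x], of "(\<psi> x)\<^sup>2"] by (simp add: power2_eq_square mult_ac)
    qed
    also have "\<dots> \<le> (LBINT x. E x \<bullet> E x)"
      using stable_weightD[OF stab E supp E supp] \<psi>(2) by (simp add: g_def)
    also note E_le
    finally show ?thesis using A by (simp add: field_simps)
    qed
    then show "\<exists>B. test_bound u t f M B"
      unfolding test_bound_def A_def by blast
  qed (simp_all add: f_def weight_nonneg u(3))
  then show ?thesis unfolding f_def .
qed

lemma weight_split:
  assumes "0 \<le> b" "b \<le> a" "0 < e" "m * e = a - b"
  shows "weight m x powr e * weight b x = weight a x"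
proof (cases "m = 0")
  case True then show ?thesis using assms by (simp add: weight_def)
next
  case False
  then have "0 < m" using assms by (metis diff_ge_0_iff_ge less_eq_real_def mult_nonneg_nonpos2 not_le zero_less_mult_iff mult_eq_0_iff)
  then have "a \<noteq> 0" using assms mult_pos_pos[of m e] by linarith
  show ?thesis
  proof (cases "x = 0")
    case True then show ?thesis using False \<open>a \<noteq> 0\<close> by (simp add: weight_def)
  next
    case x: False
    have "weight m x powr e = norm x powr (a - b)" using False x assms(4) by (simp add: weight_def powr_powr)
    moreover have "weight b x = norm x powr b" "weight a x = norm x powr a" using x by (auto simp: weight_def)
    ultimately show ?thesis using x by (simp add: powr_add[symmetric])
  qed
qed

text \<open>Pointwise estimates at the critical value \<open>pq\<sigma> = 1\<close>, where \<open>\<omega> \<le> u\<close> is the comparison of the components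
written at the level of \<open>u\<close>. The first one is \<open>U + \<omega> \<ge> 2 \<surd>(\<omega>U)\<close>; both use that \<open>\<omega> / U \<le> 1\<close> enters with a
favourable exponent because \<open>0 \<le> q \<le> 1\<close>.\<close>

lemma critical_pointwise:
  fixes U V Wa Wb w p q \<sigma> :: real
  defines "\<omega> \<equiv> \<sigma> powr (1 / (q + 1)) * w * V powr (1 / \<sigma>)"
  assumes pos: "0 < U" "0 < V" "0 \<le> Wa" "0 \<le> Wb" "0 \<le> w" and split: "w powr (q + 1) * Wb = Wa"
    and pq: "0 \<le> p" "0 \<le> q" "q \<le> 1" and \<sigma>: "\<sigma> = (q + 1) / (p + 1)" "p * q * \<sigma> = 1"
    and comp: "\<sigma> * (Wa * V powr (p + 1)) \<le> Wb * U powr (q + 1)"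
  shows "2 * (Wa * V powr p * U) \<le> sqrt (p * Wa * V powr (p - 1) * (q * Wb * U powr (q - 1))) * (U * (U + \<omega>))"
    and "1 / \<sigma> * (\<omega>\<^sup>2 / V * (Wb * U powr q)) \<le> Wa * V powr p * U"
    and "0 < Wb \<Longrightarrow> \<omega> \<le> U"
proof -
  have \<sigma>0: "0 < \<sigma>" using pq by (simp add: \<sigma>(1))
  have \<omega>0: "0 \<le> \<omega>" using pos by (simp add: \<omega>_def)
  have X: "\<omega> powr (q + 1) = \<sigma> * w powr (q + 1) * V powr (p + 1)"
  proof -
    have "1 / \<sigma> * (q + 1) = p + 1" using pq by (simp add: \<sigma>(1))
    then show ?thesis using pos pq \<sigma>0 by (simp add: \<omega>_def powr_mult powr_powr)
  qed
  have Q: "\<omega> powr (q + 1) * Wb = \<sigma> * (Wa * V powr (p + 1))"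
    by (simp add: X split[symmetric])
  show le: "\<omega> \<le> U" if "0 < Wb"
  proof -
    have "\<omega> powr (q + 1) * Wb \<le> U powr (q + 1) * Wb" using comp Q by (simp add: mult.commute)
    then have "\<omega> powr (q + 1) \<le> U powr (q + 1)" using that by simp
    then have "(\<omega> powr (q + 1)) powr (1 / (q + 1)) \<le> (U powr (q + 1)) powr (1 / (q + 1))"
      by (rule powr_mono2[rotated 2]) (use pq in auto)
    then show ?thesis using \<omega>0 pos pq by (simp add: powr_powr)
  qed
  have WaVp: "Wa * V powr p = \<omega> powr (q + 1) * Wb / (\<sigma> * V)"
    using Q pos \<sigma>0 by (simp add: powr_add field_simps)
  have "2 * (Wa * V powr p * U) \<le> sqrt (p * Wa * V powr (p - 1) * (q * Wb * U powr (q - 1))) * (U * (U + \<omega>)) \<and>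
    1 / \<sigma> * (\<omega>\<^sup>2 / V * (Wb * U powr q)) \<le> Wa * V powr p * U"
  proof (cases "Wb = 0")
    case True then show ?thesis using split by simp
  next
    case False
    then have Wb: "0 < Wb" using pos by simp
    note le = le[OF Wb]
    have key2: "\<omega>\<^sup>2 * U powr q \<le> \<omega> powr (q + 1) * U"
    proof (cases "\<omega> = 0")
      case True then show ?thesis by simp
    next
      case False
      then have "0 < \<omega>" using \<omega>0 by simp
      then have "\<omega>\<^sup>2 = \<omega> powr (q + 1) * \<omega> powr (1 - q)" "U = U powr (1 - q) * U powr q"
        using pos by (simp_all add: powr_add[symmetric])
      moreover have "\<omega> powr (1 - q) \<le> U powr (1 - q)" using le \<omega>0 pq by (intro powr_mono2) auto
      ultimately show ?thesis
        by (metis mult.assoc mult_left_mono mult_right_mono powr_ge_zero)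
    qed
    have 2: "1 / \<sigma> * (\<omega>\<^sup>2 / V * (Wb * U powr q)) \<le> Wa * V powr p * U"
    proof -
      have "(\<omega>\<^sup>2 * U powr q) * (Wb / (\<sigma> * V)) \<le> (\<omega> powr (q + 1) * U) * (Wb / (\<sigma> * V))"
        using key2 Wb \<sigma>0 pos by (intro mult_right_mono) auto
      then show ?thesis by (simp add: WaVp mult_ac)
    qed
    define S where "S = sqrt (p * Wa * V powr (p - 1) * (q * Wb * U powr (q - 1)))"
    define y where "y = sqrt (\<omega> * U)"
    have y: "0 \<le> y" "\<omega> \<le> y" "y * y = \<omega> * U" "2 * y \<le> U + \<omega>"
    proof -
      show "0 \<le> y" "y * y = \<omega> * U" using \<omega>0 pos by (auto simp: y_def)
      show "\<omega> \<le> y" unfolding y_def using le \<omega>0 by (intro real_le_rsqrt) (auto simp: power2_eq_square intro: mult_left_mono)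
      show "2 * y \<le> U + \<omega>" using arith_geo_mean_sqrt[of \<omega> U] \<omega>0 pos by (simp add: y_def)
    qed
    have SUV: "S * (U * V) = Wb / \<sigma> * y powr (q + 1)"
    proof -
      have "S * (U * V) = sqrt (p * Wa * V powr (p - 1) * (q * Wb * U powr (q - 1)) * (U * V)\<^sup>2)"
        using pos by (simp add: S_def real_sqrt_mult)
      also have "p * Wa * V powr (p - 1) * (q * Wb * U powr (q - 1)) * (U * V)\<^sup>2
          = (p * q) * (Wa * V powr (p + 1)) * (Wb * U powr (q + 1))"
      proof -
        have "V powr (p + 1) = V powr (p - 1) * V\<^sup>2" "U powr (q + 1) = U powr (q - 1) * U\<^sup>2"
          using pos powr_add[of V "p - 1" 2] powr_add[of U "q - 1" 2] by (simp_all add: add.commute)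
        then show ?thesis by (simp add: power_mult_distrib mult_ac)
      qed
      also have "p * q = 1 / \<sigma>" using \<sigma>(2) \<sigma>0 by (simp add: field_simps)
      also have "1 / \<sigma> * (Wa * V powr (p + 1)) * (Wb * U powr (q + 1)) = (Wb / \<sigma>)\<^sup>2 * (\<omega> * U) powr (q + 1)"
      proof -
        have "Wa * V powr (p + 1) = \<omega> powr (q + 1) * Wb / \<sigma>" using Q \<sigma>0 by (simp add: field_simps)
        then show ?thesis using \<omega>0 pos by (simp add: powr_mult power2_eq_square)
      qed
      also have "(\<omega> * U) powr (q + 1) = (y powr (q + 1))\<^sup>2"
        using y(1) by (simp add: y(3)[symmetric] powr_mult power2_eq_square)
      finally show ?thesis using Wb \<sigma>0 by (simp add: real_sqrt_mult)
    qed
    have key1: "2 * (\<omega> powr (q + 1) * U) \<le> y powr (q + 1) * (U + \<omega>)"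
    proof -
      have "\<omega> powr (q + 1) * U = \<omega> powr q * (y * y)" using \<omega>0 by (cases "\<omega> = 0") (simp_all add: y(3) powr_add)
      also have "\<dots> \<le> y powr q * (y * y)" using y \<omega>0 pq by (intro mult_right_mono powr_mono2) auto
      also have "\<dots> = y powr (q + 1) * y" using y(1) by (cases "y = 0") (simp_all add: powr_add)
      finally have "2 * (\<omega> powr (q + 1) * U) \<le> y powr (q + 1) * (2 * y)" by simp
      also have "\<dots> \<le> y powr (q + 1) * (U + \<omega>)" using y by (intro mult_left_mono) auto
      finally show ?thesis .
    qed
    have "2 * (Wa * V powr p * U) * V = 2 * (\<omega> powr (q + 1) * U) * (Wb / \<sigma>)"
      using pos \<sigma>0 by (simp add: WaVp)
    also have "\<dots> \<le> y powr (q + 1) * (U + \<omega>) * (Wb / \<sigma>)"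
      using key1 Wb \<sigma>0 by (intro mult_right_mono) auto
    also have "\<dots> = (Wb / \<sigma> * y powr (q + 1)) * (U + \<omega>)" by (simp only: mult_ac)
    also have "\<dots> = S * (U * (U + \<omega>)) * V" by (simp only: SUV[symmetric] mult_ac)
    finally have "2 * (Wa * V powr p * U) \<le> S * (U * (U + \<omega>))" using pos by simp
    with 2 show ?thesis by (simp add: S_def)
  qed
  then show "2 * (Wa * V powr p * U) \<le> sqrt (p * Wa * V powr (p - 1) * (q * Wb * U powr (q - 1))) * (U * (U + \<omega>))"
    and "1 / \<sigma> * (\<omega>\<^sup>2 / V * (Wb * U powr q)) \<le> Wa * V powr p * U" by auto
qed

text \<open>The density that the energy identity leaves for the test function \<open>h \<psi>\<close>, with \<open>A = \<nabla>\<psi>\<close>, \<open>B = \<nabla>h\<close>. The term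
in which no derivative falls on the cutoff has a sign; the others are supported in its transition
region.\<close>

lemma weighted_commutator:
  fixes A B :: "'a::real_inner" and c h \<psi> Q Lh K D m :: real
  assumes c: "0 \<le> c" "c \<le> 1/4" and h: "0 \<le> h" and \<psi>: "0 \<le> \<psi>" "\<psi> \<le> 1"
    and sign: "(1 - 2 * c) * (B \<bullet> B) - 2 * c * (h * Lh) \<le> 0"
    and A: "norm A \<le> K / D" and Q: "\<bar>Q\<bar> \<le> K / D\<^sup>2" and B: "norm B \<le> m * h / D" and D: "0 < D"
  shows "(h *\<^sub>R A + \<psi> *\<^sub>R B) \<bullet> (h *\<^sub>R A + \<psi> *\<^sub>R B) - c * (2 * (h * \<psi> * (h * Q + \<psi> * Lh + 2 * (B \<bullet> A))
     + (h *\<^sub>R A + \<psi> *\<^sub>R B) \<bullet> (h *\<^sub>R A + \<psi> *\<^sub>R B))) \<le> h\<^sup>2 * ((K\<^sup>2 + 2 * K * m + K) / D\<^sup>2)" (is "?lhs \<le> _")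
proof -
  have K: "0 \<le> K" using order_trans[OF norm_ge_zero A] D by (simp add: zero_le_divide_iff)
  have mh: "0 \<le> m * h" using order_trans[OF norm_ge_zero B] D by (simp add: zero_le_divide_iff)
  have "?lhs = \<psi>\<^sup>2 * ((1 - 2 * c) * (B \<bullet> B) - 2 * c * (h * Lh)) + (1 - 2 * c) * (h\<^sup>2 * (A \<bullet> A))
      + (2 - 8 * c) * (h * \<psi> * (A \<bullet> B)) + 2 * c * (h\<^sup>2 * (\<psi> * - Q))"
    by (simp add: inner_add_left inner_add_right inner_commute algebra_simps power2_eq_square)
  also have "\<dots> \<le> 0 + 1 * (h\<^sup>2 * (K / D)\<^sup>2) + 2 * (h * 1 * (K / D * (m * h / D))) + 1 * (h\<^sup>2 * (1 * (K / D\<^sup>2)))"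
  proof (intro add_mono)
    show "\<psi>\<^sup>2 * ((1 - 2 * c) * (B \<bullet> B) - 2 * c * (h * Lh)) \<le> 0"
      using sign by (intro mult_nonneg_nonpos) auto
    have "A \<bullet> A \<le> (K / D)\<^sup>2" using power_mono[OF A, of 2] by (simp add: power2_norm_eq_inner)
    then show "(1 - 2 * c) * (h\<^sup>2 * (A \<bullet> A)) \<le> 1 * (h\<^sup>2 * (K / D)\<^sup>2)"
      using c by (intro mult_mono mult_left_mono) auto
    have "\<bar>A \<bullet> B\<bar> \<le> norm A * norm B" by (rule Cauchy_Schwarz_ineq2)
    also have "\<dots> \<le> K / D * (m * h / D)" using A B K D by (intro mult_mono) auto
    finally have AB: "\<bar>A \<bullet> B\<bar> \<le> K / D * (m * h / D)" .
    have "(2 - 8 * c) * (h * \<psi> * (A \<bullet> B)) \<le> (2 - 8 * c) * (h * \<psi> * \<bar>A \<bullet> B\<bar>)"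
      using c h \<psi> by (intro mult_left_mono) auto
    also have "\<dots> \<le> 2 * (h * 1 * (K / D * (m * h / D)))"
      using c h \<psi> AB by (intro mult_mono mult_nonneg_nonneg) auto
    finally show "(2 - 8 * c) * (h * \<psi> * (A \<bullet> B)) \<le> 2 * (h * 1 * (K / D * (m * h / D)))" .
    have "2 * c * (h\<^sup>2 * (\<psi> * - Q)) \<le> 2 * c * (h\<^sup>2 * (\<psi> * \<bar>Q\<bar>))"
      using c \<psi> by (intro mult_left_mono) auto
    also have "\<dots> \<le> 1 * (h\<^sup>2 * (1 * (K / D\<^sup>2)))"
      using c \<psi> Q by (intro mult_mono mult_nonneg_nonneg) auto
    finally show "2 * c * (h\<^sup>2 * (\<psi> * - Q)) \<le> 1 * (h\<^sup>2 * (1 * (K / D\<^sup>2)))" .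
  qed
  also have "\<dots> = h\<^sup>2 * ((K\<^sup>2 + 2 * K * m + K) / D\<^sup>2)"
    using D by (simp add: field_simps power2_eq_square)
  finally show ?thesis .
qed

text \<open>The weight \<open>\<bar>x\<bar>\<^sup>m\<close> need not be twice differentiable at the origin; this approximation from above is
smooth, and it still satisfies the differential inequality used in the energy estimate below.\<close>

definition regularized_power :: "real \<Rightarrow> real \<Rightarrow> real^'n::finite \<Rightarrow> real"
  where "regularized_power m d x = (x \<bullet> x + d\<^sup>2) powr (m / 2)"

lemma regularized_power_pos: "0 < d \<Longrightarrow> 0 < regularized_power m d x"
  by (simp add: regularized_power_def add_nonneg_pos less_imp_neq[THEN not_sym])

lemma has_laplacian_regularized_power:
  fixes d m :: real
  assumes d: "0 < d"
  shows "has_laplacian (regularized_power m d :: real^'n::finite \<Rightarrow> real)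
    (\<lambda>x. (m * (x \<bullet> x + d\<^sup>2) powr (m / 2 - 1)) *\<^sub>R x)
    (\<lambda>x. m * (x \<bullet> x + d\<^sup>2) powr (m / 2 - 2) * (real CARD('n) * (x \<bullet> x + d\<^sup>2) + (m - 2) * (x \<bullet> x)))"
proof -
  let ?j = "\<lambda>x::real^'n. x \<bullet> x + d\<^sup>2"
  have jpos: "0 < ?j x" for x using d by (simp add: add_nonneg_pos)
  have lapj: "has_laplacian ?j (\<lambda>x. 2 *\<^sub>R x) (\<lambda>x. 2 * real CARD('n))"
    using has_laplacian_add[OF has_laplacian_norm_square has_laplacian_const[of "d\<^sup>2"]] by simp
  note has_laplacian_powr[OF lapj jpos, of "m / 2"]
  moreover have "(m / 2 * ?j x powr (m / 2 - 1)) * (2 * real CARD('n)) + (m / 2 * ((m / 2 - 1) * ?j x powr (m / 2 - 2))) * ((2 *\<^sub>R x) \<bullet> (2 *\<^sub>R x))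
    = m * ?j x powr (m / 2 - 2) * (real CARD('n) * ?j x + (m - 2) * (x \<bullet> x))" for x
  proof -
    have "?j x powr (m / 2 - 1) = ?j x powr (m / 2 - 2) * ?j x"
      using jpos[of x] powr_add[of "?j x" "m / 2 - 2" 1] by simp
    then show ?thesis by (simp add: algebra_simps)
  qed
  ultimately show ?thesis by (simp add: regularized_power_def[abs_def])
qed

lemma regularized_power_ge_weight:
  assumes "0 \<le> m" "0 < d"
  shows "weight m x \<le> regularized_power m d x"
proof (cases "m = 0")
  case True
  have "0 < x \<bullet> x + d\<^sup>2" using assms by (simp add: add_nonneg_pos)
  then show ?thesis using True by (simp add: weight_def regularized_power_def)
next
  case False
  have "norm x powr m = (x \<bullet> x) powr (m / 2)"
    by (simp add: norm_eq_sqrt_inner powr_half_sqrt[symmetric] powr_powr)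
  also have "\<dots> \<le> regularized_power m d x"
    unfolding regularized_power_def using assms by (intro powr_mono2) auto
  finally show ?thesis using False by (simp add: weight_def)
qed

lemma regularized_power_continuous: "0 < d \<Longrightarrow> continuous_on UNIV (regularized_power m d)"
  by (rule has_laplacianD(3)[OF has_laplacian_regularized_power])

text \<open>Dominated convergence, with the largest of the regularised weights as majorant.\<close>

lemma regularized_power_limit:
  fixes g \<psi> :: "real^'n::finite \<Rightarrow> real"
  assumes g: "continuous_on UNIV g" "\<And>x. 0 \<le> g x" and \<psi>: "continuous_on UNIV \<psi>" "bdd_support \<psi>"
    and r: "0 < r" and m: "0 \<le> m"
  shows "(\<lambda>k. LBINT x. g x * (\<kappa> * (regularized_power m (r / real (Suc k)) x * \<psi> x))\<^sup>2)
    \<longlonglongrightarrow> (LBINT x. g x * (\<kappa> * (weight m x * \<psi> x))\<^sup>2)"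
proof -
  let ?h = "\<lambda>k::nat. regularized_power m (r / real (Suc k)) :: real^'n \<Rightarrow> real"
  let ?F = "\<lambda>H x. g x * (\<kappa> * (H x * \<psi> x))\<^sup>2"
  have cts: "continuous_on UNIV (?F H)" if "continuous_on UNIV H" for H
    by (intro continuous_intros g \<psi> that)
  note ch = regularized_power_continuous
  show ?thesis
  proof (rule integral_dominated_convergence[where w="?F (regularized_power m r)"])
    have "bdd_support (\<lambda>x. (\<kappa> * (H x * \<psi> x))\<^sup>2)" for H :: "real^'n \<Rightarrow> real"
      by (rule bdd_support_vanish[OF \<psi>(2)]) simp
    then show "integrable lborel (?F (regularized_power m r))"
      by (intro integrable_bdd_support[OF cts[OF ch[OF r]]] bdd_support_mult(2))
    show "?F (weight m) \<in> borel_measurable lborel"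
      using borel_measurable_continuous_onI[OF cts[OF weight_continuous[OF m]]] by simp
    show "?F (?h k) \<in> borel_measurable lborel" for k
      using borel_measurable_continuous_onI[OF cts[OF ch[of "r / real (Suc k)"]]] r by simp
    show "AE x in lborel. (\<lambda>k. ?F (?h k) x) \<longlonglongrightarrow> ?F (weight m) x"
    proof (rule AE_I2, intro tendsto_intros)
      fix x :: "real^'n"
      show "(\<lambda>k. ?h k x) \<longlonglongrightarrow> weight m x"
      proof (cases "m = 0")
        case True
        have "0 < x \<bullet> x + (r / real (Suc k))\<^sup>2" for k
          using r by (intro add_nonneg_pos) auto
        then have "?h k x = 1" for k using True by (simp add: regularized_power_def less_imp_neq[THEN not_sym])
        then show ?thesis using True by (simp add: weight_def)
      next
        case False
        have "(\<lambda>k. r / real (Suc k)) \<longlonglongrightarrow> 0"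
          using tendsto_mult_right_zero[OF LIMSEQ_inverse_real_of_nat, of r] by (simp add: divide_inverse)
        then have "(\<lambda>k. x \<bullet> x + (r / real (Suc k))\<^sup>2) \<longlonglongrightarrow> x \<bullet> x + 0\<^sup>2"
          by (intro tendsto_intros)
        then have "(\<lambda>k. x \<bullet> x + (r / real (Suc k))\<^sup>2) \<longlonglongrightarrow> x \<bullet> x" by simp
        then have "(\<lambda>k. ?h k x) \<longlonglongrightarrow> (x \<bullet> x) powr (m / 2)"
          unfolding regularized_power_def using False m by (intro tendsto_powr2) auto
        moreover have "(x \<bullet> x) powr (m / 2) = weight m x"
          using False by (simp add: weight_def norm_eq_sqrt_inner powr_half_sqrt[symmetric] powr_powr)
        ultimately show ?thesis by simp
      qed
    qed
    show "AE x in lborel. norm (?F (?h k) x) \<le> ?F (regularized_power m r) x" for k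
    proof (rule AE_I2)
      fix x :: "real^'n"
      have "r / real (Suc k) \<le> r" using r by (simp add: divide_simps)
      then have "(r / real (Suc k))\<^sup>2 \<le> r\<^sup>2" using r by (intro power_mono) auto
      then have "0 \<le> ?h k x" "?h k x \<le> regularized_power m r x"
        unfolding regularized_power_def using m by (auto intro!: powr_mono2)
      then have "(?h k x)\<^sup>2 * (\<kappa>\<^sup>2 * (\<psi> x)\<^sup>2) \<le> (regularized_power m r x)\<^sup>2 * (\<kappa>\<^sup>2 * (\<psi> x)\<^sup>2)"
        by (intro mult_right_mono power_mono) auto
      then have "(\<kappa> * (?h k x * \<psi> x))\<^sup>2 \<le> (\<kappa> * (regularized_power m r x * \<psi> x))\<^sup>2"
        by (simp add: power_mult_distrib mult_ac)
      then show "norm (?F (?h k) x) \<le> ?F (regularized_power m r) x"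
        using g(2)[of x] by (simp add: abs_mult mult_left_mono)
    qed
  qed
qed

text \<open>The energy identity with \<open>\<Psi> = \<kappa> (\<bar>x\<bar>\<^sup>2 + d\<^sup>2)\<^sup>m\<^sup>/\<^sup>2 \<psi>\<close>. The term in which both derivatives fall on the weight is
nonpositive because \<open>m \<le> (s - 1) (N - 2)\<close>. The others live where \<open>\<bar>x\<bar> \<ge> r\<close>; there the weight is comparable to
\<open>\<bar>x\<bar>\<^sup>m\<close>, and the domination by \<open>u\<close> applies.\<close>

lemma weighted_power_energy:
  fixes u v :: "real^'n::finite \<Rightarrow> real" and s m \<kappa> :: real
  assumes v: "has_laplacian v G L" "\<And>x. 0 < v x" and u: "continuous_on UNIV u"
    and s: "1 < s" and m: "0 \<le> m" "m \<le> (s - 1) * (real CARD('n) - 2)" and \<kappa>: "0 < \<kappa>"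
    and dom: "\<And>x. x \<noteq> 0 \<Longrightarrow> \<kappa> * weight m x * v x powr s \<le> u x"
  shows "\<exists>M>0. \<forall>r \<rho> d \<psi> P Q. 0 < r \<and> r < \<rho> \<and> \<rho> \<le> 2 * r \<and> is_cutoff r \<rho> \<psi> P Q \<and> 0 < d \<and> d \<le> r \<longrightarrow>
    (\<exists>H. has_gradient (\<lambda>x. v x powr s * (\<kappa> * (regularized_power m d x * \<psi> x))) H \<and>
        (LBINT x. H x \<bullet> H x)
          \<le> s\<^sup>2 / (2 * s - 1) * (LBINT x. v x powr (2 * s - 1) * - L x * (\<kappa> * (regularized_power m d x * \<psi> x))\<^sup>2)
            + M * (ball_integral (\<lambda>x. (u x)\<^sup>2) \<rho> / (\<rho> - r)\<^sup>2))"
proof -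
  have s_half: "1/2 < s" using s by simp
  define c where "c = (s - 1) / (2 * (2 * s - 1))"
  have c: "0 \<le> c" "c \<le> 1/4" using s by (auto simp: c_def divide_simps)
  define K where "K = 288 + 36 * real CARD('n)"
  have K: "1 \<le> K" by (simp add: K_def)
  define M2 where "M2 = 2 powr m * (K\<^sup>2 + 2 * K * m + K)"
  have Km: "0 < K\<^sup>2 + 2 * K * m + K" using K m by (intro add_nonneg_pos add_nonneg_nonneg mult_nonneg_nonneg) auto
  then have M: "0 < M2" by (simp add: M2_def)
  note pc = powr_continuous[OF has_laplacianD(3)[OF v(1)] v(2)]
  let ?h = "regularized_power m :: real \<Rightarrow> real^'n \<Rightarrow> real"
  show ?thesis
  proof (intro exI[of _ M2] conjI allI impI M, elim conjE)
    fix r \<rho> d \<psi> P Q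
    assume r: "0 < r" "r < \<rho>" "\<rho> \<le> 2 * r" and cut: "is_cutoff r \<rho> (\<psi> :: real^'n \<Rightarrow> real) P Q" and d: "0 < d" "d \<le> r"
    note \<psi> = is_cutoffD[OF cut]
    define I where "I = ball_integral (\<lambda>x. (u x)\<^sup>2) \<rho> / (\<rho> - r)\<^sup>2"
    let ?j = "\<lambda>x::real^'n. x \<bullet> x + d\<^sup>2"
    have jpos: "0 < ?j x" for x using d by (simp add: add_nonneg_pos)
    let ?Gh = "\<lambda>x::real^'n. (m * ?j x powr (m / 2 - 1)) *\<^sub>R x"
    let ?Lh = "\<lambda>x::real^'n. m * ?j x powr (m / 2 - 2) * (real CARD('n) * ?j x + (m - 2) * (x \<bullet> x))"
    have laph: "has_laplacian (?h d) ?Gh ?Lh"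
      by (rule has_laplacian_regularized_power[OF d(1)])
    let ?P = "\<lambda>x. ?h d x *\<^sub>R P x + \<psi> x *\<^sub>R ?Gh x"
    let ?Q = "\<lambda>x. ?h d x * Q x + \<psi> x * ?Lh x + 2 * (?Gh x \<bullet> P x)"
    have lap\<Psi>: "has_laplacian (\<lambda>x. \<kappa> * (?h d x * \<psi> x)) (\<lambda>x. \<kappa> *\<^sub>R ?P x) (\<lambda>x. \<kappa> * ?Q x)"
      by (rule has_laplacian_cmult[OF has_laplacian_mult[OF laph \<psi>(1)]])
    have b\<Psi>: "bdd_support (\<lambda>x. \<kappa> * (?h d x * \<psi> x))"
      by (intro bdd_support_mult(2) \<psi>(7))
    obtain H where H: "has_gradient (\<lambda>x. v x powr s * (\<kappa> * (?h d x * \<psi> x))) H"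
      and enH: "(LBINT x. H x \<bullet> H x) = s\<^sup>2 / (2 * s - 1) * (LBINT x. v x powr (2 * s - 1) * - L x * (\<kappa> * (?h d x * \<psi> x))\<^sup>2)
        + (LBINT x. v x powr (2 * s) * ((\<kappa> *\<^sub>R ?P x) \<bullet> (\<kappa> *\<^sub>R ?P x) - (s - 1) / (2 * (2 * s - 1)) *
           (2 * (\<kappa> * (?h d x * \<psi> x) * (\<kappa> * ?Q x) + (\<kappa> *\<^sub>R ?P x) \<bullet> (\<kappa> *\<^sub>R ?P x)))))"
      using energy_identity[OF v(1,2) lap\<Psi> b\<Psi> s_half] by blast
    let ?e = "\<lambda>x. (\<kappa> *\<^sub>R ?P x) \<bullet> (\<kappa> *\<^sub>R ?P x) - (s - 1) / (2 * (2 * s - 1)) *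
           (2 * (\<kappa> * (?h d x * \<psi> x) * (\<kappa> * ?Q x) + (\<kappa> *\<^sub>R ?P x) \<bullet> (\<kappa> *\<^sub>R ?P x)))"
    have hpos: "0 < ?h d x" for x by (rule regularized_power_pos[OF d(1)])
    have sign: "(1 - 2 * c) * (?Gh x \<bullet> ?Gh x) - 2 * c * (?h d x * ?Lh x) \<le> 0" for x
    proof -
      let ?n = "x \<bullet> x" and ?t = "?j x powr (m - 2)"
      have tpos: "0 \<le> ?t" by simp
      have e1: "?j x powr (m / 2 - 1) * ?j x powr (m / 2 - 1) = ?t"
        by (simp add: powr_add[symmetric])
      have e2: "?j x powr (m / 2) * ?j x powr (m / 2 - 2) = ?t"
        by (simp add: powr_add[symmetric])
      have "?Gh x \<bullet> ?Gh x = m\<^sup>2 * (?j x powr (m / 2 - 1) * ?j x powr (m / 2 - 1)) * ?n"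
        by (simp add: power2_eq_square)
      then have GG: "?Gh x \<bullet> ?Gh x = m\<^sup>2 * ?t * ?n" by (simp only: e1)
      have "?h d x * ?Lh x = m * (?j x powr (m / 2) * ?j x powr (m / 2 - 2)) * (real CARD('n) * ?j x + (m - 2) * ?n)"
        by (simp add: regularized_power_def)
      then have hL: "?h d x * ?Lh x = m * ?t * (real CARD('n) * ?j x + (m - 2) * ?n)" by (simp only: e2)
      have "s * m * ?n \<le> (s - 1) * (real CARD('n) * ?j x + (m - 2) * ?n)"
      proof -
        have "s * m \<le> (s - 1) * (real CARD('n) + m - 2)" using m(2) by (simp add: algebra_simps)
        then have "s * m * ?n \<le> (s - 1) * (real CARD('n) + m - 2) * ?n" by (intro mult_right_mono) auto
        also have "\<dots> = (s - 1) * (real CARD('n) * ?n + (m - 2) * ?n)" by (simp add: algebra_simps)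
        also have "\<dots> \<le> (s - 1) * (real CARD('n) * ?j x + (m - 2) * ?n)"
          using s by (intro mult_left_mono add_right_mono) auto
        finally show ?thesis .
      qed
      then have "(m * ?t) * (s * m * ?n) \<le> (m * ?t) * ((s - 1) * (real CARD('n) * ?j x + (m - 2) * ?n))"
        using m tpos by (intro mult_left_mono) auto
      then have le: "s * (?Gh x \<bullet> ?Gh x) \<le> (s - 1) * (?h d x * ?Lh x)"
        unfolding GG hL by (simp add: power2_eq_square mult_ac)
      have c2: "2 * c = (s - 1) / (2 * s - 1)" "1 - (s - 1) / (2 * s - 1) = s / (2 * s - 1)"
        using s by (simp_all add: c_def field_simps)
      have "(1 - 2 * c) * (?Gh x \<bullet> ?Gh x) - 2 * c * (?h d x * ?Lh x)
          = (s * (?Gh x \<bullet> ?Gh x) - (s - 1) * (?h d x * ?Lh x)) / (2 * s - 1)"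
      proof -
        have "e / k * y - e' / k * y' = (e * y - e' * y') / k" for e e' k y y' :: real
          by (simp add: diff_divide_distrib)
        then show ?thesis unfolding c2 .
      qed
      also have "\<dots> \<le> 0" using le s by (intro divide_nonpos_pos) auto
      finally show ?thesis .
    qed
    have e_eq: "?e x = \<kappa>\<^sup>2 * (?P x \<bullet> ?P x - c * (2 * (?h d x * \<psi> x * ?Q x + ?P x \<bullet> ?P x)))" for x
    proof -
      have "(\<kappa> *\<^sub>R A) \<bullet> (\<kappa> *\<^sub>R A) - c * (2 * (\<kappa> * z * (\<kappa> * y) + (\<kappa> *\<^sub>R A) \<bullet> (\<kappa> *\<^sub>R A)))
        = \<kappa>\<^sup>2 * (A \<bullet> A - c * (2 * (z * y + A \<bullet> A)))" for A :: "real^'n" and y z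
        by (simp add: power2_eq_square algebra_simps)
      then show ?thesis unfolding c_def .
    qed
    have rest: "(LBINT x. v x powr (2 * s) * ?e x) \<le> M2 * I"
    proof -
      have "(LBINT x. v x powr (2 * s) * ?e x) \<le> ball_integral (\<lambda>x. M2 / (\<rho> - r)\<^sup>2 * (u x)\<^sup>2) \<rho>"
      proof (rule integral_le_ball_integral)
        note \<Psi>' = has_laplacianD[OF lap\<Psi>]
        show "continuous_on UNIV (\<lambda>x. M2 / (\<rho> - r)\<^sup>2 * (u x)\<^sup>2)" by (intro continuous_intros u)
        have P\<rho>: "P x = 0 \<and> Q x = 0 \<and> \<psi> x = 0" if "norm x > \<rho>" for x
          using cut that by (simp add: is_cutoff_def)
        show "integrable lborel (\<lambda>x. v x powr (2 * s) * ?e x)"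
          by (rule integrable_bdd_support, intro continuous_on_mult pc continuous_on_diff continuous_on_inner continuous_on_add continuous_on_const \<Psi>',
              rule bdd_supportI[of \<rho>]) (simp add: P\<rho>)
        show "v x powr (2 * s) * ?e x \<le> 0" if "norm x > \<rho>" for x
          using P\<rho>[OF that] by simp
        show "v x powr (2 * s) * ?e x \<le> M2 / (\<rho> - r)\<^sup>2 * (u x)\<^sup>2" if x\<rho>: "norm x \<le> \<rho>" for x
        proof (cases "norm x < r")
          case True
          then have P0: "P x = 0 \<and> Q x = 0" using cut by (simp add: is_cutoff_def)
          have "?P x \<bullet> ?P x - c * (2 * (?h d x * \<psi> x * ?Q x + ?P x \<bullet> ?P x))
              = (\<psi> x)\<^sup>2 * ((1 - 2 * c) * (?Gh x \<bullet> ?Gh x) - 2 * c * (?h d x * ?Lh x))"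
            using P0 by (simp add: power2_eq_square algebra_simps)
          also have "\<dots> \<le> 0" using sign[of x] by (intro mult_nonneg_nonpos) auto
          finally have "?e x \<le> 0" unfolding e_eq by (intro mult_nonneg_nonpos) auto
          then have "v x powr (2 * s) * ?e x \<le> 0" by (intro mult_nonneg_nonpos) auto
          also have "0 \<le> M2 / (\<rho> - r)\<^sup>2 * (u x)\<^sup>2" using M by simp
          finally show ?thesis .
        next
          case False
          then have xr: "r \<le> norm x" by simp
          have D: "0 < \<rho> - r" "\<rho> - r \<le> norm x" using r xr by auto
          have x0: "x \<noteq> 0" using r xr by auto
          have "?P x \<bullet> ?P x - c * (2 * (?h d x * \<psi> x * ?Q x + ?P x \<bullet> ?P x)) \<le> (?h d x)\<^sup>2 * ((K\<^sup>2 + 2 * K * m + K) / (\<rho> - r)\<^sup>2)"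
          proof (rule weighted_commutator[OF c less_imp_le[OF hpos] \<psi>(2,3) sign _ _ _ D(1)])
            have "norm (P x) \<le> (288 + 18 * real CARD('n)) / (\<rho> - r)" using cut by (simp add: is_cutoff_def)
            also have "\<dots> \<le> K / (\<rho> - r)" using r by (intro divide_right_mono) (auto simp: K_def)
            finally show "norm (P x) \<le> K / (\<rho> - r)" .
            show "\<bar>Q x\<bar> \<le> K / (\<rho> - r)\<^sup>2" using cut by (simp add: is_cutoff_def K_def)
            have hj: "?h d x = ?j x powr (m / 2 - 1) * ?j x"
              using jpos[of x] powr_add[of "?j x" "m / 2 - 1" 1] by (simp add: regularized_power_def)
            have "norm x * (\<rho> - r) \<le> norm x * norm x" using D by (intro mult_left_mono) auto
            also have "\<dots> \<le> ?j x" by (simp add: power2_eq_square[symmetric] power2_norm_eq_inner)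
            finally have "m * ?j x powr (m / 2 - 1) * (norm x * (\<rho> - r)) \<le> m * ?j x powr (m / 2 - 1) * ?j x"
              using m by (intro mult_left_mono) auto
            then have "norm (?Gh x) * (\<rho> - r) \<le> m * ?h d x"
              using m by (simp add: hj mult_ac)
            then show "norm (?Gh x) \<le> m * ?h d x / (\<rho> - r)" using D by (simp add: pos_le_divide_eq)
          qed
          then have "?e x \<le> \<kappa>\<^sup>2 * ((?h d x)\<^sup>2 * ((K\<^sup>2 + 2 * K * m + K) / (\<rho> - r)\<^sup>2))"
            unfolding e_eq by (intro mult_left_mono) auto
          then have "v x powr (2 * s) * ?e x \<le> v x powr (2 * s) * (\<kappa>\<^sup>2 * ((?h d x)\<^sup>2 * ((K\<^sup>2 + 2 * K * m + K) / (\<rho> - r)\<^sup>2)))"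
            by (intro mult_left_mono) auto
          also have "\<dots> = (v x powr (2 * s) * (\<kappa>\<^sup>2 * (?h d x)\<^sup>2)) * ((K\<^sup>2 + 2 * K * m + K) / (\<rho> - r)\<^sup>2)"
            by (simp only: mult_ac)
          also have "\<dots> \<le> (2 powr m * (u x)\<^sup>2) * ((K\<^sup>2 + 2 * K * m + K) / (\<rho> - r)\<^sup>2)"
          proof (rule mult_right_mono)
            have "d\<^sup>2 \<le> (norm x)\<^sup>2" using d xr by (intro power_mono) auto
            then have j2: "?j x \<le> 2 * (norm x)\<^sup>2" by (simp add: power2_norm_eq_inner)
            have "(?h d x)\<^sup>2 = ?j x powr m" using jpos[of x] by (simp add: regularized_power_def powr_square)
            also have "\<dots> \<le> (2 * (norm x)\<^sup>2) powr m"
              using j2 m jpos[of x] by (intro powr_mono2) auto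
            also have "\<dots> = 2 powr m * (weight m x)\<^sup>2"
              using x0 by (simp add: powr_mult weight_def power2_eq_square)
            finally have "v x powr (2 * s) * (\<kappa>\<^sup>2 * (?h d x)\<^sup>2) \<le> v x powr (2 * s) * (\<kappa>\<^sup>2 * (2 powr m * (weight m x)\<^sup>2))"
              by (intro mult_left_mono) auto
            also have "\<dots> = 2 powr m * (\<kappa> * weight m x * v x powr s)\<^sup>2"
              by (simp add: power_mult_distrib powr_square[OF v(2)])
            also have "\<dots> \<le> 2 powr m * (u x)\<^sup>2"
              using dom[OF x0] \<kappa> weight_nonneg[of m x]
              by (intro mult_left_mono power_mono) auto
            finally show "v x powr (2 * s) * (\<kappa>\<^sup>2 * (?h d x)\<^sup>2) \<le> 2 powr m * (u x)\<^sup>2" .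
          qed (use Km in auto)
          also have "\<dots> = M2 / (\<rho> - r)\<^sup>2 * (u x)\<^sup>2" by (simp add: M2_def)
          finally show ?thesis .
        qed
      qed
      also have "ball_integral (\<lambda>x. M2 / (\<rho> - r)\<^sup>2 * (u x)\<^sup>2) \<rho> = M2 * I"
        unfolding ball_integral_cmult by (simp add: I_def)
      finally show ?thesis .
    qed
    show "\<exists>H. has_gradient (\<lambda>x. v x powr s * (\<kappa> * (?h d x * \<psi> x))) H \<and>
        (LBINT x. H x \<bullet> H x) \<le> s\<^sup>2 / (2 * s - 1) * (LBINT x. v x powr (2 * s - 1) * - L x * (\<kappa> * (?h d x * \<psi> x))\<^sup>2)
            + M2 * (ball_integral (\<lambda>x. (u x)\<^sup>2) \<rho> / (\<rho> - r)\<^sup>2)"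
      unfolding I_def[symmetric]
    proof (intro exI conjI)
      show "(LBINT x. H x \<bullet> H x) \<le> s\<^sup>2 / (2 * s - 1) * (LBINT x. v x powr (2 * s - 1) * - L x * (\<kappa> * (?h d x * \<psi> x))\<^sup>2) + M2 * I"
        unfolding enH using rest by (rule add_left_mono)
    qed (rule H)
  qed
qed

text \<open>For \<open>pq(q + 1) / (p + 1) = 1\<close> the only admissible exponent is \<open>t = 1\<close>, where testing with \<open>u\<close> alone is
not coercive. In this case \<open>q \<le> 1\<close> and \<open>\<sigma> < 1\<close>, so the second component yields a gain: with \<open>s = 1 / \<sigma>\<close> and
\<open>m = (a - b) / (q + 1)\<close> put \<open>\<omega> = \<kappa> \<bar>x\<bar>\<^sup>m v\<^sup>s\<close>, which would equal \<open>u\<close> if the comparison were an equality. Adding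
the stability inequalities for the pairs \<open>(u, u)\<close> and \<open>(u, \<omega>)\<close>, the left side is at least 4 times the integral
of \<open>f = \<bar>x\<bar>\<^sup>a v\<^sup>p u\<close>, and the right side is at most \<open>3 + s / (2s - 1) < 4\<close> times this integral. The weight
\<open>\<bar>x\<bar>\<^sup>m\<close> contributes a term of the sign of \<open>m - (s - 1) (N - 2)\<close>, which is nonpositive precisely when
\<open>a - b \<le> (N - 2) (p - q)\<close>. The regularisation parameter \<open>d\<close> tends to 0 at the end.\<close>

lemma caccioppoli_critical:
  fixes u v :: "real^'n::finite \<Rightarrow> real" and a b p q :: real
  assumes par: "0 \<le> p" "0 \<le> q" "0 \<le> a" "0 \<le> b" "1 < p * q"
    and u: "has_laplacian u Gu Lu" "\<And>x. 0 < u x" "\<And>x. Lu x = - (weight a x * v x powr p)"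
    and v: "has_laplacian v Gv Lv" "\<And>x. 0 < v x" "\<And>x. Lv x = - (weight b x * u x powr q)"
    and stab: "stable_weight (\<lambda>x. sqrt (p * weight a x * v x powr (p - 1) * (q * weight b x * u x powr (q - 1))))"
    and comp: "\<And>x. (q + 1) / (p + 1) * (weight a x * v x powr (p + 1)) \<le> weight b x * u x powr (q + 1)"
    and ab: "0 \<le> a - b" "a - b \<le> (real CARD('n) - 2) * (p - q)"
    and crit: "p * q * (q + 1) / (p + 1) = 1"
  shows "caccioppoli (\<lambda>x. u x powr 1) (\<lambda>x. weight a x * v x powr p * u x)"
proof -
  define \<sigma> where "\<sigma> = (q + 1) / (p + 1)"
  have \<sigma>: "p * q * \<sigma> = 1" using crit unfolding \<sigma>_def times_divide_eq_right .
  have \<sigma>01: "0 < \<sigma>" "\<sigma> < 1"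
  proof -
    show "0 < \<sigma>" using par by (simp add: \<sigma>_def)
    then show "\<sigma> < 1" using \<sigma> par(5) by (smt (verit) mult_less_cancel_right mult_cancel_right1 mult_le_cancel_left1)
  qed
  have q1: "q \<le> 1"
  proof (rule ccontr)
    assume "\<not> q \<le> 1"
    then have "p * 1 \<le> p * q * q" using par by (smt (verit) mult_le_cancel_left1 mult_mono mult.assoc mult_left_mono)
    moreover have "p * q * q + p * q = p + 1" using crit par by (simp add: field_simps)
    ultimately show False using par(5) by simp
  qed
  define s where "s = 1 / \<sigma>"
  have s: "1 < s" and s_eq: "s = (p + 1) / (q + 1)"
    using \<sigma>01 by (simp add: s_def) (simp add: s_def \<sigma>_def)
  define m where "m = (a - b) / (q + 1)"
  have m: "0 \<le> m" "m * (q + 1) = a - b" using ab par by (auto simp: m_def)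
  have m_le: "m \<le> (s - 1) * (real CARD('n) - 2)"
  proof -
    have "s - 1 = (p - q) / (q + 1)" using par by (simp add: s_eq divide_simps)
    then show ?thesis using ab par by (simp add: m_def divide_right_mono mult.commute)
  qed
  define \<kappa> where "\<kappa> = \<sigma> powr (1 / (q + 1))"
  have \<kappa>: "0 < \<kappa>" using \<sigma>01 by (simp add: \<kappa>_def)
  define B where "B = s / (2 * s - 1)"
  have B: "0 < B" "B < 1" using s by (auto simp: B_def divide_simps)
  define f where "f x = weight a x * v x powr p * u x" for x
  define g where "g x = sqrt (p * weight a x * v x powr (p - 1) * (q * weight b x * u x powr (q - 1)))" for x
  define \<omega> where "\<omega> x = \<kappa> * weight m x * v x powr s" for x
  note u' = has_laplacianD[OF u(1)] and v' = has_laplacianD[OF v(1)]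
  note pc = powr_continuous[OF u'(3) u(2)] powr_continuous[OF v'(3) v(2)]
  note wsplit = weight_split[OF par(4) _ _ m(2)]
  have pt: "2 * f x \<le> g x * (u x * (u x + \<omega> x))" "s * ((\<omega> x)\<^sup>2 / v x * (weight b x * u x powr q)) \<le> f x"
     "0 < weight b x \<Longrightarrow> \<omega> x \<le> u x" for x
    using critical_pointwise[where U="u x" and V="v x" and Wa="weight a x" and Wb="weight b x" and w="weight m x" and p=p and q=q and \<sigma>=\<sigma>]
      u(2)[of x] v(2)[of x] weight_nonneg[of a x] weight_nonneg[of b x] weight_nonneg[of m x] wsplit[of x] ab par q1 \<sigma> comp[of x]
    by (auto simp: f_def g_def \<omega>_def s_def \<kappa>_def \<sigma>_def[symmetric])
  have cf: "continuous_on UNIV f"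
    unfolding f_def[abs_def] by (intro continuous_intros pc weight_continuous par u'(3))
  have cg: "continuous_on UNIV g"
    unfolding g_def[abs_def] by (intro continuous_intros pc weight_continuous par)
  have g0: "0 \<le> g x" for x using par weight_nonneg[of a x] weight_nonneg[of b x] by (simp add: g_def)
  let ?h = "regularized_power m :: real \<Rightarrow> real^'n \<Rightarrow> real"
  note ch = regularized_power_continuous
  have dom: "\<kappa> * weight m x * v x powr s \<le> u x" if "x \<noteq> 0" for x
    using pt(3)[OF weight_pos[OF that]] by (simp only: \<omega>_def)
  obtain M2 where M2: "0 < M2" and second: "\<forall>r \<rho> d \<psi> P Q. 0 < r \<and> r < \<rho> \<and> \<rho> \<le> 2 * r \<and> is_cutoff r \<rho> \<psi> P Q \<and> 0 < d \<and> d \<le> r \<longrightarrow>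
      (\<exists>H. has_gradient (\<lambda>x. v x powr s * (\<kappa> * (?h d x * \<psi> x))) H \<and>
        (LBINT x. H x \<bullet> H x) \<le> s\<^sup>2 / (2 * s - 1) * (LBINT x. v x powr (2 * s - 1) * - Lv x * (\<kappa> * (?h d x * \<psi> x))\<^sup>2)
            + M2 * (ball_integral (\<lambda>x. (u x)\<^sup>2) \<rho> / (\<rho> - r)\<^sup>2))"
    using weighted_power_energy[OF v(1,2) u'(3) s m(1) m_le \<kappa> dom] by blast
  have u1: "u x powr 1 = u x" for x using u(2)[of x] by simp
  have "caccioppoli (\<lambda>x. u x powr 1) f"
  proof (rule caccioppoliI[OF u(1,2) _ cf])
    fix M1 :: real assume "0 < M1"
    have bound: "(LBINT x. f x * (\<psi> x)\<^sup>2) \<le> (3 * M1 + M2) / (1 - B) * I"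
      if r: "0 < r" "r < \<rho>" "\<rho> \<le> 2 * r" and cut: "is_cutoff r \<rho> (\<psi> :: real^'n \<Rightarrow> real) P Q"
        and E: "has_gradient (\<lambda>x. u x * \<psi> x) E" and I: "I = ball_integral (\<lambda>x. (u x)\<^sup>2) \<rho> / (\<rho> - r)\<^sup>2"
        and E_le: "(LBINT x. E x \<bullet> E x) \<le> (LBINT x. f x * (\<psi> x)\<^sup>2) + M1 * I" for r \<rho> \<psi> P Q E I
    proof -
      note \<psi> = is_cutoffD[OF cut]
      define F where "F = (LBINT x. f x * (\<psi> x)\<^sup>2)"
      define J where "J H = (LBINT x. v x powr (2 * s - 1) * - Lv x * (\<kappa> * (H x * \<psi> x))\<^sup>2)" for H
      have intF: "integrable lborel (\<lambda>x. f x * (\<psi> x)\<^sup>2)"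
        by (intro integrable_bdd_support continuous_intros cf \<psi>(6) bdd_support_mult(2) \<psi>(8))
      have supp: "bdd_support (\<lambda>x. u x * \<psi> x)" using \<psi>(7) by (rule bdd_support_mult(2))
      have up: "0 \<le> u x * \<psi> x" for x using u(2)[of x] \<psi>(2) by simp
      \<comment> \<open>only the last integral depends on the regularisation \<open>d\<close>\<close>
      have est: "F - (3 * M1 + M2) * I \<le> s\<^sup>2 / (2 * s - 1) * J (?h d)" if d: "0 < d" "d \<le> r" for d
      proof -
        let ?y = "\<lambda>x. v x powr s * (\<kappa> * (?h d x * \<psi> x))"
        obtain H where H: "has_gradient ?y H"
          and H_le: "(LBINT x. H x \<bullet> H x) \<le> s\<^sup>2 / (2 * s - 1) * J (?h d) + M2 * I"
          using second[rule_format, of r \<rho> \<psi> P Q d] r cut d unfolding J_def I by blast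
        have suppH: "bdd_support ?y" by (intro bdd_support_mult(2) \<psi>(7))
        have S1: "2 * (LBINT x. g x * ((u x * \<psi> x) * (u x * \<psi> x))) \<le> (LBINT x. E x \<bullet> E x) + (LBINT x. E x \<bullet> E x)"
          unfolding g_def by (rule stable_weightD[OF stab E supp E supp up up])
        have S2: "2 * (LBINT x. g x * ((u x * \<psi> x) * ?y x)) \<le> (LBINT x. E x \<bullet> E x) + (LBINT x. H x \<bullet> H x)"
          unfolding g_def
        proof (rule stable_weightD[OF stab E supp H suppH up])
          show "0 \<le> ?y x" for x
            using regularized_power_pos[OF d(1), of m x] \<kappa> \<psi>(2)[of x] by simp
        qed
        have i1: "integrable lborel (\<lambda>x. g x * ((u x * \<psi> x) * (u x * \<psi> x)))"
          by (intro integrable_bdd_support continuous_intros cg u'(3) \<psi>(6) bdd_support_mult(2) \<psi>(7))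
        have i2: "integrable lborel (\<lambda>x. g x * ((u x * \<psi> x) * ?y x))"
          by (intro integrable_bdd_support continuous_intros cg u'(3) \<psi>(6) pc ch[OF d(1)] bdd_support_mult(2) \<psi>(7))
        have "2 * F = (LBINT x. 2 * (f x * (\<psi> x)\<^sup>2))" by (simp add: F_def)
        also have "\<dots> \<le> (LBINT x. g x * ((u x * \<psi> x) * (u x * \<psi> x)) + g x * ((u x * \<psi> x) * ?y x))"
        proof (rule integral_mono)
          fix x
          have "\<kappa> * weight m x \<le> \<kappa> * ?h d x"
            using regularized_power_ge_weight[OF m(1) d(1), of x] \<kappa> by simp
          then have "\<omega> x \<le> v x powr s * (\<kappa> * ?h d x)"
            by (simp add: \<omega>_def mult.commute[of _ "v x powr s"] mult_left_mono)
          then have "g x * (u x * (u x + \<omega> x)) \<le> g x * (u x * (u x + v x powr s * (\<kappa> * ?h d x)))"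
            using g0[of x] u(2)[of x] by (intro mult_left_mono) auto
          then have "2 * f x \<le> g x * (u x * (u x + v x powr s * (\<kappa> * ?h d x)))"
            using pt(1)[of x] by linarith
          then have "2 * f x * (\<psi> x)\<^sup>2 \<le> g x * (u x * (u x + v x powr s * (\<kappa> * ?h d x))) * (\<psi> x)\<^sup>2"
            by (intro mult_right_mono) auto
          then show "2 * (f x * (\<psi> x)\<^sup>2) \<le> g x * ((u x * \<psi> x) * (u x * \<psi> x)) + g x * ((u x * \<psi> x) * ?y x)"
            by (simp add: power2_eq_square algebra_simps)
        qed (use i1 i2 intF in auto)
        also have "\<dots> = (LBINT x. g x * ((u x * \<psi> x) * (u x * \<psi> x))) + (LBINT x. g x * ((u x * \<psi> x) * ?y x))"
          by (rule Bochner_Integration.integral_add[OF i1 i2])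
        finally have "4 * F \<le> 3 * (LBINT x. E x \<bullet> E x) + (LBINT x. H x \<bullet> H x)"
          using S1 S2 by linarith
        then show ?thesis using E_le H_le by (simp add: algebra_simps F_def)
      qed
      have "F - (3 * M1 + M2) * I \<le> s\<^sup>2 / (2 * s - 1) * J (weight m)"
      proof (rule LIMSEQ_le_const, unfold J_def, rule tendsto_mult_left, rule regularized_power_limit[OF _ _ \<psi>(6,7) r(1) m(1)])
        show "continuous_on UNIV (\<lambda>x. v x powr (2 * s - 1) * - Lv x)" by (intro continuous_intros pc v')
        show "0 \<le> v x powr (2 * s - 1) * - Lv x" for x
          unfolding v(3) using weight_nonneg[of b x] by simp
        show "\<exists>k0. \<forall>k\<ge>k0. F - (3 * M1 + M2) * I \<le> s\<^sup>2 / (2 * s - 1) *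
            (LBINT x. v x powr (2 * s - 1) * - Lv x * (\<kappa> * (?h (r / real (Suc k)) x * \<psi> x))\<^sup>2)"
        proof (intro exI allI impI)
          show "F - (3 * M1 + M2) * I \<le> s\<^sup>2 / (2 * s - 1) *
            (LBINT x. v x powr (2 * s - 1) * - Lv x * (\<kappa> * (?h (r / real (Suc k)) x * \<psi> x))\<^sup>2)" for k
            by (rule est[unfolded J_def]) (use r in \<open>auto simp: divide_simps\<close>)
        qed
      qed
      also have "\<dots> = B * (LBINT x. s * (v x powr (2 * s - 1) * - Lv x * (\<kappa> * (weight m x * \<psi> x))\<^sup>2))"
        by (simp add: B_def J_def power2_eq_square)
      also have "\<dots> \<le> B * F"
        unfolding F_def
      proof (intro mult_left_mono integral_mono intF)
        have "bdd_support (\<lambda>x. (\<kappa> * (weight m x * \<psi> x))\<^sup>2)"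
          by (rule bdd_support_vanish[OF \<psi>(7)]) simp
        then show "integrable lborel (\<lambda>x. s * (v x powr (2 * s - 1) * - Lv x * (\<kappa> * (weight m x * \<psi> x))\<^sup>2))"
          by (intro integrable_bdd_support continuous_intros pc v' \<psi>(6) weight_continuous m bdd_support_mult(2))
        fix x
        have "v x powr (2 * s - 1) = v x powr (2 * s) / v x" using v(2)[of x] by (simp add: powr_diff)
        then have "s * (v x powr (2 * s - 1) * - Lv x * (\<kappa> * (weight m x * \<psi> x))\<^sup>2)
            = s * ((\<omega> x)\<^sup>2 / v x * (weight b x * u x powr q)) * (\<psi> x)\<^sup>2"
          by (simp add: \<omega>_def power_mult_distrib powr_square[OF v(2)] v(3) mult_ac)
        also have "\<dots> \<le> f x * (\<psi> x)\<^sup>2" using pt(2)[of x] by (intro mult_right_mono) auto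
        finally show "s * (v x powr (2 * s - 1) * - Lv x * (\<kappa> * (weight m x * \<psi> x))\<^sup>2) \<le> f x * (\<psi> x)\<^sup>2" .
      qed (use B in auto)
      finally show ?thesis using B by (simp add: F_def field_simps)
    qed
    have one: "1\<^sup>2 / (2 * 1 - 1) * y = y" for y :: real by simp
    show "\<exists>B. test_bound u 1 f M1 B"
      unfolding test_bound_def u1 one using bound by blast
  next
    show "0 \<le> f x" "f x = u x powr (2 * 1 - 1) * - Lu x" for x
      using u(2)[of x] by (simp_all add: f_def weight_nonneg u(3))
  qed simp
  then show ?thesis unfolding f_def .
qed

section \<open>From the Caccioppoli estimate to decay\<close>

text \<open>The correlation of \<open>w\<close> with its translate by \<open>sz\<close> equals the square integral at \<open>s = 0\<close>; its derivative in \<open>s\<close>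
is bounded by Young's inequality, and the mean value theorem gives the claim.\<close>

lemma translation_estimate:
  fixes w :: "real^'n::finite \<Rightarrow> real"
  assumes w: "has_gradient w E" "bdd_support w"
  shows "(LBINT x. (w x)\<^sup>2) \<le> 2 * (LBINT x. w x * w (x + z)) + (norm z)\<^sup>2 * (LBINT x. E x \<bullet> E x)"
proof -
  note cont = has_gradient_continuous[OF w(1)]
  obtain r where r: "\<And>x. norm x > r \<Longrightarrow> w x = 0"
    using w(2) by (auto simp: bdd_support_def)
  have i2: "integrable lborel (\<lambda>x. (w x)\<^sup>2)"
    by (rule integrable_bdd_support, intro continuous_intros cont, rule bdd_supportI[of r]) (simp add: r)
  have iE: "integrable lborel (\<lambda>x. E x \<bullet> E x)" by (rule integrable_gradient_norm[OF w])
  have shift: "(LBINT x. f (c + x)) = (LBINT x. f x)" "integrable lborel (\<lambda>x. f (c + x))"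
    if "integrable lborel f" for f :: "real^'n \<Rightarrow> real" and c
  proof -
    show "(LBINT x. f (c + x)) = (LBINT x. f x)"
      using integral_affine[of f 1 c] that by (simp add: borel_measurable_integrable)
    have "integrable (distr lborel borel ((+) c)) f" using that by (simp add: lborel_distr_plus)
    then show "integrable lborel (\<lambda>x. f (c + x))"
      using that by (subst (asm) integrable_distr_eq) (auto dest: borel_measurable_integrable)
  qed
  define m where "m s = (LBINT x. w x * w (x + s *\<^sub>R z))" for s
  define m' where "m' s = (LBINT x. w x * (E (x + s *\<^sub>R z) \<bullet> z))" for s
  have deriv: "(m has_real_derivative m' s) (at s)" for s
    unfolding m_def[abs_def] m'_def
  proof (rule DERIV_integral_parameter)
    show "((\<lambda>t. w x * w (x + t *\<^sub>R z)) has_real_derivative w x * (E (x + t *\<^sub>R z) \<bullet> z)) (at t)" for t x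
    proof -
      have "((\<lambda>t. x + t *\<^sub>R z) has_derivative (\<lambda>h. h *\<^sub>R z)) (at t)"
        by (rule derivative_eq_intros refl)+ simp
      from has_derivative_compose[OF this has_gradientD[OF w(1)]]
      have "((\<lambda>t. w (x + t *\<^sub>R z)) has_real_derivative (E (x + t *\<^sub>R z) \<bullet> z)) (at t)"
        by (simp add: has_field_derivative_def mult.commute[of _ "_ \<bullet> _"])
      then show ?thesis by (rule DERIV_cmult)
    qed
    show "continuous_on (UNIV \<times> UNIV) (\<lambda>(t, x). w x * (E (x + t *\<^sub>R z) \<bullet> z))"
      unfolding split_beta
      by (intro continuous_intros continuous_on_compose2[OF cont(2)] continuous_on_compose2[OF cont(1)]) auto
    show "continuous_on UNIV (\<lambda>x. w x * w (x + t *\<^sub>R z))" for t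
      by (intro continuous_intros continuous_on_compose2[OF cont(1)] cont) auto
    show "w x * w (x + t *\<^sub>R z) = 0" "w x * (E (x + t *\<^sub>R z) \<bullet> z) = 0" if "norm x > r" for t x
      using r[OF that] by auto
  qed auto
  let ?A = "LBINT x. (w x)\<^sup>2" and ?B = "LBINT x. E x \<bullet> E x"
  have lower: "- (?A / 2 + (norm z)\<^sup>2 * ?B / 2) \<le> m' s" for s
  proof -
    let ?g = "\<lambda>x. (w x)\<^sup>2 / 2 + (norm z)\<^sup>2 / 2 * (E (s *\<^sub>R z + x) \<bullet> E (s *\<^sub>R z + x))"
    have ig: "integrable lborel ?g" using i2 shift(2)[OF iE, of "s *\<^sub>R z"] by simp
    have "- m' s = (LBINT x. - (w x * (E (x + s *\<^sub>R z) \<bullet> z)))" by (simp add: m'_def)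
    also have "\<dots> \<le> (LBINT x. ?g x)"
    proof (rule integral_mono[OF _ ig])
      show "integrable lborel (\<lambda>x. - (w x * (E (x + s *\<^sub>R z) \<bullet> z)))"
        by (rule integrable_bdd_support, intro continuous_intros continuous_on_compose2[OF cont(2)] cont, simp,
            rule bdd_supportI[of r]) (simp add: r)
      fix x
      have "\<bar>E (x + s *\<^sub>R z) \<bullet> z\<bar> \<le> norm (E (x + s *\<^sub>R z)) * norm z" by (rule Cauchy_Schwarz_ineq2)
      then have "\<bar>w x\<bar> * \<bar>E (x + s *\<^sub>R z) \<bullet> z\<bar> \<le> \<bar>w x\<bar> * (norm (E (x + s *\<^sub>R z)) * norm z)"
        by (intro mult_left_mono) auto
      also have "\<dots> \<le> (\<bar>w x\<bar>\<^sup>2 + (norm (E (x + s *\<^sub>R z)) * norm z)\<^sup>2) / 2"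
        using sum_squares_bound[of "\<bar>w x\<bar>" "norm (E (x + s *\<^sub>R z)) * norm z"] by simp
      finally show "- (w x * (E (x + s *\<^sub>R z) \<bullet> z)) \<le> ?g x"
        by (simp add: abs_mult[symmetric] power_mult_distrib power2_norm_eq_inner[symmetric] add.commute abs_le_iff mult.commute add_divide_distrib)
    qed
    also have "\<dots> = ?A / 2 + (norm z)\<^sup>2 / 2 * ?B"
      using i2 shift[OF iE, of "s *\<^sub>R z"] by simp
    finally show ?thesis by simp
  qed
  obtain \<xi> where "m 1 - m 0 = (1 - 0) * m' \<xi>"
    using MVT2[of 0 1 m m'] deriv by auto
  then have "m 0 - m 1 \<le> ?A / 2 + (norm z)\<^sup>2 * ?B / 2" using lower[of \<xi>] by simp
  moreover have "m 0 = ?A" "m 1 = (LBINT x. w x * w (x + z))"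
    by (simp_all add: m_def power2_eq_square)
  ultimately show ?thesis by (simp add: field_simps)
qed

text \<open>Averaging the translation estimate over a cube of side \<open>h\<close>: by Tonelli the correlations integrate to at
most the square of the integral of \<open>w\<close>. This local form of Nash's inequality takes the place of the
Sobolev embedding.\<close>

lemma nash_inequality:
  fixes w :: "real^'n::finite \<Rightarrow> real"
  assumes w: "has_gradient w E" "bdd_support w" and nn: "\<And>x. 0 \<le> w x" and h: "0 < h"
  shows "(LBINT x. (w x)\<^sup>2) \<le> 2 / h ^ CARD('n) * (LBINT x. w x)\<^sup>2 + (real CARD('n) * h)\<^sup>2 * (LBINT x. E x \<bullet> E x)"
proof -
  note cont = has_gradient_continuous[OF w(1)]
  let ?A = "LBINT x. (w x)\<^sup>2" and ?B = "LBINT x. E x \<bullet> E x" and ?I = "LBINT x. w x"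
  have iw: "integrable lborel w" by (rule integrable_bdd_support[OF cont(1) w(2)])
  have meas[measurable]: "w \<in> borel_measurable borel" using iw by (simp add: borel_measurable_integrable)
  have B0: "0 \<le> ?B" by (intro Bochner_Integration.integral_nonneg) simp
  have I0: "0 \<le> ?I" using nn by (intro Bochner_Integration.integral_nonneg)
  define b where "b = ((\<chi> i. h) :: real^'n)"
  define c where "c = (?A - (real CARD('n) * h)\<^sup>2 * ?B) / 2"
  have box: "emeasure lborel (cbox 0 b) = ennreal (h ^ CARD('n))"
  proof -
    have "(\<Prod>i\<in>Basis. (b - 0) \<bullet> i) = h ^ CARD('n)"
    proof -
      have "b \<bullet> i = h" if "i \<in> Basis" for i
        using that by (auto simp: b_def Basis_vec_def inner_axis)
      then show ?thesis by simp
    qed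
    moreover have "0 \<bullet> i \<le> b \<bullet> i" if "i \<in> Basis" for i
      using that h by (auto simp: b_def Basis_vec_def inner_axis)
    ultimately show ?thesis by (simp add: emeasure_lborel_cbox)
  qed
  have pointwise: "ennreal c \<le> (\<integral>\<^sup>+x. ennreal (w x * w (x + z)) \<partial>lborel)" if z: "z \<in> cbox 0 b" for z
  proof -
    have "norm z \<le> (\<Sum>i\<in>UNIV. \<bar>z $ i\<bar>)" by (rule norm_le_l1_cart)
    also have "\<dots> \<le> (\<Sum>i\<in>(UNIV :: 'n set). h)"
      using z by (intro sum_mono) (auto simp: mem_box_cart b_def)
    finally have "norm z \<le> real CARD('n) * h" by simp
    then have "(norm z)\<^sup>2 * ?B \<le> (real CARD('n) * h)\<^sup>2 * ?B"
      using B0 by (intro mult_right_mono power_mono) auto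
    then have "c \<le> (LBINT x. w x * w (x + z))"
      using translation_estimate[OF w, of z] by (simp add: c_def)
    moreover have "integrable lborel (\<lambda>x. w x * w (x + z))"
      by (intro integrable_bdd_support continuous_intros continuous_on_compose2[OF cont(1)] cont(1) bdd_support_mult(1) w) auto
    ultimately show ?thesis
      using nn by (subst nn_integral_eq_integral) (auto intro: ennreal_leI)
  qed
  have "ennreal (c * h ^ CARD('n)) \<le> ennreal c * emeasure lborel (cbox 0 b)"
  proof (cases "0 \<le> c")
    case True then show ?thesis using h by (simp add: box ennreal_mult)
  next
    case False
    then have "c * h ^ CARD('n) \<le> 0" using h by (simp add: mult_le_0_iff)
    then show ?thesis by (simp add: ennreal_neg)
  qed
  also have "\<dots> = (\<integral>\<^sup>+z. ennreal c * indicator (cbox 0 b) z \<partial>lborel)"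
    by (subst nn_integral_cmult_indicator) auto
  also have "\<dots> \<le> (\<integral>\<^sup>+z. (\<integral>\<^sup>+x. ennreal (w x * w (x + z)) \<partial>lborel) \<partial>lborel)"
    using pointwise by (intro nn_integral_mono) (auto simp: indicator_def)
  also have "\<dots> = (\<integral>\<^sup>+x. (\<integral>\<^sup>+z. ennreal (w x * w (x + z)) \<partial>lborel) \<partial>lborel)"
    by (rule lborel_pair.Fubini'[of "\<lambda>x z. ennreal (w x * w (x + z))"]) measurable
  also have "\<dots> = (\<integral>\<^sup>+x. ennreal (w x) * ennreal ?I \<partial>lborel)"
  proof (rule nn_integral_cong)
    fix x
    have "(\<integral>\<^sup>+z. ennreal (w x * w (x + z)) \<partial>lborel) = ennreal (w x) * (\<integral>\<^sup>+z. ennreal (w (x + z)) \<partial>lborel)"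
      using nn by (subst nn_integral_cmult[symmetric]) (auto simp: ennreal_mult)
    also have "(\<integral>\<^sup>+z. ennreal (w (x + z)) \<partial>lborel) = (\<integral>\<^sup>+z. ennreal (w z) \<partial>distr lborel borel ((+) x))"
      by (subst nn_integral_distr) auto
    also have "\<dots> = ennreal ?I"
      using nn iw by (simp add: lborel_distr_plus nn_integral_eq_integral)
    finally show "(\<integral>\<^sup>+z. ennreal (w x * w (x + z)) \<partial>lborel) = ennreal (w x) * ennreal ?I" .
  qed
  also have "\<dots> = ennreal ?I * ennreal ?I"
    using nn iw by (subst nn_integral_multc) (auto simp: nn_integral_eq_integral)
  also have "\<dots> = ennreal (?I\<^sup>2)" using I0 by (simp add: ennreal_mult power2_eq_square)
  finally have "c * h ^ CARD('n) \<le> ?I\<^sup>2" by (simp add: ennreal_le_iff)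
  then have "c \<le> ?I\<^sup>2 / h ^ CARD('n)" using h by (simp add: pos_le_divide_eq)
  then show ?thesis by (simp add: c_def field_simps)
qed

text \<open>The first-power integral of \<open>w \<le> u\<^sup>t\<close> in Nash's inequality is split at a level \<open>L\<close> of \<open>u\<close>. Below \<open>L\<close> one has
\<open>u\<^sup>t \<le> L\<^sup>t\<^sup>-\<^sup>1 u\<close>. Above \<open>L\<close> the Cauchy-Schwarz inequality is used, since the superlevel set has measure at most
\<open>I / L\<close>; for \<open>L\<close> a large multiple of \<open>I / h\<^sup>N\<close> this part is absorbed. Hence the first power of \<open>u\<close> suffices
as a priori information, whatever \<open>t\<close> is.\<close>

lemma interpolated_nash:
  fixes w u :: "real^'n::finite \<Rightarrow> real" and t h \<rho> :: real
  assumes w: "has_gradient w E" and nn: "\<And>x. 0 \<le> w x" and h: "0 < h"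
    and u: "continuous_on UNIV u" "\<And>x. 0 < u x" and t: "1 \<le> t"
    and le: "\<And>x. w x \<le> u x powr t" and supp: "\<And>x. \<rho> \<le> norm x \<Longrightarrow> w x = 0"
    and I: "ball_integral u \<rho> \<le> I" "0 < I" and S: "0 < (LBINT x. (w x)\<^sup>2)"
  shows "(LBINT x. (w x)\<^sup>2) \<le> 8 powr (2 * t - 1) * h powr (- (real CARD('n) * (2 * t - 1))) * I powr (2 * t)
     + 2 * (real CARD('n) * h)\<^sup>2 * (LBINT x. E x \<bullet> E x)"
proof -
  let ?S = "LBINT x. (w x)\<^sup>2" and ?B = "LBINT x. E x \<bullet> E x"
  note cont = has_gradient_continuous[OF w]
  have bw: "bdd_support w" by (rule bdd_supportI[of \<rho>]) (simp add: supp)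
  have iw: "integrable lborel w" by (rule integrable_bdd_support[OF cont(1) bw])
  have i2: "integrable lborel (\<lambda>x. (w x)\<^sup>2)"
    by (rule integrable_bdd_support, intro continuous_intros cont, rule bdd_supportI[of \<rho>]) (simp add: supp)
  define H where "H = h ^ CARD('n)"
  have H: "0 < H" using h by (simp add: H_def)
  define L where "L = 8 * I / H"
  have L: "0 < L" using I H by (simp add: L_def)
  \<comment> \<open>the parameter that balances the two terms of Young's inequality above the level \<open>L\<close>\<close>
  define l where "l = sqrt (I / (L * ?S))"
  have l: "0 < l" using I L S by (simp add: l_def)
  have pw: "w x \<le> indicator (cball 0 \<rho>) x * ((L powr (t - 1) + 1 / (2 * l * L)) * u x) + l / 2 * (w x)\<^sup>2" for x
  proof (cases "norm x \<le> \<rho>")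
    case True
    have nn2: "0 \<le> u x / (2 * l * L)" "0 \<le> l / 2 * (w x)\<^sup>2" "0 \<le> L powr (t - 1) * u x"
      using u(2)[of x] l L by (auto simp: less_imp_le)
    have "w x \<le> L powr (t - 1) * u x + u x / (2 * l * L) + l / 2 * (w x)\<^sup>2"
    proof (cases "u x \<le> L")
      case True
      have "w x \<le> u x powr (t - 1) * u x"
        using le[of x] u(2)[of x] powr_add[of "u x" "t - 1" 1] by simp
      also have "\<dots> \<le> L powr (t - 1) * u x"
        using True u(2)[of x] t by (intro mult_right_mono powr_mono2) auto
      finally show ?thesis using nn2 by linarith
    next
      case False
      have "0 \<le> (l * w x - 1)\<^sup>2" by simp
      then have "2 * l * w x \<le> l\<^sup>2 * (w x)\<^sup>2 + 1" by (simp add: power2_eq_square algebra_simps)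
      then have "w x \<le> l / 2 * (w x)\<^sup>2 + 1 / (2 * l)"
        using l by (simp add: field_simps power2_eq_square)
      also have "1 / (2 * l) \<le> u x / (2 * l * L)"
        using False l L by (simp add: field_simps)
      finally show ?thesis using nn2 by linarith
    qed
    then show ?thesis using True by (simp add: algebra_simps)
  next
    case False then show ?thesis using supp[of x] by simp
  qed
  have "(LBINT x. w x) \<le> (LBINT x. indicator (cball 0 \<rho>) x * ((L powr (t - 1) + 1 / (2 * l * L)) * u x) + l / 2 * (w x)\<^sup>2)"
    using i2 integrable_on_ball[of "\<lambda>x. (L powr (t - 1) + 1 / (2 * l * L)) * u x" \<rho>] u(1)
    by (intro integral_mono[OF iw] pw Bochner_Integration.integrable_add) (auto intro: continuous_on_mult_left)
  also have "\<dots> = ball_integral (\<lambda>x. (L powr (t - 1) + 1 / (2 * l * L)) * u x) \<rho> + l / 2 * ?S"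
    unfolding ball_integral_def
    using i2 integrable_on_ball[of "\<lambda>x. (L powr (t - 1) + 1 / (2 * l * L)) * u x" \<rho>] u(1)
    by (subst Bochner_Integration.integral_add) (auto intro: continuous_on_mult_left)
  also have "\<dots> = (L powr (t - 1) + 1 / (2 * l * L)) * ball_integral u \<rho> + l / 2 * ?S"
    by (simp only: ball_integral_cmult)
  also have "\<dots> \<le> (L powr (t - 1) + 1 / (2 * l * L)) * I + l / 2 * ?S"
    using I l L by (intro add_right_mono mult_left_mono) auto
  also have "\<dots> = L powr (t - 1) * I + sqrt (I * ?S / L)"
  proof -
    have root: "sqrt (I / (L * y)) * y = sqrt (I * y / L)" "1 / (sqrt (I / (L * y)) * L) * I = sqrt (I * y / L)"
      if y: "0 < y" for y
    proof -
      have yy: "sqrt y * sqrt y = y" and II: "sqrt I * sqrt I = I" and LL: "sqrt L * sqrt L = L"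
        using y I L by auto
      have nz: "sqrt y \<noteq> 0" "sqrt I \<noteq> 0" "sqrt L \<noteq> 0" using y I L by auto
      have alg: "A / (B * D) * (D * D) = A * D / B" "1 / (A / (B * D) * (B * B)) * (A * A) = A * D / B"
        if "A \<noteq> 0" "B \<noteq> 0" "D \<noteq> 0" for A B D :: real
        using that by (simp_all add: field_simps)
      have "sqrt (I / (L * y)) * y = sqrt I / (sqrt L * sqrt y) * (sqrt y * sqrt y)"
        by (simp only: real_sqrt_divide real_sqrt_mult yy)
      also have "\<dots> = sqrt (I * y / L)" unfolding alg(1)[OF nz(2,3,1)] by (simp only: real_sqrt_divide real_sqrt_mult)
      finally show "sqrt (I / (L * y)) * y = sqrt (I * y / L)" .
      have "1 / (sqrt (I / (L * y)) * L) * I = 1 / (sqrt I / (sqrt L * sqrt y) * (sqrt L * sqrt L)) * (sqrt I * sqrt I)"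
        by (simp only: real_sqrt_divide real_sqrt_mult II LL)
      also have "\<dots> = sqrt (I * y / L)" unfolding alg(2)[OF nz(2,3,1)] by (simp only: real_sqrt_divide real_sqrt_mult)
      finally show "1 / (sqrt (I / (L * y)) * L) * I = sqrt (I * y / L)" .
    qed
    have "l * ?S = sqrt (I * ?S / L)" "1 / (l * L) * I = sqrt (I * ?S / L)"
      unfolding l_def by (rule root[OF S])+
    moreover have "(c + 1 / (2 * l * L)) * I + l / 2 * y = c * I + (1 / (l * L) * I) / 2 + (l * y) / 2" for c y
      by (simp add: algebra_simps)
    ultimately show ?thesis by simp
  qed
  finally have w1: "(LBINT x. w x) \<le> L powr (t - 1) * I + sqrt (I * ?S / L)" .
  have "(LBINT x. w x)\<^sup>2 \<le> (L powr (t - 1) * I + sqrt (I * ?S / L))\<^sup>2"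
    using w1 nn by (intro power_mono Bochner_Integration.integral_nonneg) auto
  also have "\<dots> \<le> 2 * (L powr (t - 1) * I)\<^sup>2 + 2 * (sqrt (I * ?S / L))\<^sup>2"
    using sum_squares_bound[of "L powr (t - 1) * I" "sqrt (I * ?S / L)"] by (simp add: power2_sum)
  also have "\<dots> = 2 * (L powr (t - 1) * I)\<^sup>2 + 2 * (H * ?S / 8)"
    using I L S H by (simp add: L_def)
  finally have w2: "(LBINT x. w x)\<^sup>2 \<le> 2 * (L powr (t - 1) * I)\<^sup>2 + 2 * (H * ?S / 8)" .
  have "?S \<le> 2 / H * (LBINT x. w x)\<^sup>2 + (real CARD('n) * h)\<^sup>2 * ?B"
    using nash_inequality[OF w bw nn h] by (simp add: H_def)
  also have "\<dots> \<le> 2 / H * (2 * (L powr (t - 1) * I)\<^sup>2 + 2 * (H * ?S / 8)) + (real CARD('n) * h)\<^sup>2 * ?B"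
    using w2 H by (intro add_right_mono mult_left_mono) auto
  also have "\<dots> = 4 / H * (L powr (t - 1) * I)\<^sup>2 + ?S / 2 + (real CARD('n) * h)\<^sup>2 * ?B"
    using H by (simp add: field_simps)
  finally have "?S \<le> 8 / H * (L powr (t - 1) * I)\<^sup>2 + 2 * (real CARD('n) * h)\<^sup>2 * ?B" by simp
  also have "8 / H * (L powr (t - 1) * I)\<^sup>2 = 8 powr (2 * t - 1) * h powr (- (real CARD('n) * (2 * t - 1))) * I powr (2 * t)"
  proof -
    have "(L powr (t - 1))\<^sup>2 = 8 powr (2 * t - 2) * I powr (2 * t - 2) * H powr (- (2 * t - 2))"
    proof -
      have "(L powr (t - 1))\<^sup>2 = L powr (2 * t - 2)" using powr_square[OF L, of "t - 1"] by (simp add: algebra_simps)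
      also have "\<dots> = 8 powr (2 * t - 2) * I powr (2 * t - 2) / H powr (2 * t - 2)"
        by (simp only: L_def powr_divide powr_mult)
      finally show ?thesis by (simp only: powr_minus_divide) simp
    qed
    moreover have "I powr (2 * t) = I powr (2 * t - 2) * I\<^sup>2"
      using I powr_add[of I "2 * t - 2" 2] by simp
    moreover have "(8::real) powr (2 * t - 1) = 8 powr (2 * t - 2) * 8"
      using powr_add[of "8::real" "2 * t - 2" 1] by simp
    moreover have "h powr (- (real CARD('n) * (2 * t - 1))) = H powr (- (2 * t - 2)) / H"
    proof -
      have "H = h powr real CARD('n)" using h by (simp add: H_def powr_realpow)
      then have "H powr (- (2 * t - 1)) = h powr (- (real CARD('n) * (2 * t - 1)))"
        by (simp only: powr_powr mult_minus_right)
      moreover have "H powr (- (2 * t - 1)) = H powr (- (2 * t - 2)) / H"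
        using H powr_add[of H "- (2 * t - 2)" "- 1"] by (simp add: powr_minus_divide)
      ultimately show ?thesis by simp
    qed
    ultimately show ?thesis by (simp add: power_mult_distrib)
  qed
  finally show ?thesis .
qed

text \<open>Taking the supremum over \<open>r\<close> of \<open>(2R - r)\<^sup>\<alpha> G(r)\<close>, which is finite, absorbs the term on the right at once; no
sequence of radii is needed.\<close>

lemma absorbing_iteration:
  fixes G :: "real \<Rightarrow> real"
  assumes R: "0 < R" and al: "0 \<le> \<alpha>" and G0: "\<And>r. 0 \<le> G r" and mono: "\<And>r s. r \<le> s \<Longrightarrow> G r \<le> G s"
    and step: "\<And>r. R \<le> r \<Longrightarrow> r < 2 * R \<Longrightarrow>
      (2 * R - r) powr \<alpha> * G r \<le> A + 1/2 * ((2 * R - (r + 2 * R) / 2) powr \<alpha> * G ((r + 2 * R) / 2))"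
  shows "R powr \<alpha> * G R \<le> 2 * A"
proof -
  let ?F = "\<lambda>r. (2 * R - r) powr \<alpha> * G r"
  define S where "S = (SUP r\<in>{R..<2*R}. ?F r)"
  have bdd: "bdd_above (?F ` {R..<2*R})"
  proof (rule bdd_aboveI2)
    fix r assume "r \<in> {R..<2*R}"
    then show "?F r \<le> R powr \<alpha> * G (2 * R)"
      using al G0 mono by (intro mult_mono powr_mono2) auto
  qed
  have "?F r \<le> A + 1/2 * S" if r: "r \<in> {R..<2*R}" for r
  proof -
    have "?F ((r + 2 * R) / 2) \<le> S"
      unfolding S_def using r by (intro cSUP_upper bdd) auto
    then show ?thesis using step[of r] r by auto
  qed
  then have "S \<le> A + 1/2 * S"
    unfolding S_def[symmetric] using R by (subst (1) S_def, intro cSUP_least) auto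
  moreover have "?F R \<le> S" unfolding S_def using R by (intro cSUP_upper bdd) auto
  ultimately show ?thesis by simp
qed

text \<open>Nash's inequality at a scale that is a small multiple \<open>e\<close> of \<open>\<rho> - r\<close> makes the energy from the Caccioppoli
estimate a small multiple of the square integral over the larger ball, which is absorbed. What
remains bounds the integral of \<open>u\<^sup>2\<^sup>t\<close> by its scaling rate \<open>R\<^sup>N\<^sup>-\<^sup>2\<^sup>t\<^sup>\<beta>\<close>, and the Caccioppoli estimate gains the
factor \<open>R\<^sup>-\<^sup>2\<close>.\<close>

lemma caccioppoli_decay:
  fixes u :: "real^'n::finite \<Rightarrow> real" and t \<beta> :: real
  assumes cacc: "caccioppoli (\<lambda>x. u x powr t) f" and t: "1 \<le> t"
    and u: "continuous_on UNIV u" "\<And>x. 0 < u x"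
    and decay: "0 < C0" "\<And>R. 0 < R \<Longrightarrow> ball_integral u R \<le> C0 * R powr (real CARD('n) - \<beta>)"
  obtains C where "0 < C" "\<And>R. 0 < R \<Longrightarrow> ball_integral f R \<le> C * R powr (real CARD('n) - 2 - 2 * t * \<beta>)"
proof -
  let ?N = "real CARD('n)"
  obtain C1 where C1: "0 < C1" and C1_prop: "\<And>r \<rho>. 0 < r \<and> r < \<rho> \<and> \<rho> \<le> 2 * r \<Longrightarrow>
    (\<exists>w E. has_gradient w E \<and> (\<forall>x. norm x \<le> r \<longrightarrow> w x = u x powr t) \<and> (\<forall>x. 0 \<le> w x \<and> w x \<le> u x powr t) \<and>
      (\<forall>x. \<rho> \<le> norm x \<longrightarrow> w x = 0) \<and>
      (LBINT x. E x \<bullet> E x) \<le> C1 / (\<rho> - r)\<^sup>2 * ball_integral (\<lambda>x. (u x powr t)\<^sup>2) \<rho> \<and>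
      ball_integral f r \<le> C1 / (\<rho> - r)\<^sup>2 * ball_integral (\<lambda>x. (u x powr t)\<^sup>2) \<rho>)"
    using cacc unfolding caccioppoli_def by blast
  define G where "G r = ball_integral (\<lambda>x. (u x powr t)\<^sup>2) r" for r
  have cg: "continuous_on UNIV (\<lambda>x. (u x powr t)\<^sup>2)" by (intro continuous_intros powr_continuous u)
  have G0: "0 \<le> G r" for r unfolding G_def by (rule ball_integral_nonneg) simp
  have Gmono: "G r \<le> G s" if "r \<le> s" for r s
    unfolding G_def using that by (intro ball_integral_mono_radius cg) auto
  define \<alpha> where "\<alpha> = ?N * (2 * t - 1)"
  have \<alpha>: "0 \<le> \<alpha>" using t by (simp add: \<alpha>_def)
  \<comment> \<open>small enough that the factor in front of the larger ball becomes one half\<close>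
  define e where "e = sqrt (1 / (4 * ?N\<^sup>2 * C1 * 2 powr \<alpha>))"
  have e: "0 < e" using C1 by (simp add: e_def)
  have e2: "2 * ?N\<^sup>2 * C1 * 2 powr \<alpha> * e\<^sup>2 = 1/2"
    using C1 by (simp add: e_def field_simps)
  define D where "D = 8 powr (2 * t - 1) * (2 / e) powr \<alpha>"
  have D: "0 < D" using e by (simp add: D_def)
  have G_le: "R powr \<alpha> * G R \<le> 2 * (D * ball_integral u (2 * R) powr (2 * t))" if R: "0 < R" for R
  proof (rule absorbing_iteration[OF R \<alpha> G0 Gmono])
    fix r assume r: "R \<le> r" "r < 2 * R"
    define \<rho> where "\<rho> = (r + 2 * R) / 2"
    have \<rho>: "0 < r \<and> r < \<rho> \<and> \<rho> \<le> 2 * r" "\<rho> \<le> 2 * R" "2 * R - r = 2 * (\<rho> - r)" "2 * R - \<rho> = \<rho> - r"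
      using r R by (auto simp: \<rho>_def field_simps)
    obtain w E where w: "has_gradient w E" "\<And>x. norm x \<le> r \<Longrightarrow> w x = u x powr t" "\<And>x. 0 \<le> w x \<and> w x \<le> u x powr t"
      "\<And>x. \<rho> \<le> norm x \<Longrightarrow> w x = 0" and E: "(LBINT x. E x \<bullet> E x) \<le> C1 / (\<rho> - r)\<^sup>2 * G \<rho>"
      using C1_prop[OF \<rho>(1)] unfolding G_def by blast
    define I where "I = ball_integral u (2 * R)"
    have I: "0 < I" unfolding I_def using R u by (intro ball_integral_pos) (auto simp: less_imp_le)
    have I\<rho>: "ball_integral u \<rho> \<le> I"
      unfolding I_def using \<rho> u by (intro ball_integral_mono_radius) (auto simp: less_imp_le)
    let ?S = "LBINT x. (w x)\<^sup>2"
    have "integrable lborel (\<lambda>x. (w x)\<^sup>2)"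
      by (rule integrable_bdd_support, intro continuous_intros has_gradient_continuous(1)[OF w(1)], rule bdd_supportI[of \<rho>]) (simp add: w(4))
    then have GS: "G r \<le> ?S"
      unfolding G_def by (intro ball_integral_le_integral cg) (auto simp: w(2))
    have "0 < G r" unfolding G_def using \<rho> u by (intro ball_integral_pos cg) (auto simp: less_imp_neq[THEN not_sym])
    then have S0: "0 < ?S" using GS by simp
    let ?h = "e * (\<rho> - r)"
    have h: "0 < ?h" using e \<rho> by simp
    have "?S \<le> 8 powr (2 * t - 1) * ?h powr (- \<alpha>) * I powr (2 * t) + 2 * (?N * ?h)\<^sup>2 * (LBINT x. E x \<bullet> E x)"
      unfolding \<alpha>_def
      by (rule interpolated_nash[OF w(1) _ h u t _ w(4) I\<rho> I S0]) (use w(3) in auto)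
    also have "\<dots> \<le> 8 powr (2 * t - 1) * ?h powr (- \<alpha>) * I powr (2 * t) + 2 * (?N * ?h)\<^sup>2 * (C1 / (\<rho> - r)\<^sup>2 * G \<rho>)"
      using E by (intro add_left_mono mult_left_mono) auto
    finally have "G r \<le> 8 powr (2 * t - 1) * ?h powr (- \<alpha>) * I powr (2 * t) + 2 * (?N * ?h)\<^sup>2 * (C1 / (\<rho> - r)\<^sup>2 * G \<rho>)"
      using GS by simp
    then have "(2 * R - r) powr \<alpha> * G r \<le> (2 * R - r) powr \<alpha> * (8 powr (2 * t - 1) * ?h powr (- \<alpha>) * I powr (2 * t) + 2 * (?N * ?h)\<^sup>2 * (C1 / (\<rho> - r)\<^sup>2 * G \<rho>))"
      by (intro mult_left_mono) auto
    also have "\<dots> = D * I powr (2 * t) + (2 * ?N\<^sup>2 * C1 * 2 powr \<alpha> * e\<^sup>2) * ((\<rho> - r) powr \<alpha> * G \<rho>)"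
    proof -
      have d: "0 < \<rho> - r" using \<rho> by simp
      have "(2 * R - r) powr \<alpha> = 2 powr \<alpha> * (\<rho> - r) powr \<alpha>" by (simp only: \<rho>(3) powr_mult)
      moreover have "2 powr \<alpha> * (\<rho> - r) powr \<alpha> * ?h powr (- \<alpha>) = (2 / e) powr \<alpha>"
      proof -
        have hp: "?h powr (- \<alpha>) = 1 / (e powr \<alpha> * (\<rho> - r) powr \<alpha>)"
          by (simp only: powr_minus_divide powr_mult)
        show ?thesis unfolding hp powr_divide using d e by simp
      qed
      moreover have "(?N * ?h)\<^sup>2 * (C1 / (\<rho> - r)\<^sup>2 * G \<rho>) = ?N\<^sup>2 * e\<^sup>2 * C1 * G \<rho>"
        using d by (simp add: power_mult_distrib)
      ultimately show ?thesis unfolding D_def by (simp add: algebra_simps)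
    qed
    also have "\<dots> = D * I powr (2 * t) + 1/2 * ((2 * R - \<rho>) powr \<alpha> * G \<rho>)" by (simp only: e2 \<rho>(4))
    finally show "(2 * R - r) powr \<alpha> * G r \<le> D * ball_integral u (2 * R) powr (2 * t)
        + 1/2 * ((2 * R - (r + 2 * R) / 2) powr \<alpha> * G ((r + 2 * R) / 2))"
      by (simp add: I_def \<rho>_def)
  qed
  define C where "C = 2 * C1 * D * C0 powr (2 * t) * 4 powr ((?N - \<beta>) * (2 * t)) * 2 powr (- \<alpha>)"
  show ?thesis
  proof (rule that[of C])
    show "0 < C" using C1 D decay by (simp add: C_def)
    fix R :: real assume R: "0 < R"
    have "ball_integral f R \<le> C1 / (2 * R - R)\<^sup>2 * G (2 * R)"
      using C1_prop[of R "2 * R"] R by (auto simp: G_def)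
    also have "G (2 * R) \<le> (2 * R) powr (- \<alpha>) * (2 * (D * ball_integral u (4 * R) powr (2 * t)))"
      using G_le[of "2 * R"] R by (simp add: powr_minus field_simps)
    also have "ball_integral u (4 * R) powr (2 * t) \<le> (C0 * (4 * R) powr (?N - \<beta>)) powr (2 * t)"
      using decay(2)[of "4 * R"] R t u by (intro powr_mono2 ball_integral_nonneg) (auto simp: less_imp_le)
    finally have "ball_integral f R \<le> C1 / R\<^sup>2 * ((2 * R) powr (- \<alpha>) * (2 * (D * (C0 * (4 * R) powr (?N - \<beta>)) powr (2 * t))))"
      using C1 D by (simp add: mult_left_mono divide_right_mono)
    also have "\<dots> = C * R powr (?N - 2 - 2 * t * \<beta>)"
    proof -
      have ex: "?N - 2 - 2 * t * \<beta> = - 2 + (- \<alpha>) + (?N - \<beta>) * (2 * t)"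
        by (simp add: \<alpha>_def algebra_simps)
      have "R powr (?N - 2 - 2 * t * \<beta>) = 1 / R\<^sup>2 * R powr (- \<alpha>) * R powr ((?N - \<beta>) * (2 * t))"
        unfolding ex powr_add using R by (simp add: powr_minus_divide)
      moreover have "(C0 * (4 * R) powr (?N - \<beta>)) powr (2 * t) = C0 powr (2 * t) * 4 powr ((?N - \<beta>) * (2 * t)) * R powr ((?N - \<beta>) * (2 * t))"
        using R decay by (simp only: powr_mult powr_powr mult.assoc)
      moreover have "(2 * R) powr (- \<alpha>) = 2 powr (- \<alpha>) * R powr (- \<alpha>)" using R by (simp add: powr_mult)
      ultimately show ?thesis by (simp add: C_def)
    qed
    finally show "ball_integral f R \<le> C * R powr (?N - 2 - 2 * t * \<beta>)" .
  qed
qed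

section \<open>Nonexistence of stable solutions\<close>

theorem theorem4:
  fixes N :: nat and p q a b :: real
  assumes "N = CARD('n::finite)" and "N \<ge> 1"
    and "p \<ge> 0" and "q \<ge> 0" and "a \<ge> 0" and "b \<ge> 0"
    and "p * q > 1"
    and "0 \<le> a - b" and "a - b \<le> (real N - 2) * (p - q)"
    and "p * q * (q + 1) / (p + 1) \<ge> 1"
    and "real N < 2 + 2 * ((p * (b + 2) + a + 2) / (p * q - 1)) *
           (sqrt (p * q * (q + 1) / (p + 1)) +
            sqrt (p * q * (q + 1) / (p + 1) - sqrt (p * q * (q + 1) / (p + 1))))"
  shows "\<not> (\<exists>u v :: real^'n \<Rightarrow> real. positive_stable_solution a b p q u v)"
proof
  assume "\<exists>u v :: real^'n \<Rightarrow> real. positive_stable_solution a b p q u v"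
  then obtain u v \<zeta> \<eta> :: "real^'n \<Rightarrow> real" where
    C2: "C_k 2 u" "C_k 2 v" "C_k 2 \<zeta>" "C_k 2 \<eta>"
    and pos: "\<And>x. 0 < u x" "\<And>x. 0 < v x" "\<And>x. 0 < \<zeta> x" "\<And>x. 0 < \<eta> x"
    and equ: "\<And>x. - laplacian u x = weight a x * v x powr p" "\<And>x. - laplacian v x = weight b x * u x powr q"
    and eqs: "\<And>x. - laplacian \<zeta> x = p * weight a x * v x powr (p - 1) * \<eta> x"
      "\<And>x. - laplacian \<eta> x = q * weight b x * u x powr (q - 1) * \<zeta> x"
    unfolding positive_stable_solution_def positive_classical_solution_def pointwise_stable_def by blast
  note lap = C2[THEN C_k_2_has_laplacian]
  note cont = has_laplacianD(3)[OF lap(1)] has_laplacianD(3)[OF lap(2)]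
  have Lu: "laplacian u x = - (weight a x * v x powr p)" and Lv: "laplacian v x = - (weight b x * u x powr q)"
    and Lz: "laplacian \<zeta> x = - (p * weight a x * v x powr (p - 1) * \<eta> x)"
    and Le: "laplacian \<eta> x = - (q * weight b x * u x powr (q - 1) * \<zeta> x)" for x
    using equ[of x] eqs[of x] by linarith+
  note par = assms(3-7)
  define \<beta> where "\<beta> = (p * (b + 2) + a + 2) / (p * q - 1)"
  have \<beta>: "0 < \<beta>" using par by (auto simp: \<beta>_def intro!: divide_pos_pos add_nonneg_pos)
  have high: "2 + \<beta> \<le> real CARD('n)"
    using no_positive_solution_low_dimension[OF par lap(1) pos(1) Lu lap(2) pos(2) Lv] unfolding \<beta>_def by (meson not_le)
  have pq: "q \<le> p"
  proof -
    have "0 \<le> (real N - 2) * (p - q)" using assms(8,9) by linarith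
    then show ?thesis using high \<beta> by (simp add: assms(1) zero_le_mult_iff)
  qed
  have ab: "a - b \<le> (real CARD('n) - 2) * (p - q)" using assms(1,9) by simp
  note comp = component_comparison[OF par lap(1) pos(1) Lu lap(2) pos(2) Lv pq assms(8) ab]
  have stab: "stable_weight (\<lambda>x. sqrt (p * weight a x * v x powr (p - 1) * (q * weight b x * u x powr (q - 1))))"
    unfolding stable_weight_def
  proof (intro allI impI, elim conjE, rule stability_inequality[OF lap(3) pos(3) Lz lap(4) pos(4) Le])
    show "continuous_on UNIV (\<lambda>x. p * weight a x * v x powr (p - 1))" "continuous_on UNIV (\<lambda>x. q * weight b x * u x powr (q - 1))"
      by (intro continuous_intros weight_continuous powr_continuous par cont pos)+
    show "0 \<le> p * weight a x * v x powr (p - 1)" "0 \<le> q * weight b x * u x powr (q - 1)" for x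
      by (intro mult_nonneg_nonneg par weight_nonneg powr_ge_zero)+
  qed auto
  define X where "X = p * q * (q + 1) / (p + 1)"
  define K where "K = sqrt X"
  have X1: "1 \<le> X" using assms(10) by (simp add: X_def)
  have K: "1 \<le> K" "K\<^sup>2 = X" using X1 by (auto simp: K_def)
  have dim: "real CARD('n) < 2 + 2 * \<beta> * (K + sqrt (X - K))"
    using assms(1,11) by (simp add: \<beta>_def K_def X_def)
  obtain t where t: "1 \<le> t" "real CARD('n) - 2 < 2 * t * \<beta>"
    and cacc: "caccioppoli (\<lambda>x. u x powr t) (\<lambda>x. weight a x * v x powr p * u x powr (2 * t - 1))"
  proof (cases "X = 1")
    case True
    have "caccioppoli (\<lambda>x. u x powr 1) (\<lambda>x. weight a x * v x powr p * u x)"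
      by (rule caccioppoli_critical[OF par lap(1) pos(1) Lu lap(2) pos(2) Lv stab comp assms(8) ab True[unfolded X_def]])
    moreover have "(\<lambda>x. weight a x * v x powr p * u x powr (2 * 1 - 1)) = (\<lambda>x. weight a x * v x powr p * u x)"
      using pos(1) by (simp add: fun_eq_iff abs_of_pos)
    moreover have "real CARD('n) - 2 < 2 * 1 * \<beta>" using dim True by (simp add: K_def)
    ultimately show ?thesis by (intro that[of 1]) (simp_all only: order_refl)
  next
    case False
    then have X: "1 < X" using X1 by simp
    then have K1: "1 < K" by (simp add: K_def)
    define D where "D = sqrt (K\<^sup>2 - K)"
    have D: "0 < D" "D\<^sup>2 = K\<^sup>2 - K" using K1 by (auto simp: D_def power2_eq_square)
    have "(real CARD('n) - 2) / (2 * \<beta>) < K + D" using dim \<beta> by (simp add: D_def K(2) field_simps)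
    \<comment> \<open>any exponent between \<open>K\<close> and the larger root of \<open>t\<^sup>2 = K (2t - 1)\<close> is coercive; near this root the dimension bound is met\<close>
    then obtain t where t: "max K ((real CARD('n) - 2) / (2 * \<beta>)) < t" "t < K + D"
      using dense[of "max K ((real CARD('n) - 2) / (2 * \<beta>))" "K + D"] D by auto
    have "(t - K)\<^sup>2 < D\<^sup>2" using t by (intro power_strict_mono) auto
    then have "(t - K)\<^sup>2 < K\<^sup>2 - K" by (simp only: D(2))
    then have "t\<^sup>2 < K * (2 * t - 1)" by (simp add: power2_eq_square algebra_simps)
    then have "t\<^sup>2 / (2 * t - 1) < K" using t K1 by (simp add: pos_divide_less_eq)
    then have "t\<^sup>2 / (2 * t - 1) < sqrt (p * q * (q + 1) / (p + 1))" by (simp only: K_def X_def)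
    moreover have "1/2 < t" using t K1 by simp
    ultimately have "caccioppoli (\<lambda>x. u x powr t) (\<lambda>x. weight a x * v x powr p * u x powr (2 * t - 1))"
      by (intro caccioppoli_coercive[OF par(1-4) lap(1) pos(1) Lu cont(2) pos(2) stab comp])
    moreover have "real CARD('n) - 2 < 2 * t * \<beta>"
    proof -
      have "(real CARD('n) - 2) / (2 * \<beta>) < t" using t(1) by simp
      then have "real CARD('n) - 2 < t * (2 * \<beta>)" using \<beta> by (simp only: pos_divide_less_eq mult_pos_pos zero_less_numeral)
      then show ?thesis by (simp only: mult_ac)
    qed
    moreover have "1 \<le> t" using t K1 by simp
    ultimately show ?thesis by (intro that)
  qed
  let ?f = "\<lambda>x. weight a x * v x powr p * u x powr (2 * t - 1)"
  obtain C0 where C0: "0 < C0" "\<And>R. 0 < R \<Longrightarrow> ball_integral u R \<le> C0 * R powr (real CARD('n) - \<beta>)"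
    using ball_integral_decay[OF par lap(1) pos(1) Lu lap(2) pos(2) Lv] unfolding \<beta>_def by blast
  obtain C where C: "0 < C" "\<And>R. 0 < R \<Longrightarrow> ball_integral ?f R \<le> C * R powr (real CARD('n) - 2 - 2 * t * \<beta>)"
    using caccioppoli_decay[OF cacc t(1) cont(1) pos(1) C0] by blast
  have cf: "continuous_on UNIV ?f"
    by (intro continuous_intros weight_continuous powr_continuous par cont pos)
  have f0: "0 \<le> ?f x" for x by (simp add: weight_nonneg)
  have f1: "0 < ball_integral ?f 1"
  proof (rule ball_integral_pos[OF cf f0])
    show "0 < ?f x" if "x \<noteq> 0" for x
      using weight_pos[OF that, of a] pos(1,2)[of x] by simp
  qed simp
  obtain R where R: "1 \<le> R" "\<And>S. S \<ge> R \<Longrightarrow> C * S powr (real CARD('n) - 2 - 2 * t * \<beta>) < ball_integral ?f 1"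
    by (rule powr_neg_exponent_arbitrarily_small[of "real CARD('n) - 2 - 2 * t * \<beta>" "ball_integral ?f 1" C])
      (use t(2) f1 C(1) in auto)
  have "ball_integral ?f 1 \<le> ball_integral ?f R"
    by (rule ball_integral_mono_radius[OF cf f0 R(1)])
  also have "\<dots> \<le> C * R powr (real CARD('n) - 2 - 2 * t * \<beta>)" using C(2)[of R] R by simp
  also have "\<dots> < ball_integral ?f 1" by (rule R(2)) simp
  finally show False by simp
qed

end
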